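(* Let $d\ge 2$, let $\Omega\subseteq\mathbb{R}^d$ be a bounded open set, let $K\subseteq\Omega$ be a compact set with $\mathrm{Cap}_\Omega(K)=0$, and let $\{K_\varepsilon\}_{\varepsilon>0}$ be a family of compact subsets of $\Omega$ concentrating to $K$. Let $\lambda_N=\lambda_N(\Omega)$ be a Dirichlet eigenvalue of $\Omega$ of multiplicity $m$, where $N$ is the smallest index $i$ with $\lambda_i(\Omega)=\lambda_N$, so that $\lambda_N=\lambda_{N+1}=\dots=\lambda_{N+m-1}$. Let $E(\lambda_N)$ be the associated eigenspace and, for $\varepsilon>0$, let $\lambda_i^\varepsilon=\lambda_i(\Omega\setminus K_\varepsilon)$. Set \[ \chi_\varepsilon^2\equiv\sup\{\mathrm{Cap}_\Omega(K_\varepsilon,u)\,:\,u\in E(\lambda_N),\ \|u\|_{L^2(\Omega)}=1\}, \] and let $\mu_1^\varepsilon\le\dots\le\mu_m^\varepsilon$ be the eigenvalues (with respect to the $L^2(\Omega)$ inner product) of the symmetric bilinear form $r_\varepsilon$ on $E(\lambda_N)$ defined by \[ r_\varepsilon(u,v)\equiv\int_\Omega\nabla V_{K_\varepsilon,u}\cdot\nabla V_{K_\varepsilon,v}\,dx-\lambda_N\int_\Omega V_{K_\varepsilon,u}V_{K_\varepsilon,v}\,dx . \] Then, for every $i\in\{1,\dots,m\}$, \[ \lambda_{N+i-1}^\varepsilon=\lambda_N+\mu_i^\varepsilon+o(\chi_\varepsilon^2)\quad\text{as }\varepsilon\to0 . \]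
   Context: For a bounded open $U\subseteq\mathbb{R}^d$, $0<\lambda_1(U)\le\lambda_2(U)\le\dots$ denote the eigenvalues of the Dirichlet Laplacian on $U$ (the eigenvalues of the quadratic form $\int_U|\nabla u|^2dx$ on $H^1_0(U)$ with respect to the $L^2(U)$ inner product), repeated according to multiplicity. For a compact $K\subseteq\Omega$, $H^1_0(\Omega\setminus K)$ is identified with a closed subspace of $H^1_0(\Omega)$ by extension by zero. The standard capacity is $\mathrm{Cap}_\Omega(K)=\inf\{\int_\Omega|\nabla f|^2dx: f\in H^1_0(\Omega),\ f-\eta_K\in H^1_0(\Omega\setminus K)\}$, where $\eta_K$ is a smooth function with support in $\Omega$ equal to $1$ near $K$. For $u\in H^1_0(\Omega)$, the potential $V_{K,u}$ is the unique minimizer of $\int_\Omega|\nabla f|^2dx$ over $\{f\in H^1_0(\Omega): f-u\in H^1_0(\Omega\setminus K)\}$, and the $u$-capacity is $\mathrm{Cap}_\Omega(K,u)=\int_\Omega|\nabla V_{K,u}|^2dx$. A family $\{K_\varepsilon\}_{\varepsilon>0}$ of compact subsets of $\Omega$ concentrates to $K$ if for every open $U$ with $K\subseteq U\subseteq\Omega$ there is $\varepsilon_U>0$ such that $K_\varepsilon\subseteq U$ for all $\varepsilon<\varepsilon_U$. *)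

theory Defs
  imports "HOL-Analysis.Analysis" "HOL-Library.Landau_Symbols"
begin

primrec iter_dderiv :: "'a::euclidean_space list \<Rightarrow> ('a \<Rightarrow> real) \<Rightarrow> ('a \<Rightarrow> real)" where
  "iter_dderiv [] f = f"
| "iter_dderiv (v # vs) f = (\<lambda>x. frechet_derivative (iter_dderiv vs f) (at x) v)"

definition smooth_fun :: "('a::euclidean_space \<Rightarrow> real) \<Rightarrow> bool" where
  "smooth_fun f \<longleftrightarrow> (\<forall>vs x. iter_dderiv vs f differentiable (at x))"

definition fsupport :: "('a::euclidean_space \<Rightarrow> real) \<Rightarrow> 'a set" where
  "fsupport f = closure {x. f x \<noteq> 0}"

definition test_functions :: "'a::euclidean_space set \<Rightarrow> ('a \<Rightarrow> real) set" where
  "test_functions U = {f. smooth_fun f \<and> compact (fsupport f) \<and> fsupport f \<subseteq> U}"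

definition grad_fun :: "('a::euclidean_space \<Rightarrow> real) \<Rightarrow> 'a \<Rightarrow> 'a" where
  "grad_fun f x = (\<Sum>b\<in>Basis. frechet_derivative f (at x) b *\<^sub>R b)"

text \<open>Functions are defined on the whole space (extension by zero).\<close>
definition L2fun :: "('a::euclidean_space \<Rightarrow> real) \<Rightarrow> bool" where
  "L2fun u \<longleftrightarrow> u \<in> borel_measurable lebesgue \<and> integrable lebesgue (\<lambda>x. (u x)\<^sup>2)"

definition L2vec :: "('a::euclidean_space \<Rightarrow> 'a) \<Rightarrow> bool" where
  "L2vec g \<longleftrightarrow> g \<in> borel_measurable lebesgue \<and> integrable lebesgue (\<lambda>x. (norm (g x))\<^sup>2)"

definition l2_inner :: "('a::euclidean_space \<Rightarrow> real) \<Rightarrow> ('a \<Rightarrow> real) \<Rightarrow> real" where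
  "l2_inner u v = (\<integral>x. u x * v x \<partial>lebesgue)"

definition weak_gradient :: "'a::euclidean_space set \<Rightarrow> ('a \<Rightarrow> real) \<Rightarrow> ('a \<Rightarrow> 'a) \<Rightarrow> bool" where
  "weak_gradient U u g \<longleftrightarrow>
     (\<forall>\<phi>\<in>test_functions U. \<forall>v.
        integrable lebesgue (\<lambda>x. u x * frechet_derivative \<phi> (at x) v) \<and>
        integrable lebesgue (\<lambda>x. \<phi> x * (g x \<bullet> v)) \<and>
        (\<integral>x. u x * frechet_derivative \<phi> (at x) v \<partial>lebesgue) = - (\<integral>x. \<phi> x * (g x \<bullet> v) \<partial>lebesgue))"

text \<open>H^1_0(U), as a set of functions on the whole space (extended by zero): the closure
  of C_c^infinity(U) in the H^1 norm.\<close>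
definition H10 :: "'a::euclidean_space set \<Rightarrow> ('a \<Rightarrow> real) set" where
  "H10 U = {u. L2fun u \<and> (\<exists>g. L2vec g \<and> weak_gradient UNIV u g \<and>
      (\<exists>\<phi>s. (\<forall>n. \<phi>s n \<in> test_functions U) \<and>
          (\<lambda>n. \<integral>x. (\<phi>s n x - u x)\<^sup>2 \<partial>lebesgue) \<longlonglongrightarrow> 0 \<and>
          (\<lambda>n. \<integral>x. (norm (grad_fun (\<phi>s n) x - g x))\<^sup>2 \<partial>lebesgue) \<longlonglongrightarrow> 0))}"

text \<open>The (a.e. unique) weak gradient on the whole space.\<close>
definition wgrad :: "('a::euclidean_space \<Rightarrow> real) \<Rightarrow> 'a \<Rightarrow> 'a" where
  "wgrad u = (SOME g. L2vec g \<and> weak_gradient UNIV u g)"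

definition dirichlet_form :: "('a::euclidean_space \<Rightarrow> real) \<Rightarrow> ('a \<Rightarrow> real) \<Rightarrow> real" where
  "dirichlet_form u v = (\<integral>x. wgrad u x \<bullet> wgrad v x \<partial>lebesgue)"

definition energy :: "('a::euclidean_space \<Rightarrow> real) \<Rightarrow> real" where
  "energy u = (\<integral>x. (norm (wgrad u x))\<^sup>2 \<partial>lebesgue)"

text \<open>k-th Dirichlet eigenvalue (k \<ge> 1) of U, repeated with multiplicity, given by the
  Courant--Fischer min-max values of the form on H^1_0(U) w.r.t. L^2(U).
  An L^2-orthonormal family f_0..f_{k-1} spans a k-dimensional subspace.\<close>
definition dir_eigenvalue :: "'a::euclidean_space set \<Rightarrow> nat \<Rightarrow> real" where
  "dir_eigenvalue U k = Inf {Sup {energy (\<lambda>x. \<Sum>j<k. c j * f j x) | c. (\<Sum>j<k. (c j)\<^sup>2) = 1}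
        | f. (\<forall>j<k. f j \<in> H10 U) \<and>
             (\<forall>i<k. \<forall>j<k. l2_inner (f i) (f j) = (if i = j then 1 else 0))}"

definition dir_eigenspace :: "'a::euclidean_space set \<Rightarrow> real \<Rightarrow> ('a \<Rightarrow> real) set" where
  "dir_eigenspace U lam = {u \<in> H10 U. \<forall>v\<in>H10 U. dirichlet_form u v = lam * l2_inner u v}"

definition u_capacity :: "'a::euclidean_space set \<Rightarrow> 'a set \<Rightarrow> ('a \<Rightarrow> real) \<Rightarrow> real" where
  "u_capacity \<Omega> K u = Inf {energy f | f. f \<in> H10 \<Omega> \<and> (\<lambda>x. f x - u x) \<in> H10 (\<Omega> - K)}"

text \<open>The potential V_{K,u}: the minimizer (unique up to null sets).\<close>
definition potential :: "'a::euclidean_space set \<Rightarrow> 'a set \<Rightarrow> ('a \<Rightarrow> real) \<Rightarrow> ('a \<Rightarrow> real)" where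
  "potential \<Omega> K u = (SOME f. f \<in> H10 \<Omega> \<and> (\<lambda>x. f x - u x) \<in> H10 (\<Omega> - K) \<and>
       energy f = u_capacity \<Omega> K u)"

definition capacity :: "'a::euclidean_space set \<Rightarrow> 'a set \<Rightarrow> real" where
  "capacity \<Omega> K = u_capacity \<Omega> K
     (SOME \<eta>. \<eta> \<in> test_functions \<Omega> \<and> (\<exists>W. open W \<and> K \<subseteq> W \<and> (\<forall>x\<in>W. \<eta> x = 1)))"

definition concentrates_to :: "'a::euclidean_space set \<Rightarrow> (real \<Rightarrow> 'a set) \<Rightarrow> 'a set \<Rightarrow> bool" where
  "concentrates_to \<Omega> Ks K \<longleftrightarrow>
     (\<forall>U. open U \<and> K \<subseteq> U \<and> U \<subseteq> \<Omega> \<longrightarrow>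
        (\<exists>eU>0. \<forall>\<epsilon>. 0 < \<epsilon> \<and> \<epsilon> < eU \<longrightarrow> Ks \<epsilon> \<subseteq> U))"

definition chi2 :: "'a::euclidean_space set \<Rightarrow> 'a set \<Rightarrow> real \<Rightarrow> real" where
  "chi2 \<Omega> Ke lam = Sup {u_capacity \<Omega> Ke u | u. u \<in> dir_eigenspace \<Omega> lam \<and> l2_inner u u = 1}"

definition r_form :: "'a::euclidean_space set \<Rightarrow> 'a set \<Rightarrow> real \<Rightarrow> ('a \<Rightarrow> real) \<Rightarrow> ('a \<Rightarrow> real) \<Rightarrow> real" where
  "r_form \<Omega> Ke lam u v =
     dirichlet_form (potential \<Omega> Ke u) (potential \<Omega> Ke v)
     - lam * l2_inner (potential \<Omega> Ke u) (potential \<Omega> Ke v)"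

definition r_eigenvalues :: "'a::euclidean_space set \<Rightarrow> 'a set \<Rightarrow> real \<Rightarrow> nat \<Rightarrow> (nat \<Rightarrow> real) \<Rightarrow> bool" where
  "r_eigenvalues \<Omega> Ke lam m \<mu> \<longleftrightarrow>
     (\<forall>i j. 1 \<le> i \<and> i \<le> j \<and> j \<le> m \<longrightarrow> \<mu> i \<le> \<mu> j) \<and>
     (\<exists>e. (\<forall>i\<in>{1..m}. e i \<in> dir_eigenspace \<Omega> lam) \<and>
          (\<forall>i\<in>{1..m}. \<forall>j\<in>{1..m}. l2_inner (e i) (e j) = (if i = j then 1 else 0)) \<and>
          (\<forall>u\<in>dir_eigenspace \<Omega> lam.
              AE x in lebesgue. u x = (\<Sum>i=1..m. l2_inner u (e i) * e i x)) \<and>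
          (\<forall>i\<in>{1..m}. \<forall>v\<in>dir_eigenspace \<Omega> lam.
              r_form \<Omega> Ke lam (e i) v = \<mu> i * l2_inner (e i) v))"

end

theory Submission
  imports Defs
begin

text \<open>
  Write \<open>q\<close> for the Dirichlet form, \<open>b\<close> for the \<open>L\<^sup>2\<close> inner product and \<open>a = q - \<lambda>\<^sub>N b\<close>. The form domain
  \<open>M = H\<^sup>1\<^sub>0(\<Omega> - K\<^sub>\<epsilon>)\<close> is a closed subspace of \<open>H = H\<^sup>1\<^sub>0(\<Omega>)\<close>, and \<open>V\<^sub>u\<close> is the \<open>q\<close>-orthogonal projection of \<open>u\<close> to
  the complement of \<open>M\<close>. As \<open>a(u, -)\<close> vanishes for \<open>u \<in> E(\<lambda>\<^sub>N)\<close>, one has the exact identity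
  \<open>a(u - V\<^sub>u, v - V\<^sub>v) = r\<^sub>\<epsilon>(u, v)\<close> on \<open>E(\<lambda>\<^sub>N)\<close>. The spectral gaps on both sides of \<open>\<lambda>\<^sub>N\<close> yield an \<open>a\<close>-orthogonal
  decomposition \<open>H = F + E(\<lambda>\<^sub>N) + G\<close> with \<open>a\<close> negative definite on the \<open>(N - 1)\<close>-dimensional \<open>F\<close> and coercive on
  \<open>G\<close>, by min-max alone. The upper bound tests the perturbed min-max value with the projection to \<open>M\<close> of \<open>F\<close> and
  the first eigenvectors of \<open>r\<^sub>\<epsilon>\<close>; for the lower bound every competing subspace of \<open>M\<close> contains a unit vector that is
  \<open>a\<close>-orthogonal to \<open>F\<close> and \<open>b\<close>-orthogonal to the first eigenvectors of \<open>r\<^sub>\<epsilon>\<close>.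
  The errors are \<open>o(\<chi>\<^sub>\<epsilon>\<^sup>2)\<close> because of two facts. Since \<open>K\<close> has zero capacity, test functions supported off \<open>K\<close> are
  dense in \<open>H\<close>, so \<open>V\<^sub>w \<rightarrow> 0\<close> for every fixed \<open>w\<close>. With Rellich's theorem this gives \<open>b(v, v) \<le> o(1) q(v, v)\<close>
  uniformly on the complement of \<open>M\<close>.
\<close>

subsection \<open>Symmetric bilinear forms\<close>

text \<open>The difficulty is the order of the errors. Besides the values of
  \<open>r\<^sub>\<epsilon>\<close>, projecting to \<open>M\<close> creates cross terms between the
  eigenspace part, whose potential has energy norm at most \<open>x\<close>, and the parts in
  \<open>F\<close> or \<open>G\<close>. Such terms are linear in \<open>x\<close>, hence too large
  by themselves. Orthogonality to \<open>M\<close> removes their energy part or leaves it paired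
  with the small potentials \<open>wf j\<close>; the rest is an \<open>L\<^sup>2\<close> pairing
  with a potential. Either way a factor \<open>k\<close> is gained, and completing the square
  against the definite form on \<open>F\<close> or \<open>G\<close> turns \<open>k * x\<close> into
  \<open>k\<^sup>2 * x\<^sup>2\<close>, where \<open>k\<close> may be taken arbitrarily small. The
  eigenbasis of \<open>r\<^sub>\<epsilon>\<close> may jump with \<open>\<epsilon>\<close>. Hence
  \<open>f\<close>, \<open>D\<close> and \<open>c\<close> are fixed once; they depend on the
  eigenspace only through orthogonality to it, so one threshold serves all small
  \<open>\<epsilon>\<close>. Functions are kept as representatives instead of classes, so both forms
  are only semidefinite.\<close>

locale sym_form =
  fixes B :: "'v::real_vector \<Rightarrow> 'v \<Rightarrow> real"
  assumes bilin: "bilinear B" and sym: "B x y = B y x"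
begin

lemma lsum: "B (\<Sum>i\<in>S. f i) y = (\<Sum>i\<in>S. B (f i) y)"
proof -
  interpret linear "\<lambda>x. B x y" using bilin by (simp add: bilinear_def)
  show ?thesis by (rule sum)
qed

lemma rsum: "B y (\<Sum>i\<in>S. f i) = (\<Sum>i\<in>S. B y (f i))"
  by (simp add: sym[of y] lsum)

lemma lmul: "B (c *\<^sub>R x) y = c * B x y" and rmul: "B x (c *\<^sub>R y) = c * B x y"
  using bilinear_lmul[OF bilin] bilinear_rmul[OF bilin] by auto

lemmas lin = bilinear_ladd[OF bilin] bilinear_radd[OF bilin] bilinear_lsub[OF bilin]
  bilinear_rsub[OF bilin] bilinear_lneg[OF bilin] bilinear_rneg[OF bilin]
  bilinear_lzero[OF bilin] bilinear_rzero[OF bilin] lmul rmul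

definition ortho :: "nat \<Rightarrow> (nat \<Rightarrow> 'v) \<Rightarrow> bool" where
  "ortho k z \<longleftrightarrow> (\<forall>i<k. \<forall>j<k. B (z i) (z j) = (if i = j then 1 else 0))"

lemma ortho_coeff:
  assumes "ortho k z" "i < k"
  shows "B (\<Sum>j<k. c j *\<^sub>R z j) (z i) = c i"
proof -
  have "B (\<Sum>j<k. c j *\<^sub>R z j) (z i) = (\<Sum>j<k. if j = i then c j else 0)"
    unfolding lsum by (intro sum.cong) (use assms in \<open>auto simp: ortho_def lmul\<close>)
  then show ?thesis using assms by simp
qed

lemma ortho_sum:
  assumes "ortho k z"
  shows "B (\<Sum>j<k. c j *\<^sub>R z j) (\<Sum>j<k. d j *\<^sub>R z j) = (\<Sum>j<k. c j * d j)"
proof -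
  have "B (\<Sum>j<k. c j *\<^sub>R z j) (\<Sum>j<k. d j *\<^sub>R z j) = (\<Sum>i<k. d i * B (\<Sum>j<k. c j *\<^sub>R z j) (z i))"
    by (simp add: rsum rmul)
  also have "\<dots> = (\<Sum>i<k. c i * d i)"
    by (intro sum.cong) (auto simp: ortho_coeff[OF assms])
  finally show ?thesis .
qed

end

lemma span_image_lessThan:
  "span (y ` {..<k::nat}) = {\<Sum>j<k. c j *\<^sub>R y j | c. True}" for y :: "nat \<Rightarrow> 'v::real_vector"
proof
  have "subspace {\<Sum>j<k. c j *\<^sub>R y j | c. True}"
    unfolding subspace_def
  proof (intro conjI ballI allI)
    show "0 \<in> {\<Sum>j<k. c j *\<^sub>R y j | c. True}" by (intro CollectI exI[of _ "\<lambda>_. 0"]) simp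
    fix u assume "u \<in> {\<Sum>j<k. c j *\<^sub>R y j | c. True}"
    then obtain c where u: "u = (\<Sum>j<k. c j *\<^sub>R y j)" by blast
    show "r *\<^sub>R u \<in> {\<Sum>j<k. c j *\<^sub>R y j | c. True}" for r
      by (intro CollectI exI[of _ "\<lambda>j. r * c j"]) (simp add: u scaleR_sum_right)
    fix v assume "v \<in> {\<Sum>j<k. c j *\<^sub>R y j | c. True}"
    then obtain d where v: "v = (\<Sum>j<k. d j *\<^sub>R y j)" by blast
    show "u + v \<in> {\<Sum>j<k. c j *\<^sub>R y j | c. True}"
      by (intro CollectI exI[of _ "\<lambda>j. c j + d j"]) (simp add: u v scaleR_add_left sum.distrib)
  qed
  moreover have "y ` {..<k} \<subseteq> {\<Sum>j<k. c j *\<^sub>R y j | c. True}"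
  proof (intro image_subsetI CollectI)
    fix i assume "i \<in> {..<k}"
    then have "y i = (\<Sum>j<k. (if j = i then 1 else 0) *\<^sub>R y j)"
      by (simp add: if_distrib[of "\<lambda>c. c *\<^sub>R _"] sum.If_cases)
    then show "\<exists>c. y i = (\<Sum>j<k. c j *\<^sub>R y j) \<and> True"
      by (intro exI[of _ "\<lambda>j. if j = i then 1 else 0"]) simp
  qed
  ultimately show "span (y ` {..<k}) \<subseteq> {\<Sum>j<k. c j *\<^sub>R y j | c. True}"
    by (rule span_minimal[rotated])
  show "{\<Sum>j<k. c j *\<^sub>R y j | c. True} \<subseteq> span (y ` {..<k})"
    by (auto intro!: span_sum span_scale intro: span_base)
qed

text \<open>Positivity is asked only on nontrivial combinations of \<open>y\<close>, not of the
  whole form. Thus the lemma serves both the \<open>L\<^sup>2\<close> form and the indefinite form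
  \<open>- a\<close>, and the hypothesis contains linear independence.\<close>

lemma (in sym_form) gram_schmidt:
  assumes "\<And>c. \<exists>j<k. c j \<noteq> 0 \<Longrightarrow> B (\<Sum>j<k. c j *\<^sub>R y j) (\<Sum>j<k. c j *\<^sub>R y j) > 0"
  shows "\<exists>z. (\<forall>j<k. z j \<in> span (y ` {..<k})) \<and> ortho k z"
  using assms
proof (induction k)
  case 0
  then show ?case by (auto simp: ortho_def)
next
  case (Suc k)
  have "B (\<Sum>j<k. c j *\<^sub>R y j) (\<Sum>j<k. c j *\<^sub>R y j) > 0" if "\<exists>j<k. c j \<noteq> 0" for c
  proof -
    have "\<exists>j<Suc k. (if j < k then c j else 0) \<noteq> 0" using that by (auto simp: less_Suc_eq)
    from Suc.prems[OF this] show ?thesis by simp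
  qed
  from Suc.IH[OF this] obtain z where z: "\<forall>j<k. z j \<in> span (y ` {..<k})" "ortho k z" by blast
  define v where "v = y k - (\<Sum>j<k. B (y k) (z j) *\<^sub>R z j)"
  have "(\<Sum>j<k. B (y k) (z j) *\<^sub>R z j) \<in> span (y ` {..<k})"
    using z by (auto intro!: span_sum span_scale)
  then obtain c where c: "(\<Sum>j<k. B (y k) (z j) *\<^sub>R z j) = (\<Sum>j<k. c j *\<^sub>R y j)"
    unfolding span_image_lessThan by blast
  \<comment> \<open>The coefficient of \<open>y k\<close> is 1, so the combination is nontrivial and
    the hypothesis makes \<open>B v v\<close> positive.\<close>
  have "v = (\<Sum>j<Suc k. (if j < k then - c j else 1) *\<^sub>R y j)"
    by (simp add: v_def c sum_negf)
  then have vpos: "B v v > 0"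
    by (simp only:) (rule Suc.prems, auto)
  have vz: "B v (z i) = 0" if "i < k" for i
    using ortho_coeff[OF z(2) that] by (simp add: v_def lin)
  define w where "w = z(k := (1 / sqrt (B v v)) *\<^sub>R v)"
  have sp: "span (y ` {..<k}) \<subseteq> span (y ` {..<Suc k})"
    by (rule span_mono) auto
  have vs: "v \<in> span (y ` {..<Suc k})"
    unfolding v_def using z sp by (intro span_diff span_sum span_scale) (auto intro: span_base)
  have "\<forall>j<Suc k. w j \<in> span (y ` {..<Suc k})"
    using z sp vs by (auto simp: w_def less_Suc_eq intro!: span_scale)
  moreover have "ortho (Suc k) w"
    using z vpos vz vz[unfolded sym[of v]] unfolding ortho_def w_def
    by (auto simp: less_Suc_eq lin)
  ultimately show ?case by blast
qed

text \<open>Gaussian elimination on the number of equations: equation \<open>p\<close> either has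
  only zero coefficients, or it is solved for an unknown \<open>r\<close> that is then eliminated
  from the others. All dimension counts of the proof are made in this coefficient form.\<close>

lemma exists_kernel_vector:
  fixes A :: "nat \<Rightarrow> 'i \<Rightarrow> real"
  assumes "finite J" "p < card J"
  shows "\<exists>c. (\<exists>j\<in>J. c j \<noteq> 0) \<and> (\<forall>i<p. (\<Sum>j\<in>J. c j * A i j) = 0)"
  using assms
proof (induction p arbitrary: J A)
  case 0
  then have "J \<noteq> {}" by auto
  then show ?case by (auto intro!: exI[of _ "\<lambda>_. 1"])
next
  case (Suc p)
  show ?case
  proof (cases "\<forall>j\<in>J. A p j = 0")
    case True
    from Suc.IH[of J A] Suc.prems obtain c where
      c: "\<exists>j\<in>J. c j \<noteq> 0" "\<forall>i<p. (\<Sum>j\<in>J. c j * A i j) = 0" by auto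
    then show ?thesis using True by (intro exI[of _ c]) (auto simp: less_Suc_eq)
  next
    case False
    then obtain r where r: "r \<in> J" "A p r \<noteq> 0" by blast
    define A' where "A' = (\<lambda>i j. A i j - A i r * A p j / A p r)"
    have "finite (J - {r})" "p < card (J - {r})" using Suc.prems r by auto
    from Suc.IH[OF this, of A'] obtain c where
      c: "\<exists>j\<in>J - {r}. c j \<noteq> 0" "\<forall>i<p. (\<Sum>j\<in>J - {r}. c j * A' i j) = 0" by blast
    define s where "s = (\<Sum>j\<in>J - {r}. c j * A p j)"
    \<comment> \<open>The value at the pivot \<open>r\<close> is forced by equation
      \<open>p\<close>.\<close>
    define d where "d = c(r := - s / A p r)"
    have *: "(\<Sum>j\<in>J. d j * A i j) = (\<Sum>j\<in>J - {r}. c j * A i j) - s / A p r * A i r" for i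
    proof -
      have "(\<Sum>j\<in>J. d j * A i j) = d r * A i r + (\<Sum>j\<in>J - {r}. d j * A i j)"
        using Suc.prems r by (subst sum.remove[of _ r]) auto
      moreover have "(\<Sum>j\<in>J - {r}. d j * A i j) = (\<Sum>j\<in>J - {r}. c j * A i j)"
        by (intro sum.cong) (auto simp: d_def)
      ultimately show ?thesis by (simp add: d_def)
    qed
    have "(\<Sum>j\<in>J. d j * A i j) = 0" if "i < Suc p" for i
    proof (cases "i = p")
      case True
      then show ?thesis using r by (simp add: * s_def)
    next
      case False
      with that have "i < p" by auto
      with c(2) have "(\<Sum>j\<in>J - {r}. c j * A' i j) = 0" by blast
      moreover have "(\<Sum>j\<in>J - {r}. c j * A' i j) = (\<Sum>j\<in>J - {r}. c j * A i j) - s / A p r * A i r"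
        by (simp add: A'_def s_def right_diff_distrib sum_subtractf sum_divide_distrib sum_distrib_left sum_distrib_right mult_ac)
      ultimately show ?thesis by (simp add: *)
    qed
    moreover have "\<exists>j\<in>J. d j \<noteq> 0" using c(1) by (auto simp: d_def)
    ultimately show ?thesis by blast
  qed
qed

lemma exists_unit_kernel_vector:
  fixes A :: "nat \<Rightarrow> nat \<Rightarrow> real"
  assumes "p < k"
  shows "\<exists>c. (\<Sum>j<k. (c j)\<^sup>2) = 1 \<and> (\<forall>i<p. (\<Sum>j<k. c j * A i j) = 0)"
proof -
  from exists_kernel_vector[of "{..<k}" p A] assms obtain c where
    c: "\<exists>j<k. c j \<noteq> 0" "\<forall>i<p. (\<Sum>j<k. c j * A i j) = 0" by auto
  define s where "s = (\<Sum>j<k. (c j)\<^sup>2)"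
  from c(1) obtain r where r: "r < k" "c r \<noteq> 0" by blast
  have "s > 0" unfolding s_def using r by (intro sum_pos2[of _ r]) auto
  then have "(\<Sum>j<k. (c j / sqrt s)\<^sup>2) = 1"
    by (simp add: power_divide sum_divide_distrib[symmetric] s_def[symmetric])
  moreover have "(\<Sum>j<k. c j / sqrt s * A i j) = 0" if "i < p" for i
    using c(2) that by (simp add: sum_divide_distrib[symmetric])
  ultimately show ?thesis by (intro exI[of _ "\<lambda>j. c j / sqrt s"]) auto
qed

text \<open>Semidefiniteness is all that representatives of functions allow: a nonzero vector may
  vanish almost everywhere.\<close>

locale psd_form = sym_form +
  assumes nonneg: "0 \<le> B x x"
begin

definition nrm :: "'a \<Rightarrow> real" where "nrm x = sqrt (B x x)"

lemma nrm_nonneg: "0 \<le> nrm x" and nrm_sq: "(nrm x)\<^sup>2 = B x x"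
  by (auto simp: nrm_def nonneg)

lemma nrm_le_iff: "0 \<le> t \<Longrightarrow> nrm x \<le> t \<longleftrightarrow> B x x \<le> t\<^sup>2"
  unfolding nrm_def by (metis nonneg real_sqrt_le_iff real_sqrt_unique)

lemma cauchy_schwarz_sq: "(B x y)\<^sup>2 \<le> B x x * B y y"
proof (cases "B y y = 0")
  case True
  have "B x y = 0"
  proof (rule ccontr)
    assume n: "B x y \<noteq> 0"
    \<comment> \<open>As \<open>B y y = 0\<close>, the form is affine along the line through
      \<open>x\<close> in direction \<open>y\<close>; this \<open>t\<close> would give it the value
      -1.\<close>
    define t where "t = - (B x x + 1) / (2 * B x y)"
    have "0 \<le> B (x + t *\<^sub>R y) (x + t *\<^sub>R y)" by (rule nonneg)
    also have "\<dots> = B x x + 2 * t * B x y" using True by (simp add: lin sym[of y x] algebra_simps)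
    also have "\<dots> = -1" using n by (simp add: t_def field_simps)
    finally show False by simp
  qed
  then show ?thesis using True by simp
next
  case False
  then have p: "B y y > 0" using nonneg[of y] by simp
  define t where "t = - B x y / B y y"
  have "0 \<le> B (x + t *\<^sub>R y) (x + t *\<^sub>R y)" by (rule nonneg)
  also have "\<dots> = B x x + 2 * t * B x y + t\<^sup>2 * B y y"
    by (simp add: lin sym[of y x] algebra_simps power2_eq_square)
  also have "\<dots> = B x x - (B x y)\<^sup>2 / B y y" using p by (simp add: t_def field_simps power2_eq_square)
  finally show ?thesis using p by (simp add: field_simps)
qed

lemma cauchy_schwarz: "\<bar>B x y\<bar> \<le> nrm x * nrm y"
proof -
  have "\<bar>B x y\<bar> = sqrt ((B x y)\<^sup>2)" by simp
  also have "\<dots> \<le> sqrt (B x x * B y y)" using cauchy_schwarz_sq by (rule real_sqrt_le_mono)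
  finally show ?thesis by (simp add: nrm_def real_sqrt_mult)
qed

lemma null_right: "B y y = 0 \<Longrightarrow> B x y = 0"
  using cauchy_schwarz_sq[of x y] by simp

lemma nrm_add: "nrm (x + y) \<le> nrm x + nrm y"
proof -
  have "B (x + y) (x + y) \<le> (nrm x + nrm y)\<^sup>2"
    using cauchy_schwarz[of x y] by (simp add: lin sym[of y x] power2_sum nrm_sq)
  then show ?thesis by (simp add: nrm_le_iff nrm_nonneg)
qed

lemma nrm_scale: "nrm (c *\<^sub>R x) = \<bar>c\<bar> * nrm x"
  by (simp add: nrm_def lin real_sqrt_mult mult.assoc[symmetric])

lemma nrm_zero: "nrm 0 = 0" by (simp add: nrm_def lin)

lemma nrm_minus: "nrm (- x) = nrm x" by (simp add: nrm_def lin)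

lemma nrm_diff: "nrm (x - y) \<le> nrm x + nrm y"
  using nrm_add[of x "- y"] by (simp add: nrm_minus)

lemma nrm_diff_commute: "nrm (x - y) = nrm (y - x)"
  using nrm_minus[of "x - y"] by simp

lemma nrm_sum: "nrm (\<Sum>i\<in>S. f i) \<le> (\<Sum>i\<in>S. nrm (f i))"
  by (induction S rule: infinite_finite_induct)
    (auto simp: nrm_zero intro: order_trans[OF nrm_add])

text \<open>Each coefficient is at most the Euclidean norm \<open>s\<close> of all of them. The
  crude sum of the norms is good enough, since the families have fixed finite length.\<close>

lemma nrm_sum_unit:
  fixes k :: nat
  assumes "(\<Sum>j<k. (c j)\<^sup>2) \<le> s\<^sup>2" "0 \<le> s"
  shows "nrm (\<Sum>j<k. c j *\<^sub>R f j) \<le> s * (\<Sum>j<k. nrm (f j))"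
proof -
  have "\<bar>c j\<bar> \<le> s" if "j < k" for j
  proof -
    have "(c j)\<^sup>2 \<le> (\<Sum>j<k. (c j)\<^sup>2)" using that by (intro member_le_sum[where f = "\<lambda>j. (c j)\<^sup>2"]) auto
    with assms have "(c j)\<^sup>2 \<le> s\<^sup>2" by linarith
    then show ?thesis using assms(2) abs_le_square_iff[of "c j" s] by simp
  qed
  then have "(\<Sum>j<k. nrm (c j *\<^sub>R f j)) \<le> (\<Sum>j<k. s * nrm (f j))"
    by (intro sum_mono) (auto simp: nrm_scale intro!: mult_right_mono nrm_nonneg)
  then show ?thesis using nrm_sum[of "\<lambda>j. c j *\<^sub>R f j" "{..<k}"] by (simp add: sum_distrib_left)
qed

lemma bessel:
  assumes "ortho k z"
  shows "(\<Sum>j<k. (B x (z j))\<^sup>2) \<le> B x x"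
proof -
  define p where "p = (\<Sum>j<k. B x (z j) *\<^sub>R z j)"
  have "B p p = (\<Sum>j<k. (B x (z j))\<^sup>2)"
    unfolding p_def ortho_sum[OF assms] by (simp add: power2_eq_square)
  moreover have "B x p = (\<Sum>j<k. (B x (z j))\<^sup>2)"
    by (simp add: p_def rsum rmul power2_eq_square)
  moreover have "0 \<le> B (x - p) (x - p)" by (rule nonneg)
  ultimately show ?thesis by (simp add: lin sym[of p x])
qed

end

subsection \<open>Min-max values\<close>

locale form_pair = q: psd_form q + b: psd_form b
  for q b :: "'v::real_vector \<Rightarrow> 'v \<Rightarrow> real"
begin

definition rayleigh_sup :: "nat \<Rightarrow> (nat \<Rightarrow> 'v) \<Rightarrow> real" where
  "rayleigh_sup k f =
     Sup {q (\<Sum>j<k. c j *\<^sub>R f j) (\<Sum>j<k. c j *\<^sub>R f j) | c. (\<Sum>j<k. (c j)\<^sup>2) = 1}"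

definition minmax :: "'v set \<Rightarrow> nat \<Rightarrow> real" where
  "minmax H k = Inf {rayleigh_sup k f | f. (\<forall>j<k. f j \<in> H) \<and> b.ortho k f}"

text \<open>Needed before the real-valued \<open>Sup\<close> can be used as an upper bound.\<close>

lemma rayleigh_bdd:
  fixes k :: nat
  shows "bdd_above {q (\<Sum>j<k. c j *\<^sub>R f j) (\<Sum>j<k. c j *\<^sub>R f j) | c. (\<Sum>j<k. (c j)\<^sup>2) = 1}"
proof (rule bdd_aboveI)
  fix x assume "x \<in> {q (\<Sum>j<k. c j *\<^sub>R f j) (\<Sum>j<k. c j *\<^sub>R f j) | c. (\<Sum>j<k. (c j)\<^sup>2) = 1}"
  then obtain c where x: "x = q (\<Sum>j<k. c j *\<^sub>R f j) (\<Sum>j<k. c j *\<^sub>R f j)"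
    and c: "(\<Sum>j<k. (c j)\<^sup>2) = 1" by blast
  have "q.nrm (\<Sum>j<k. c j *\<^sub>R f j) \<le> 1 * (\<Sum>j<k. q.nrm (f j))"
    by (rule q.nrm_sum_unit) (use c in auto)
  then show "x \<le> (\<Sum>j<k. q.nrm (f j))\<^sup>2"
    unfolding x by (subst q.nrm_le_iff[symmetric]) (auto intro!: sum_nonneg q.nrm_nonneg)
qed

lemma rayleigh_sup_ge:
  "(\<Sum>j<k. (c j)\<^sup>2) = 1 \<Longrightarrow> q (\<Sum>j<k. c j *\<^sub>R f j) (\<Sum>j<k. c j *\<^sub>R f j) \<le> rayleigh_sup k f"
  unfolding rayleigh_sup_def by (rule cSup_upper[OF _ rayleigh_bdd]) blast

lemma unit_coeffs_exist: "k > 0 \<Longrightarrow> \<exists>c::nat \<Rightarrow> real. (\<Sum>j<k. (c j)\<^sup>2) = 1"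
  using exists_unit_kernel_vector[of 0 k] by blast

lemma rayleigh_nonneg: "k > 0 \<Longrightarrow> 0 \<le> rayleigh_sup k f"
  using unit_coeffs_exist[of k] rayleigh_sup_ge[of _ k f] q.nonneg by (meson order_trans)

lemma rayleigh_sup_le:
  assumes "k > 0" "\<And>c. (\<Sum>j<k. (c j)\<^sup>2) = 1 \<Longrightarrow> q (\<Sum>j<k. c j *\<^sub>R f j) (\<Sum>j<k. c j *\<^sub>R f j) \<le> s"
  shows "rayleigh_sup k f \<le> s"
  unfolding rayleigh_sup_def using assms unit_coeffs_exist[OF assms(1)] by (intro cSup_least) auto

lemma minmax_bdd:
  "k > 0 \<Longrightarrow> bdd_below {rayleigh_sup k f | f. (\<forall>j<k. f j \<in> H) \<and> b.ortho k f}"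
  using rayleigh_nonneg by (auto intro!: bdd_belowI[of _ 0])

lemma minmax_le_rayleigh:
  assumes "k > 0" "\<forall>j<k. f j \<in> H" "b.ortho k f"
  shows "minmax H k \<le> rayleigh_sup k f"
  unfolding minmax_def by (rule cInf_lower[OF _ minmax_bdd]) (use assms in auto)

lemma minmax_gt:
  assumes "k > 0" "\<forall>j<k. f j \<in> H" "b.ortho k f" "t < minmax H k"
  obtains c where "(\<Sum>j<k. (c j)\<^sup>2) = 1" "t < q (\<Sum>j<k. c j *\<^sub>R f j) (\<Sum>j<k. c j *\<^sub>R f j)"
proof -
  have "t < rayleigh_sup k f" using minmax_le_rayleigh[OF assms(1-3)] assms(4) by simp
  then have "\<not> (\<forall>c. (\<Sum>j<k. (c j)\<^sup>2) = 1 \<longrightarrow> q (\<Sum>j<k. c j *\<^sub>R f j) (\<Sum>j<k. c j *\<^sub>R f j) \<le> t)"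
    using rayleigh_sup_le[OF assms(1), of f t] by force
  then show ?thesis using that by force
qed

text \<open>The hypothesis on \<open>y\<close> is linear independence modulo
  \<open>L\<^sup>2\<close>-null vectors, the right notion for a semidefinite form.\<close>

lemma ortho_family_of_independent:
  assumes "subspace H" "\<forall>j<k. y j \<in> H"
    and "\<And>c. b (\<Sum>j<k. c j *\<^sub>R y j) (\<Sum>j<k. c j *\<^sub>R y j) = 0 \<Longrightarrow> \<forall>j<k. c j = 0"
  obtains z where "\<forall>j<k. z j \<in> span (y ` {..<k})" "\<forall>j<k. z j \<in> H" "b.ortho k z"
proof -
  have "\<exists>z. (\<forall>j<k. z j \<in> span (y ` {..<k})) \<and> b.ortho k z"
    using assms(3) b.nonneg by (intro b.gram_schmidt) (metis less_eq_real_def)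
  then obtain z where z: "\<forall>j<k. z j \<in> span (y ` {..<k})" "b.ortho k z" by blast
  moreover have "span (y ` {..<k}) \<subseteq> H" using assms by (intro span_minimal) auto
  ultimately show ?thesis using that by blast
qed

lemma span_comb:
  fixes k :: nat and y :: "nat \<Rightarrow> 'v"
  assumes "\<forall>j<k. z j \<in> span (y ` {..<k})"
  obtains d where "(\<Sum>j<k. c j *\<^sub>R z j) = (\<Sum>j<k. d j *\<^sub>R y j)"
proof -
  have "(\<Sum>j<k. c j *\<^sub>R z j) \<in> span (y ` {..<k})"
    using assms by (intro span_sum span_scale) auto
  then show ?thesis using that unfolding span_image_lessThan by blast
qed

text \<open>Gram-Schmidt stays inside the span of \<open>y\<close>, and the homogeneous bound on
  this span becomes a bound for the Rayleigh quotients of the orthonormal family.\<close>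

lemma minmax_le:
  assumes "k > 0" "subspace H" "\<forall>j<k. y j \<in> H"
    and indep: "\<And>c. b (\<Sum>j<k. c j *\<^sub>R y j) (\<Sum>j<k. c j *\<^sub>R y j) = 0 \<Longrightarrow> \<forall>j<k. c j = 0"
    and le: "\<And>c. q (\<Sum>j<k. c j *\<^sub>R y j) (\<Sum>j<k. c j *\<^sub>R y j) \<le> s * b (\<Sum>j<k. c j *\<^sub>R y j) (\<Sum>j<k. c j *\<^sub>R y j)"
  shows "minmax H k \<le> s"
proof -
  obtain z where z: "\<forall>j<k. z j \<in> span (y ` {..<k})" "\<forall>j<k. z j \<in> H" "b.ortho k z"
    using ortho_family_of_independent[OF assms(2-4)] by blast
  have "rayleigh_sup k z \<le> s"
  proof (rule rayleigh_sup_le[OF assms(1)])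
    fix c :: "nat \<Rightarrow> real" assume c: "(\<Sum>j<k. (c j)\<^sup>2) = 1"
    obtain d where d: "(\<Sum>j<k. c j *\<^sub>R z j) = (\<Sum>j<k. d j *\<^sub>R y j)" by (rule span_comb[OF z(1)])
    have "b (\<Sum>j<k. c j *\<^sub>R z j) (\<Sum>j<k. c j *\<^sub>R z j) = 1"
      using c by (simp add: b.ortho_sum[OF z(3)] power2_eq_square)
    then show "q (\<Sum>j<k. c j *\<^sub>R z j) (\<Sum>j<k. c j *\<^sub>R z j) \<le> s" using le[of d] by (simp add: d)
  qed
  then show ?thesis using minmax_le_rayleigh[OF assms(1) z(2,3)] by simp
qed

text \<open>The family \<open>f0\<close> guarantees that the infimum is taken over a nonempty set;
  otherwise \<open>Inf\<close> would be an arbitrary value.\<close>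

lemma minmax_ge:
  assumes "\<forall>j<k. f0 j \<in> H" "b.ortho k f0"
    and "\<And>f. \<forall>j<k. f j \<in> H \<Longrightarrow> b.ortho k f \<Longrightarrow>
      \<exists>c. (\<Sum>j<k. (c j)\<^sup>2) = 1 \<and> s \<le> q (\<Sum>j<k. c j *\<^sub>R f j) (\<Sum>j<k. c j *\<^sub>R f j)"
  shows "s \<le> minmax H k"
  unfolding minmax_def
proof (rule cInf_greatest)
  show "{rayleigh_sup k f | f. (\<forall>j<k. f j \<in> H) \<and> b.ortho k f} \<noteq> {}" using assms(1,2) by blast
  fix x assume "x \<in> {rayleigh_sup k f | f. (\<forall>j<k. f j \<in> H) \<and> b.ortho k f}"
  then obtain f where f: "x = rayleigh_sup k f" "\<forall>j<k. f j \<in> H" "b.ortho k f" by blast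
  with assms(3)[OF f(2,3)] show "s \<le> x" using rayleigh_sup_ge order_trans by blast
qed

lemma minmax_less_family:
  assumes "k > 0" "minmax H k < minmax H l" "k \<le> l"
  obtains f where "\<forall>j<k. f j \<in> H" "b.ortho k f" "rayleigh_sup k f < minmax H l"
proof -
  let ?S = "\<lambda>k. {rayleigh_sup k f | f. (\<forall>j<k. f j \<in> H) \<and> b.ortho k f}"
  \<comment> \<open>Without orthonormal families of length \<open>k\<close> there are none of length
    \<open>l \<ge> k\<close>, and both values would be the same default \<open>Inf {}\<close>,
    contrary to the strict inequality.\<close>
  have "?S k \<noteq> {}"
  proof
    assume e: "?S k = {}"
    have mono: "b.ortho k f" if "b.ortho l f" for f
      using that assms(3) by (auto simp: b.ortho_def)
    have "\<not> ((\<forall>j<l. f j \<in> H) \<and> b.ortho l f)" for f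
    proof
      assume f: "(\<forall>j<l. f j \<in> H) \<and> b.ortho l f"
      then have "(\<forall>j<k. f j \<in> H) \<and> b.ortho k f"
        using assms(3) mono by auto
      then have "rayleigh_sup k f \<in> ?S k" by blast
      with e show False by blast
    qed
    then have "?S l = {}" by blast
    with e have "minmax H k = minmax H l" by (simp only: minmax_def)
    with assms show False by simp
  qed
  then obtain x where "x \<in> ?S k" "x < minmax H l"
    using assms(2) unfolding minmax_def[of H k] by (meson cInf_lessD)
  then show ?thesis using that by blast
qed

end

subsection \<open>Perturbation of a degenerate min-max value\<close>

text \<open>\<open>e\<close> is a basis of the eigenspace and \<open>f\<close> one of a maximal subspace on which \<open>a = q - lam b\<close> is negative.\<close>
locale degenerate_value = form_pair q b
  for q b :: "'v::real_vector \<Rightarrow> 'v \<Rightarrow> real" +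
  fixes H :: "'v set" and lam :: real and m n :: nat and e f :: "nat \<Rightarrow> 'v" and D c :: real
  assumes H: "subspace H"
    and lam_nonneg: "0 \<le> lam"
    and e_in: "j < m \<Longrightarrow> e j \<in> H"
    and e_eigen: "j < m \<Longrightarrow> v \<in> H \<Longrightarrow> q (e j) v = lam * b (e j) v"
    and e_ortho: "b.ortho m e"
    and f_in: "j < n \<Longrightarrow> f j \<in> H"
    and f_ortho: "i < n \<Longrightarrow> j < n \<Longrightarrow> q (f i) (f j) - lam * b (f i) (f j) = (if i = j then -1 else 0)"
    and fe: "i < n \<Longrightarrow> j < m \<Longrightarrow> b (f i) (e j) = 0"
    and D: "0 \<le> D" "b (\<Sum>j<n. d j *\<^sub>R f j) (\<Sum>j<n. d j *\<^sub>R f j) \<le> D\<^sup>2 * (\<Sum>j<n. (d j)\<^sup>2)"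
    and c_pos: "0 < c"
    and coercive: "g \<in> H \<Longrightarrow> \<forall>i<n. q g (f i) - lam * b g (f i) = 0 \<Longrightarrow> \<forall>j<m. b g (e j) = 0 \<Longrightarrow>
      c * b g g \<le> q g g - lam * b g g"
begin

definition a :: "'v \<Rightarrow> 'v \<Rightarrow> real" where "a x y = q x y - lam * b x y"

sublocale a: sym_form a
proof
  show "bilinear a"
    unfolding bilinear_def a_def
    by (intro conjI allI linearI) (simp_all add: q.lin b.lin algebra_simps)
  show "a x y = a y x" for x y by (simp add: a_def q.sym[of x] b.sym[of x])
qed

lemma a_eigen: "v \<in> H \<Longrightarrow> a (\<Sum>j<m. d j *\<^sub>R e j) v = 0"
  unfolding a.lsum a.lin by (intro sum.neutral ballI) (simp add: a_def e_eigen)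

lemma a_f_one: "i < n \<Longrightarrow> a (\<Sum>j<n. d j *\<^sub>R f j) (f i) = - d i"
proof -
  assume i: "i < n"
  have "a (\<Sum>j<n. d j *\<^sub>R f j) (f i) = (\<Sum>j<n. if j = i then - d j else 0)"
    unfolding a.lsum a.lin by (intro sum.cong refl) (use i in \<open>auto simp: a_def f_ortho\<close>)
  then show ?thesis using i by simp
qed

lemma a_f: "a (\<Sum>j<n. d j *\<^sub>R f j) (\<Sum>j<n. d' j *\<^sub>R f j) = - (\<Sum>j<n. d j * d' j)"
  unfolding a.rsum[of "\<Sum>j<n. d j *\<^sub>R f j"] a.lin sum_negf[symmetric]
  by (intro sum.cong refl) (simp add: a_f_one)

lemma nrm_b_f: "b.nrm (\<Sum>j<n. d j *\<^sub>R f j) \<le> D * sqrt (\<Sum>j<n. (d j)\<^sup>2)"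
  by (subst b.nrm_le_iff) (auto simp: D power_mult_distrib sum_nonneg)

lemma e_sum_in: "(\<Sum>j<m. d j *\<^sub>R e j) \<in> H"
  by (intro subspace_sum H subspace_scale e_in) auto

lemma f_sum_in: "(\<Sum>j<n. d j *\<^sub>R f j) \<in> H"
  by (intro subspace_sum H subspace_scale f_in) auto

lemma b_ef: "b (\<Sum>j<m. d' j *\<^sub>R e j) (\<Sum>j<n. d j *\<^sub>R f j) = 0"
  by (auto simp: b.lsum b.rsum b.lin b.sym[of "e _"] fe intro!: sum.neutral)

end

text \<open>
  \<open>M\<close> is the perturbed form domain, \<open>we j\<close> and \<open>wf j\<close> are the components of \<open>e j\<close> and \<open>f j\<close> that are
  energy-orthogonal to \<open>M\<close> (the potentials), \<open>x\<^sup>2\<close> plays the role of \<open>\<chi>\<^sub>\<epsilon>\<^sup>2\<close>,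
  and \<open>k\<close> is a small parameter.
\<close>
locale perturbed_value = degenerate_value q b H lam m n e f D c
  for q b :: "'v::real_vector \<Rightarrow> 'v \<Rightarrow> real" and H lam m n e f D c +
  fixes M :: "'v set" and we wf :: "nat \<Rightarrow> 'v" and k x :: real and \<mu> :: "nat \<Rightarrow> real"
  assumes M: "subspace M" "M \<subseteq> H"
    and we: "j < m \<Longrightarrow> we j \<in> H" "j < m \<Longrightarrow> e j - we j \<in> M" "j < m \<Longrightarrow> v \<in> M \<Longrightarrow> q (we j) v = 0"
    and wf: "j < n \<Longrightarrow> wf j \<in> H" "j < n \<Longrightarrow> f j - wf j \<in> M" "j < n \<Longrightarrow> v \<in> M \<Longrightarrow> q (wf j) v = 0"
    and k: "0 \<le> k" "k \<le> 1" and x: "0 \<le> x" "x \<le> 1"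
    and small: "v \<in> H \<Longrightarrow> \<forall>y\<in>M. q v y = 0 \<Longrightarrow> b.nrm v \<le> k * q.nrm v"
    and we_le: "q.nrm (\<Sum>j<m. d j *\<^sub>R we j) \<le> x * sqrt (\<Sum>j<m. (d j)\<^sup>2)"
    and wf_le: "q.nrm (\<Sum>j<n. d j *\<^sub>R wf j) \<le> k * sqrt (\<Sum>j<n. (d j)\<^sup>2)"
    and r: "i < m \<Longrightarrow> j < m \<Longrightarrow> q (we i) (we j) - lam * b (we i) (we j) = (if i = j then \<mu> i else 0)"
    and \<mu>_mono: "i \<le> j \<Longrightarrow> j < m \<Longrightarrow> \<mu> i \<le> \<mu> j"
begin

lemma we_sum: "(\<Sum>j<m. d j *\<^sub>R we j) \<in> H"
  "(\<Sum>j<m. d j *\<^sub>R e j) - (\<Sum>j<m. d j *\<^sub>R we j) \<in> M"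
  "v \<in> M \<Longrightarrow> q (\<Sum>j<m. d j *\<^sub>R we j) v = 0"
proof -
  show "(\<Sum>j<m. d j *\<^sub>R we j) \<in> H" by (intro subspace_sum H subspace_scale we) auto
  have "(\<Sum>j<m. d j *\<^sub>R (e j - we j)) \<in> M" by (intro subspace_sum M subspace_scale we) auto
  then show "(\<Sum>j<m. d j *\<^sub>R e j) - (\<Sum>j<m. d j *\<^sub>R we j) \<in> M"
    by (simp add: scaleR_diff_right sum_subtractf)
  show "v \<in> M \<Longrightarrow> q (\<Sum>j<m. d j *\<^sub>R we j) v = 0"
    by (auto simp: q.lsum q.lin we intro!: sum.neutral)
qed

lemma wf_sum: "(\<Sum>j<n. d j *\<^sub>R wf j) \<in> H"
  "(\<Sum>j<n. d j *\<^sub>R f j) - (\<Sum>j<n. d j *\<^sub>R wf j) \<in> M"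
  "v \<in> M \<Longrightarrow> q (\<Sum>j<n. d j *\<^sub>R wf j) v = 0"
proof -
  show "(\<Sum>j<n. d j *\<^sub>R wf j) \<in> H" by (intro subspace_sum H subspace_scale wf) auto
  have "(\<Sum>j<n. d j *\<^sub>R (f j - wf j)) \<in> M" by (intro subspace_sum M subspace_scale wf) auto
  then show "(\<Sum>j<n. d j *\<^sub>R f j) - (\<Sum>j<n. d j *\<^sub>R wf j) \<in> M"
    by (simp add: scaleR_diff_right sum_subtractf)
  show "v \<in> M \<Longrightarrow> q (\<Sum>j<n. d j *\<^sub>R wf j) v = 0"
    by (auto simp: q.lsum q.lin wf intro!: sum.neutral)
qed

lemma b_we: "b.nrm (\<Sum>j<m. d j *\<^sub>R we j) \<le> k * x * sqrt (\<Sum>j<m. (d j)\<^sup>2)"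
proof -
  have "b.nrm (\<Sum>j<m. d j *\<^sub>R we j) \<le> k * q.nrm (\<Sum>j<m. d j *\<^sub>R we j)"
    using we_sum by (intro small) auto
  also have "\<dots> \<le> k * (x * sqrt (\<Sum>j<m. (d j)\<^sup>2))" using we_le k by (intro mult_left_mono) auto
  finally show ?thesis by simp
qed

lemma b_wf: "b.nrm (\<Sum>j<n. d j *\<^sub>R wf j) \<le> k * sqrt (\<Sum>j<n. (d j)\<^sup>2)"
proof -
  have "b.nrm (\<Sum>j<n. d j *\<^sub>R wf j) \<le> k * q.nrm (\<Sum>j<n. d j *\<^sub>R wf j)"
    using wf_sum by (intro small) auto
  also have "\<dots> \<le> 1 * (k * sqrt (\<Sum>j<n. (d j)\<^sup>2))" using wf_le k by (intro mult_mono) (auto simp: q.nrm_nonneg)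
  finally show ?thesis by simp
qed

lemma r_sum:
  "a (\<Sum>j<m. d j *\<^sub>R we j) (\<Sum>j<m. d j *\<^sub>R we j) = (\<Sum>j<m. \<mu> j * (d j)\<^sup>2)"
proof -
  have "a (\<Sum>j<m. d j *\<^sub>R we j) (we i) = \<mu> i * d i" if i: "i < m" for i
  proof -
    have "a (\<Sum>j<m. d j *\<^sub>R we j) (we i) = (\<Sum>j<m. if j = i then \<mu> i * d i else 0)"
      unfolding a.lsum a.lin by (intro sum.cong refl) (use i in \<open>auto simp: a_def r\<close>)
    then show ?thesis using i by simp
  qed
  then have "(\<Sum>i<m. d i * a (\<Sum>j<m. d j *\<^sub>R we j) (we i)) = (\<Sum>i<m. \<mu> i * (d i)\<^sup>2)"
    by (intro sum.cong) (auto simp: power2_eq_square)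
  then show ?thesis by (simp add: a.rsum[of "\<Sum>j<m. d j *\<^sub>R we j"] a.lin)
qed

lemma \<mu>_bound:
  assumes "i < m"
  shows "\<bar>\<mu> i\<bar> \<le> (1 + lam) * x\<^sup>2"
proof -
  \<comment> \<open>Unit coefficient vectors turn the bounds on combinations into bounds on single
    potentials.\<close>
  let ?d = "\<lambda>j. if j = i then 1 else 0 :: real"
  have s: "(\<Sum>j<m. ?d j *\<^sub>R we j) = we i" "(\<Sum>j<m. (?d j)\<^sup>2) = 1"
    using assms by (simp_all add: if_distrib[of "\<lambda>c. c *\<^sub>R _"] if_distrib[of "\<lambda>c. c\<^sup>2"] cong: if_cong)
  have "q.nrm (we i) \<le> x" using we_le[of ?d] by (simp add: s)
  then have 1: "q (we i) (we i) \<le> x\<^sup>2" using x by (simp add: q.nrm_le_iff)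
  have "b.nrm (we i) \<le> k * x" using b_we[of ?d] by (simp add: s)
  then have "b (we i) (we i) \<le> (k * x)\<^sup>2" using x k by (simp add: b.nrm_le_iff)
  also have "\<dots> \<le> (1 * x)\<^sup>2" using x k by (intro power_mono mult_right_mono) auto
  finally have "lam * b (we i) (we i) \<le> lam * x\<^sup>2" using lam_nonneg by (intro mult_left_mono) auto
  moreover have "\<mu> i = q (we i) (we i) - lam * b (we i) (we i)" using r[OF assms assms] by simp
  moreover have "0 \<le> lam * b (we i) (we i)" "0 \<le> q (we i) (we i)" "0 \<le> lam * x\<^sup>2"
    using lam_nonneg b.nonneg q.nonneg by auto
  ultimately show ?thesis using 1 by (simp add: abs_le_iff algebra_simps)
qed

end


text \<open>\<open>U\<close> and \<open>F\<close> are the coefficient norms of the eigenspace part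
  and of the negative part of a test vector; \<open>aw\<close> and \<open>bw\<close> are the two
  forms at it. The term \<open>- F\<^sup>2\<close> is a budget: one half pays for the diagonal
  error, one quarter for the cross term after completing the square, one quarter for the
  \<open>F\<close>-part of the normalisation error. The latter is affordable because it is
  multiplied by \<open>mu + \<tau> * x\<^sup>2\<close>, which is of order
  \<open>x\<^sup>2\<close>.\<close>

lemma upper_arith:
  fixes U F lam k x D \<tau> mu aw bw bF :: real
  assumes aw: "aw \<le> mu * U\<^sup>2 - F\<^sup>2 + 2 * lam * D * k * F\<^sup>2 + 2 * (lam * (D + 1) * k * x * U) * F"
    and bw: "\<bar>bw - (U\<^sup>2 + bF)\<bar> \<le> k * R * (U\<^sup>2 + F\<^sup>2)" and bF: "0 \<le> bF" "bF \<le> D\<^sup>2 * F\<^sup>2"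
    and mu: "\<bar>mu\<bar> \<le> (1 + lam) * x\<^sup>2" and \<tau>: "0 < \<tau>" "\<tau> \<le> 1"
    and pos: "0 \<le> lam" "0 \<le> D" "0 \<le> k" "k \<le> 1" "0 \<le> R"
    and c1: "k * ((2 + lam) * R + 4 * lam\<^sup>2 * (D + 1)\<^sup>2) \<le> \<tau>"
    and c2: "(2 + lam) * x\<^sup>2 * (D\<^sup>2 + R) \<le> 1/4" and c3: "2 * lam * D * k \<le> 1/2"
  shows "aw \<le> (mu + \<tau> * x\<^sup>2) * bw"
proof -
  define s where "s = mu + \<tau> * x\<^sup>2"
  define L where "L = 4 * lam\<^sup>2 * (D + 1)\<^sup>2"
  define Z where "Z = D\<^sup>2 * F\<^sup>2 + k * R * (U\<^sup>2 + F\<^sup>2)"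
  have "\<tau> * x\<^sup>2 \<le> 1 * x\<^sup>2" using \<tau> by (intro mult_right_mono) auto
  moreover have "0 \<le> \<tau> * x\<^sup>2" using \<tau> by simp
  moreover have "(2 + lam) * x\<^sup>2 = (1 + lam) * x\<^sup>2 + x\<^sup>2" by (simp add: algebra_simps)
  ultimately have s: "\<bar>s\<bar> \<le> (2 + lam) * x\<^sup>2"
    using mu unfolding s_def abs_le_iff by linarith
  define p where "p = lam * (D + 1) * k * x * U"
  have "0 \<le> (2 * p - F / 2)\<^sup>2" by simp
  then have "2 * p * F \<le> 4 * p\<^sup>2 + F\<^sup>2 / 4" by (simp add: power2_eq_square algebra_simps)
  moreover have "4 * p\<^sup>2 = L * k\<^sup>2 * (x\<^sup>2 * U\<^sup>2)" by (simp add: p_def L_def power_mult_distrib)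
  moreover have "2 * lam * D * k * F\<^sup>2 \<le> 1/2 * F\<^sup>2" using c3 by (intro mult_right_mono) auto
  ultimately have A: "aw \<le> mu * U\<^sup>2 - F\<^sup>2 / 4 + L * k\<^sup>2 * (x\<^sup>2 * U\<^sup>2)"
    using aw by (simp add: p_def)
  have "\<bar>bw - U\<^sup>2\<bar> \<le> Z" using bw bF by (simp add: Z_def)
  then have "\<bar>s * (bw - U\<^sup>2)\<bar> \<le> (2 + lam) * x\<^sup>2 * Z" unfolding abs_mult using s pos
    by (intro mult_mono) auto
  then have B: "s * bw \<ge> s * U\<^sup>2 - (2 + lam) * x\<^sup>2 * Z" by (simp add: algebra_simps abs_le_iff)
  have "(k * R) * F\<^sup>2 \<le> (1 * R) * F\<^sup>2" using pos by (intro mult_right_mono) auto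
  then have "Z \<le> k * R * U\<^sup>2 + (D\<^sup>2 + R) * F\<^sup>2" by (simp add: Z_def algebra_simps)
  then have "(2 + lam) * x\<^sup>2 * Z \<le> (2 + lam) * x\<^sup>2 * (k * R * U\<^sup>2 + (D\<^sup>2 + R) * F\<^sup>2)"
    using pos by (intro mult_left_mono) auto
  also have "\<dots> = k * ((2 + lam) * R) * (x\<^sup>2 * U\<^sup>2) + ((2 + lam) * x\<^sup>2 * (D\<^sup>2 + R)) * F\<^sup>2"
    by (simp add: algebra_simps)
  also have "\<dots> \<le> k * ((2 + lam) * R) * (x\<^sup>2 * U\<^sup>2) + 1/4 * F\<^sup>2"
    using c2 by (intro add_left_mono mult_right_mono) auto
  finally have C: "(2 + lam) * x\<^sup>2 * Z \<le> k * ((2 + lam) * R) * (x\<^sup>2 * U\<^sup>2) + F\<^sup>2 / 4" by simp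
  have "L * k\<^sup>2 \<le> L * k" using pos unfolding L_def power2_eq_square[of k]
    by (intro mult_left_mono) (auto intro: mult_left_le_one_le)
  then have "L * k\<^sup>2 + k * ((2 + lam) * R) \<le> \<tau>" using c1 by (simp add: L_def algebra_simps)
  then have "(L * k\<^sup>2 + k * ((2 + lam) * R)) * (x\<^sup>2 * U\<^sup>2) \<le> \<tau> * (x\<^sup>2 * U\<^sup>2)"
    by (intro mult_right_mono) auto
  moreover have "s * U\<^sup>2 = mu * U\<^sup>2 + \<tau> * (x\<^sup>2 * U\<^sup>2)" by (simp add: s_def algebra_simps)
  ultimately have "aw \<le> s * bw" using A B C by (simp add: algebra_simps)
  then show ?thesis by (simp add: s_def)
qed

section \<open>Upper bound for the perturbed min-max value\<close>

context perturbed_value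
begin

text \<open>Since \<open>cc\<close> vanishes beyond \<open>i\<close> and \<mu> is increasing, the
  diagonal form \<open>r\<close> is at most \<open>\<mu> i\<close> on the eigenspace part. The bound
  of \<open>F\<^sup>2\<close> by \<open>lam * bF\<close> follows from
  \<open>a v v = - F\<^sup>2\<close> and \<open>q v v \<ge> 0\<close>; it later yields linear
  independence in \<open>L\<^sup>2\<close>.\<close>

lemma test_vector_estimates:
  fixes cc d :: "nat \<Rightarrow> real"
  assumes i: "i < m" and cc: "\<And>j. j < m \<Longrightarrow> i < j \<Longrightarrow> cc j = 0"
  defines "w \<equiv> ((\<Sum>j<m. cc j *\<^sub>R e j) - (\<Sum>j<m. cc j *\<^sub>R we j))
    + ((\<Sum>j<n. d j *\<^sub>R f j) - (\<Sum>j<n. d j *\<^sub>R wf j))"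
  defines "U \<equiv> sqrt (\<Sum>j<m. (cc j)\<^sup>2)" and "F \<equiv> sqrt (\<Sum>j<n. (d j)\<^sup>2)"
  defines "bF \<equiv> b (\<Sum>j<n. d j *\<^sub>R f j) (\<Sum>j<n. d j *\<^sub>R f j)"
  shows "a w w \<le> \<mu> i * U\<^sup>2 - F\<^sup>2 + 2 * lam * D * k * F\<^sup>2 + 2 * (lam * (D + 1) * k * x * U) * F"
    and "\<bar>b w w - (U\<^sup>2 + bF)\<bar> \<le> k * (4 * D + 6) * (U\<^sup>2 + F\<^sup>2)"
    and "bF \<le> D\<^sup>2 * F\<^sup>2" and "F\<^sup>2 \<le> lam * bF" and "w \<in> M"
proof -
  define u v where "u = (\<Sum>j<m. cc j *\<^sub>R e j)" and "v = (\<Sum>j<n. d j *\<^sub>R f j)"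
  define Vu Vv where "Vu = (\<Sum>j<m. cc j *\<^sub>R we j)" and "Vv = (\<Sum>j<n. d j *\<^sub>R wf j)"
  have U: "0 \<le> U" "U\<^sup>2 = (\<Sum>j<m. (cc j)\<^sup>2)" and F: "0 \<le> F" "F\<^sup>2 = (\<Sum>j<n. (d j)\<^sup>2)"
    by (auto simp: U_def F_def sum_nonneg)
  have in_H: "u \<in> H" "v \<in> H" "Vu \<in> H" "Vv \<in> H"
    by (simp_all add: u_def v_def Vu_def Vv_def e_sum_in f_sum_in we_sum wf_sum)
  have in_M: "u - Vu \<in> M" "v - Vv \<in> M"
    unfolding u_def v_def Vu_def Vv_def by (rule we_sum wf_sum)+
  show "w \<in> M" unfolding w_def by (intro subspace_add M in_M[unfolded u_def v_def Vu_def Vv_def])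
  have qM: "q Vu z = 0" "q Vv z = 0" if "z \<in> M" for z
    using we_sum(3) wf_sum(3) that by (auto simp: Vu_def Vv_def)
  have au: "a u z = 0" "a z u = 0" if "z \<in> H" for z
    using a_eigen[OF that] by (auto simp: u_def a.sym[of z])
  have nVu: "b.nrm Vu \<le> k * x * U" and nVv: "b.nrm Vv \<le> k * F" and nv: "b.nrm v \<le> D * F"
    using b_we b_wf nrm_b_f by (auto simp: Vu_def Vv_def v_def U_def F_def)
  have "b u u = U\<^sup>2" unfolding u_def b.ortho_sum[OF e_ortho] U by (simp add: power2_eq_square)
  then have nu: "b.nrm u = U" using U(1) by (simp add: b.nrm_def)
  have buv: "b u v = 0" using b_ef by (simp add: u_def v_def)
  then have bvu: "b v u = 0" using b.sym[of v u] by simp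
  have aF: "a v v = - F\<^sup>2" unfolding v_def a_f F by (simp add: power2_eq_square)
  show bF: "bF \<le> D\<^sup>2 * F\<^sup>2" unfolding bF_def F by (rule D)
  have "F\<^sup>2 = lam * bF - q v v" using aF by (simp add: a_def bF_def v_def)
  then show "F\<^sup>2 \<le> lam * bF" using q.nonneg[of v] by simp
  have w: "w = (u - Vu) + (v - Vv)" by (simp add: w_def u_def v_def Vu_def Vv_def)
  have "a (u - Vu) (u - Vu) = a Vu Vu" using in_H by (simp add: a.lin au)
  also have "\<dots> = (\<Sum>j<m. \<mu> j * (cc j)\<^sup>2)" by (simp add: Vu_def r_sum)
  also have "\<dots> \<le> (\<Sum>j<m. \<mu> i * (cc j)\<^sup>2)"
  proof (rule sum_mono)
    fix j assume "j \<in> {..<m}"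
    then show "\<mu> j * (cc j)\<^sup>2 \<le> \<mu> i * (cc j)\<^sup>2"
      using cc[of j] \<mu>_mono[of j i] i by (cases "j \<le> i") (auto intro: mult_right_mono)
  qed
  finally have A1: "a (u - Vu) (u - Vu) \<le> \<mu> i * U\<^sup>2" by (simp add: U sum_distrib_left)
  have qv: "q Vv v = q Vv Vv" using qM(2)[OF in_M(2)] by (simp add: q.lin)
  have "a (v - Vv) (v - Vv) = - F\<^sup>2 - q Vv Vv + 2 * lam * b v Vv - lam * b Vv Vv"
    using aF qv by (simp add: a.lin a.sym[of v Vv]) (simp add: a_def b.sym[of v Vv] algebra_simps)
  also have "\<dots> \<le> - F\<^sup>2 + 2 * lam * b v Vv"
    using q.nonneg[of Vv] mult_nonneg_nonneg[OF lam_nonneg b.nonneg[of Vv]] by simp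
  also have "\<dots> \<le> - F\<^sup>2 + 2 * lam * ((D * F) * (k * F))"
  proof -
    have "b v Vv \<le> b.nrm v * b.nrm Vv" using b.cauchy_schwarz[of v Vv] by simp
    also have "\<dots> \<le> (D * F) * (k * F)" using nv nVv D F by (intro mult_mono) (auto simp: b.nrm_nonneg)
    finally show ?thesis using lam_nonneg by (intro add_left_mono mult_left_mono) auto
  qed
  finally have A2: "a (v - Vv) (v - Vv) \<le> - F\<^sup>2 + 2 * lam * D * k * F\<^sup>2"
    by (simp add: power2_eq_square mult_ac)
  have vH: "v - Vv \<in> H" using in_M M by auto
  \<comment> \<open>\<open>u\<close> drops out as an eigenvector and \<open>q Vu\<close> vanishes on
    \<open>M\<close>. Only the \<open>L\<^sup>2\<close> pairing with \<open>Vu\<close> is left,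
    which is of size \<open>k * x\<close>.\<close>
  have "a (u - Vu) (v - Vv) = lam * b Vu (v - Vv)"
    using au(1)[OF vH] qM(1)[OF in_M(2)] by (simp add: a.lin(3)) (simp add: a_def)
  also have "\<dots> \<le> lam * ((k * x * U) * ((D + 1) * F))"
  proof -
    have "b Vu (v - Vv) \<le> b.nrm Vu * b.nrm (v - Vv)" using b.cauchy_schwarz[of Vu "v - Vv"] by simp
    also have "\<dots> \<le> (k * x * U) * ((D + 1) * F)"
    proof (rule mult_mono[OF nVu])
      have "k * F \<le> 1 * F" using k F by (intro mult_right_mono) auto
      then show "b.nrm (v - Vv) \<le> (D + 1) * F"
        using b.nrm_diff[of v Vv] nv nVv by (simp add: algebra_simps)
    qed (use k x U in \<open>auto simp: b.nrm_nonneg\<close>)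
    finally show ?thesis using lam_nonneg by (rule mult_left_mono)
  qed
  finally have A3: "a (u - Vu) (v - Vv) \<le> lam * ((k * x * U) * ((D + 1) * F))" .
  have "a w w = a (u - Vu) (u - Vu) + a (v - Vv) (v - Vv) + 2 * a (u - Vu) (v - Vv)"
    unfolding w by (simp only: a.lin(1,2)) (simp add: a.sym[of "v - Vv" "u - Vu"])
  with A1 A2 A3 show "a w w \<le> \<mu> i * U\<^sup>2 - F\<^sup>2 + 2 * lam * D * k * F\<^sup>2 + 2 * (lam * (D + 1) * k * x * U) * F"
    by (simp add: algebra_simps)
  \<comment> \<open>The \<open>L\<^sup>2\<close> norm of \<open>w\<close> is compared with that of
    the unprojected vector \<open>P\<close>, whose two parts are
    \<open>b\<close>-orthogonal.\<close>
  define P V where "P = u + v" and "V = Vu + Vv"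
  have w2: "w = P - V" by (simp add: w P_def V_def)
  have bP: "b P P = U\<^sup>2 + bF" using \<open>b u u = U\<^sup>2\<close> buv bvu by (simp add: P_def b.lin bF_def v_def)
  have nP: "b.nrm P \<le> (1 + D) * (U + F)"
    using b.nrm_add[of u v] nu nv mult_nonneg_nonneg[OF D(1) U(1)] F(1) U(1) by (simp add: P_def algebra_simps)
  have "k * x * U \<le> k * 1 * U" using k x U by (intro mult_right_mono mult_left_mono) auto
  then have nV: "b.nrm V \<le> k * (U + F)"
    using b.nrm_add[of Vu Vv] nVu nVv by (simp add: V_def algebra_simps)
  have UF: "0 \<le> U + F" "(U + F)\<^sup>2 \<le> 2 * (U\<^sup>2 + F\<^sup>2)"
    using U F sum_squares_bound[of U F] by (auto simp: power2_sum)
  have "\<bar>b P V\<bar> \<le> ((1 + D) * (U + F)) * (k * (U + F))"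
    using b.cauchy_schwarz[of P V] mult_mono[OF nP nV] b.nrm_nonneg D UF by (force intro: order_trans)
  then have 1: "\<bar>b P V\<bar> \<le> k * (1 + D) * (U + F)\<^sup>2" by (simp add: power2_eq_square mult_ac)
  have "b V V \<le> (k * (U + F))\<^sup>2" using nV k UF by (subst b.nrm_le_iff[symmetric]) auto
  also have "\<dots> = k * k * (U + F)\<^sup>2" by (simp add: power2_eq_square mult_ac)
  also have "\<dots> \<le> 1 * k * (U + F)\<^sup>2" using k by (intro mult_right_mono) auto
  finally have 2: "b V V \<le> k * (U + F)\<^sup>2" by simp
  have "b w w - (U\<^sup>2 + bF) = b V V - 2 * b P V" by (simp add: w2 b.lin bP[symmetric] b.sym[of V P])
  then have "\<bar>b w w - (U\<^sup>2 + bF)\<bar> \<le> k * (U + F)\<^sup>2 + 2 * (k * (1 + D) * (U + F)\<^sup>2)"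
    using 1 2 b.nonneg[of V] by linarith
  also have "\<dots> = k * (2 * D + 3) * (U + F)\<^sup>2" by (simp add: algebra_simps)
  also have "\<dots> \<le> k * (2 * D + 3) * (2 * (U\<^sup>2 + F\<^sup>2))" using UF k D by (intro mult_left_mono) auto
  finally show "\<bar>b w w - (U\<^sup>2 + bF)\<bar> \<le> k * (4 * D + 6) * (U\<^sup>2 + F\<^sup>2)" by (simp add: algebra_simps)
qed

end


lemma sum_lessThan_add: "(\<Sum>j<n + l. g j) = (\<Sum>j<n. g j) + (\<Sum>j<l. g (n + j))" for g :: "nat \<Rightarrow> 'z::comm_monoid_add"
  by (induction l) (simp_all add: add.assoc)

context perturbed_value
begin

text \<open>The test family consists of the projected \<open>f\<close> followed by the first
  \<open>Suc i\<close> projected eigenvectors. Condition \<open>c4\<close> keeps it independent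
  after projection. The second claim provides the nonempty set of competitors on which the lower
  bound depends.\<close>

lemma upper_bound:
  assumes i: "i < m" and \<tau>: "0 < \<tau>" "\<tau> \<le> 1"
    and c1: "k * ((2 + lam) * (4 * D + 6) + 4 * lam\<^sup>2 * (D + 1)\<^sup>2) \<le> \<tau>"
    and c2: "(2 + lam) * x\<^sup>2 * (D\<^sup>2 + (4 * D + 6)) \<le> 1/4" and c3: "2 * lam * D * k \<le> 1/2"
    and c4: "k * (4 * D + 6) * (1 + lam) < 1"
  shows "minmax M (n + Suc i) \<le> lam + \<mu> i + \<tau> * x\<^sup>2"
    and "\<exists>g. (\<forall>j<n + Suc i. g j \<in> M) \<and> b.ortho (n + Suc i) g"
proof -
  define y where "y = (\<lambda>j. if j < n then f j - wf j else e (j - n) - we (j - n))"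
  have y_in: "\<forall>j<n + Suc i. y j \<in> M" using i by (auto simp: y_def we wf)
  have est: "a (\<Sum>j<n + Suc i. C j *\<^sub>R y j) (\<Sum>j<n + Suc i. C j *\<^sub>R y j)
       \<le> (\<mu> i + \<tau> * x\<^sup>2) * b (\<Sum>j<n + Suc i. C j *\<^sub>R y j) (\<Sum>j<n + Suc i. C j *\<^sub>R y j) \<and>
     (b (\<Sum>j<n + Suc i. C j *\<^sub>R y j) (\<Sum>j<n + Suc i. C j *\<^sub>R y j) = 0 \<longrightarrow> (\<forall>j<n + Suc i. C j = 0))" for C
  proof -
    \<comment> \<open>Extension by zero to all \<open>m\<close> eigenvectors, the form in which the
      estimates are stated.\<close>
    define cc where "cc = (\<lambda>j. if j \<le> i then C (n + j) else 0)"
    define w where "w = ((\<Sum>j<m. cc j *\<^sub>R e j) - (\<Sum>j<m. cc j *\<^sub>R we j))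
      + ((\<Sum>j<n. C j *\<^sub>R f j) - (\<Sum>j<n. C j *\<^sub>R wf j))"
    have "(\<Sum>j<m. cc j *\<^sub>R (e j - we j)) = (\<Sum>j<Suc i. cc j *\<^sub>R (e j - we j))"
      by (rule sum.mono_neutral_right) (use i in \<open>auto simp: cc_def\<close>)
    also have "\<dots> = (\<Sum>j<Suc i. C (n + j) *\<^sub>R y (n + j))"
      by (intro sum.cong) (auto simp: cc_def y_def)
    finally have "(\<Sum>j<n + Suc i. C j *\<^sub>R y j) = (\<Sum>j<n. C j *\<^sub>R y j) + (\<Sum>j<m. cc j *\<^sub>R (e j - we j))"
      unfolding sum_lessThan_add by simp
    moreover have "(\<Sum>j<n. C j *\<^sub>R y j) = (\<Sum>j<n. C j *\<^sub>R (f j - wf j))"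
      by (intro sum.cong) (auto simp: y_def)
    ultimately have w: "(\<Sum>j<n + Suc i. C j *\<^sub>R y j) = w"
      by (simp add: w_def scaleR_diff_right sum_subtractf)
    define U2 where "U2 = (\<Sum>j<m. (cc j)\<^sup>2)"
    define F2 where "F2 = (\<Sum>j<n. (C j)\<^sup>2)"
    define bF where "bF = b (\<Sum>j<n. C j *\<^sub>R f j) (\<Sum>j<n. C j *\<^sub>R f j)"
    have nn: "0 \<le> U2" "0 \<le> F2" "0 \<le> bF" by (auto simp: U2_def F2_def bF_def sum_nonneg b.nonneg)
    note t = test_vector_estimates[of i cc C, OF i, folded w_def, folded bF_def U2_def F2_def]
    have cc0: "j < m \<Longrightarrow> i < j \<Longrightarrow> cc j = 0" for j by (simp add: cc_def)
    have 1: "a w w \<le> (\<mu> i + \<tau> * x\<^sup>2) * b w w"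
      by (rule upper_arith[where R = "4 * D + 6" and lam = lam and k = k and D = D and bF = bF and U = "sqrt U2" and F = "sqrt F2"])
        (use t[OF cc0] nn \<mu>_bound[OF i] \<tau> lam_nonneg D(1) k c1 c2 c3 in auto)
    have 2: "\<forall>j<n + Suc i. C j = 0" if "b w w = 0"
    proof -
      \<comment> \<open>For a null combination the normalisation estimate bounds
        \<open>U2 + bF\<close> by a multiple of itself with factor below 1.\<close>
      have le: "U2 + bF \<le> k * (4 * D + 6) * (U2 + F2)" using t(2)[OF cc0] that nn by simp
      have "F2 \<le> lam * bF" using t(4)[OF cc0] nn by simp
      then have "U2 + F2 \<le> (1 + lam) * (U2 + bF)"
        using nn mult_nonneg_nonneg[OF lam_nonneg nn(1)] by (simp add: algebra_simps)
      then have "k * (4 * D + 6) * (U2 + F2) \<le> k * (4 * D + 6) * ((1 + lam) * (U2 + bF))"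
        using k D by (intro mult_left_mono) auto
      with le have le': "U2 + bF \<le> (k * (4 * D + 6) * (1 + lam)) * (U2 + bF)" by (simp add: mult.assoc)
      have "\<not> 0 < U2 + bF"
        using le_less_trans[OF le' mult_strict_right_mono[OF c4, of "U2 + bF"]] by auto
      then have "U2 + bF = 0" using nn by linarith
      then have "U2 = 0" "bF = 0" using nn by auto
      moreover from this have "F2 = 0" using \<open>F2 \<le> lam * bF\<close> nn by simp
      ultimately have "\<forall>j<m. cc j = 0" "\<forall>j<n. C j = 0"
        by (auto simp: U2_def F2_def sum_nonneg_eq_0_iff)
      moreover have "C j = 0" if "n \<le> j" "j < n + Suc i" for j
      proof -
        have "j - n \<le> i" "j - n < m" "n + (j - n) = j" using that i by auto
        then show ?thesis using \<open>\<forall>j<m. cc j = 0\<close>[rule_format, of "j - n"] by (simp add: cc_def)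
      qed
      ultimately show ?thesis by (metis not_le)
    qed
    show ?thesis using 1 2 by (simp only: w) blast
  qed
  show "minmax M (n + Suc i) \<le> lam + \<mu> i + \<tau> * x\<^sup>2"
  proof (rule minmax_le[OF _ M(1) y_in])
    fix C :: "nat \<Rightarrow> real"
    show "q (\<Sum>j<n + Suc i. C j *\<^sub>R y j) (\<Sum>j<n + Suc i. C j *\<^sub>R y j)
      \<le> (lam + \<mu> i + \<tau> * x\<^sup>2) * b (\<Sum>j<n + Suc i. C j *\<^sub>R y j) (\<Sum>j<n + Suc i. C j *\<^sub>R y j)"
    proof -
      define W where "W = (\<Sum>j<n + Suc i. C j *\<^sub>R y j)"
      have "a W W \<le> (\<mu> i + \<tau> * x\<^sup>2) * b W W" using est[of C] unfolding W_def by blast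
      then show ?thesis unfolding W_def[symmetric] a_def by (simp add: algebra_simps)
    qed
  next
    show "\<forall>j<n + Suc i. C j = 0"
      if "b (\<Sum>j<n + Suc i. C j *\<^sub>R y j) (\<Sum>j<n + Suc i. C j *\<^sub>R y j) = 0" for C
      using est[of C] that by blast
  qed simp
  show "\<exists>g. (\<forall>j<n + Suc i. g j \<in> M) \<and> b.ortho (n + Suc i) g"
  proof (rule ortho_family_of_independent[OF M(1) y_in])
    show "\<forall>j<n + Suc i. C j = 0"
      if "b (\<Sum>j<n + Suc i. C j *\<^sub>R y j) (\<Sum>j<n + Suc i. C j *\<^sub>R y j) = 0" for C
      using est[of C] that by blast
  qed blast
qed

end

section \<open>Lower bound for the perturbed min-max value\<close>

context perturbed_value
begin

text \<open>Let \<open>u\<close> be the \<open>L\<^sup>2\<close> projection of \<open>w\<close> to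
  the eigenspace and \<open>g = w - u\<close>. In general \<open>g\<close> is not in
  \<open>M\<close>, but \<open>z = g + V = w - (u - V)\<close> is, so \<open>q V z = 0\<close> and
  \<open>z\<close> interacts with \<open>V\<close> only through \<open>L\<^sup>2\<close>. In turn
  \<open>z\<close> violates the orthogonality conditions of coercivity slightly; \<open>g'\<close>
  restores them by corrections of size \<open>t = k * x * U\<close>.\<close>

lemma lower_vector:
  defines "A \<equiv> real n * (1 + lam * D)\<^sup>2"
  assumes i: "i < m" and c1: "(c * (D\<^sup>2 * A + 1) + A + 6 * lam\<^sup>2 / c + 2 * (1 + lam)) * k\<^sup>2 \<le> \<tau>"
    and c2: "2 * (1 + lam) * x\<^sup>2 \<le> c / 6"
    and w: "w \<in> M" "b w w = 1" "\<And>j. j < n \<Longrightarrow> a w (f j) = 0" "\<And>j. j < i \<Longrightarrow> b w (e j) = 0"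
  shows "\<mu> i - \<tau> * x\<^sup>2 \<le> a w w"
proof -
  define cc where "cc = (\<lambda>j. b w (e j))"
  define u V where "u = (\<Sum>j<m. cc j *\<^sub>R e j)" and "V = (\<Sum>j<m. cc j *\<^sub>R we j)"
  define g z where "g = w - u" and "z = g + V"
  define dF where "dF = (\<lambda>j. a V (f j))"
  \<comment> \<open>\<open>p\<close> and \<open>s\<close> are the components of \<open>z\<close>
    along \<open>f\<close> for \<open>a\<close> and along \<open>e\<close> for \<open>b\<close>. As
    \<open>g\<close> has none, they are those of \<open>V\<close>. The sign compensates
    \<open>a (f j) (f j) = -1\<close>.\<close>
  define p where "p = (\<Sum>j<n. (- dF j) *\<^sub>R f j)"
  define s where "s = (\<Sum>j<m. b V (e j) *\<^sub>R e j)"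
  define g' where "g' = z - p - s"
  define U where "U = sqrt (\<Sum>j<m. (cc j)\<^sup>2)"
  define t where "t = k * x * U"
  have U: "0 \<le> U" "U\<^sup>2 = (\<Sum>j<m. (cc j)\<^sup>2)" by (auto simp: U_def sum_nonneg)
  have t: "0 \<le> t" using k x U by (simp add: t_def)
  have wH: "w \<in> H" using w M by auto
  have uH: "u \<in> H" and VH: "V \<in> H" and pH: "p \<in> H" and sH: "s \<in> H"
    by (simp_all add: u_def V_def p_def s_def e_sum_in we_sum f_sum_in del: scaleR_minus_left)
  have gH: "g \<in> H" and g'H: "g' \<in> H"
    unfolding g'_def z_def g_def using wH uH VH pH sH H by (auto intro!: subspace_diff subspace_add)
  have zM: "z \<in> M"
  proof -
    have "z = w - (u - V)" by (simp add: z_def g_def)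
    then show ?thesis using we_sum(2)[of cc] w M by (auto simp: u_def V_def intro!: subspace_diff)
  qed
  have au: "a u y = 0" if "y \<in> H" for y using a_eigen[OF that] by (simp add: u_def)
  have as: "a s y = 0" if "y \<in> H" for y using a_eigen[OF that] by (simp add: s_def)
  have fH: "j < n \<Longrightarrow> f j \<in> H" for j by (rule f_in)
  have ag: "a g (f j) = 0" if "j < n" for j using w(3)[OF that] au[OF fH[OF that]] by (simp add: g_def a.lin)
  have bg: "b g (e j) = 0" if "j < m" for j
    using b.ortho_coeff[OF e_ortho that, of cc] by (simp add: g_def b.lin u_def cc_def)
  have "b g u = 0" unfolding u_def b.rsum b.lin by (intro sum.neutral ballI) (simp add: bg)
  moreover have "b u u = U\<^sup>2" unfolding u_def b.ortho_sum[OF e_ortho] U by (simp add: power2_eq_square)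
  moreover have wgu: "w = g + u" by (simp add: g_def)
  ultimately have U1: "U\<^sup>2 + b g g = 1" using w(2) b.sym[of u g] by (simp add: b.lin)
  have aw: "a w w = a g g" using au[OF gH] au[OF uH] a.sym[of g u] by (simp add: wgu a.lin)
  have nV: "b.nrm V \<le> t" and nqV: "q.nrm V \<le> x * U" using b_we we_le by (auto simp: V_def t_def U_def)
  have bV: "b V V \<le> t\<^sup>2" using nV t by (simp add: b.nrm_le_iff)
  have "q V z = 0" using we_sum(3)[OF zM] by (simp add: V_def)
  then have "a z V = - lam * b z V" by (simp add: a.sym[of z V]) (simp add: a_def b.sym[of z V])
  moreover have gz: "g = z - V" by (simp add: z_def)
  ultimately have agg: "a g g = a z z + 2 * lam * b z V + a V V"
    using a.sym[of V z] by (simp add: gz a.lin)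
  \<comment> \<open>The coefficients below \<open>i\<close> vanish, so only the values
    \<open>\<mu> j\<close> with \<open>j \<ge> i\<close> occur.\<close>
  have "(\<Sum>j<m. \<mu> i * (cc j)\<^sup>2) \<le> (\<Sum>j<m. \<mu> j * (cc j)\<^sup>2)"
  proof (rule sum_mono)
    fix j assume "j \<in> {..<m}"
    then show "\<mu> i * (cc j)\<^sup>2 \<le> \<mu> j * (cc j)\<^sup>2"
      using w(4)[of j] \<mu>_mono[of i j] by (cases "j < i") (auto simp: cc_def intro: mult_right_mono)
  qed
  then have aV: "\<mu> i * U\<^sup>2 \<le> a V V" by (simp add: V_def r_sum U sum_distrib_left)
  have az: "a z (f j) = dF j" if "j < n" for j using ag[OF that] by (simp add: z_def a.lin dF_def)
  have bz: "b z (e j) = b V (e j)" if "j < m" for j using bg[OF that] by (simp add: z_def b.lin)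
  have ag': "a g' (f j) = 0" if "j < n" for j
    using az[OF that] a_f_one[OF that, of "\<lambda>j. - dF j"] as[OF fH[OF that]]
    by (simp add: g'_def a.lin p_def)
  have bpe: "b p (e j) = 0" if "j < m" for j
    unfolding p_def b.lsum b.lin by (intro sum.neutral ballI) (use that in \<open>simp add: fe\<close>)
  have bg': "b g' (e j) = 0" if "j < m" for j
    using bz[OF that] bpe[OF that] b.ortho_coeff[OF e_ortho that, of "\<lambda>j. b V (e j)"]
    by (simp add: g'_def b.lin s_def)
  have ag'p: "a g' p = 0" unfolding p_def a.rsum a.lin by (intro sum.neutral ballI) (simp add: ag')
  have app: "a p p = - (\<Sum>j<n. (dF j)\<^sup>2)" unfolding p_def a_f by (simp add: power2_eq_square)
  have z: "z = g' + p + s" by (simp add: g'_def)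
  have azz: "a z z = a g' g' + a p p"
    using as[OF g'H] as[OF pH] as[OF sH] ag'p a.sym[of g' s] a.sym[of p s] a.sym[of p g']
    by (simp add: z a.lin)
  have dF: "(dF j)\<^sup>2 \<le> (1 + lam * D)\<^sup>2 * t\<^sup>2" if j: "j < n" for j
  proof -
    let ?d = "\<lambda>i. if i = j then 1 else 0 :: real"
    have 1: "(\<Sum>i<n. ?d i *\<^sub>R wf i) = wf j" "(\<Sum>i<n. (?d i)\<^sup>2) = 1" "(\<Sum>i<n. ?d i *\<^sub>R f i) = f j"
      using j by (simp_all add: if_distrib[of "\<lambda>c. c *\<^sub>R _"] if_distrib[of "\<lambda>c. c\<^sup>2"] cong: if_cong)
    have wfj: "q.nrm (wf j) \<le> k" using wf_le[of ?d] by (simp add: 1)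
    have fj: "b.nrm (f j) \<le> D" using nrm_b_f[of ?d] by (simp add: 1)
    \<comment> \<open>Orthogonality to \<open>M\<close> replaces \<open>f j\<close> by its
      potential, whose energy norm supplies the factor \<open>k\<close>. This gives the constant
      \<open>1 + lam * D\<close>, and \<open>A\<close> arises by adding up \<open>n\<close>
      squares.\<close>
    have "q V (f j - wf j) = 0" using we_sum(3)[OF wf(2)[OF j]] by (simp add: V_def)
    then have "dF j = q V (wf j) - lam * b V (f j)" by (simp add: dF_def a_def q.lin)
    moreover have "\<bar>q V (wf j)\<bar> \<le> (x * U) * k"
      using q.cauchy_schwarz[of V "wf j"] mult_mono[OF nqV wfj] x U q.nrm_nonneg by (force intro: order_trans)
    moreover have "\<bar>b V (f j)\<bar> \<le> t * D"
      using b.cauchy_schwarz[of V "f j"] mult_mono[OF nV fj] t b.nrm_nonneg by (force intro: order_trans)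
    then have "\<bar>lam * b V (f j)\<bar> \<le> lam * (t * D)"
      unfolding abs_mult using lam_nonneg by (simp add: mult_left_mono)
    ultimately have "\<bar>dF j\<bar> \<le> t + lam * (t * D)" by (simp add: t_def mult_ac)
    also have "\<dots> = (1 + lam * D) * t" by (simp add: algebra_simps)
    finally have "\<bar>dF j\<bar>\<^sup>2 \<le> ((1 + lam * D) * t)\<^sup>2" by (intro power_mono) auto
    then show ?thesis by (simp add: power_mult_distrib)
  qed
  have A0: "0 \<le> A" by (simp add: A_def)
  have dFs: "(\<Sum>j<n. (dF j)\<^sup>2) \<le> A * t\<^sup>2"
    using sum_mono[of "{..<n}" "\<lambda>j. (dF j)\<^sup>2" "\<lambda>_. (1 + lam * D)\<^sup>2 * t\<^sup>2"] dF by (simp add: A_def)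
  have bp: "b p p \<le> D\<^sup>2 * (A * t\<^sup>2)"
  proof -
    have "b p p \<le> D\<^sup>2 * (\<Sum>j<n. (dF j)\<^sup>2)" using D(2)[of "\<lambda>j. - dF j"] by (simp add: p_def)
    also have "\<dots> \<le> D\<^sup>2 * (A * t\<^sup>2)" using dFs by (intro mult_left_mono) auto
    finally show ?thesis .
  qed
  have "b s s = (\<Sum>j<m. (b V (e j))\<^sup>2)" unfolding s_def b.ortho_sum[OF e_ortho] by (simp add: power2_eq_square)
  then have bs: "b s s \<le> t\<^sup>2" using b.bessel[OF e_ortho, of V] bV by simp
  have sq3: "b z z \<le> 3 * (b g' g' + b p p + b s s)"
  proof -
    have "b (g' - p) (g' - p) \<ge> 0" "b (g' - s) (g' - s) \<ge> 0" "b (p - s) (p - s) \<ge> 0" by (rule b.nonneg)+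
    then show ?thesis unfolding z b.lin using b.sym[of p g'] b.sym[of s g'] b.sym[of s p] by simp
  qed
  have "c * b g' g' \<le> a g' g'"
    using coercive[OF g'H] ag' bg' by (simp add: a_def)
  moreover have "c * b z z \<le> c * (3 * (b g' g' + b p p + b s s))" using sq3 c_pos by (intro mult_left_mono) auto
  moreover have "c * (3 * (b g' g' + b p p + b s s)) \<le> c * (3 * (b g' g' + D\<^sup>2 * (A * t\<^sup>2) + t\<^sup>2))"
    using bp bs c_pos by (intro mult_left_mono) auto
  ultimately have azz2: "c / 3 * b z z - (c * (D\<^sup>2 * A + 1) + A) * t\<^sup>2 \<le> a z z"
    using azz app dFs by (simp add: algebra_simps)
  have "\<bar>b z V\<bar> \<le> b.nrm z * t"
    using b.cauchy_schwarz[of z V] mult_left_mono[OF nV b.nrm_nonneg[of z]] by simp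
  then have "2 * lam * (- b z V) \<le> 2 * lam * (b.nrm z * t)" using lam_nonneg by (intro mult_left_mono) auto
  \<comment> \<open>Completing the square spends one half of the coercivity \<open>c / 3\<close> of
    \<open>z\<close>; the other half is reserved for the normalisation defect.\<close>
  moreover have "0 \<le> c / 6 * (b.nrm z - 6 * lam / c * t)\<^sup>2" using c_pos by simp
  moreover have "c / 6 * (b.nrm z - 6 * lam / c * t)\<^sup>2
      = c / 6 * b z z + 6 * lam\<^sup>2 / c * t\<^sup>2 - 2 * lam * (b.nrm z * t)"
    using c_pos unfolding b.nrm_sq[symmetric] by (simp add: field_simps power2_eq_square)
  ultimately have cross: "- (c / 6 * b z z + 6 * lam\<^sup>2 / c * t\<^sup>2) \<le> 2 * lam * b z V" by linarith
  have "b g g \<le> 2 * b z z + 2 * b V V"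
  proof -
    have "b (z + V) (z + V) \<ge> 0" by (rule b.nonneg)
    then show ?thesis unfolding gz b.lin using b.sym[of z V] by simp
  qed
  then have bgg: "b g g \<le> 2 * b z z + 2 * t\<^sup>2" using bV by simp
  have x2: "x\<^sup>2 \<le> 1" using x by (simp add: power_le_one)
  \<comment> \<open>Only \<open>U\<^sup>2 = 1 - b g g\<close> of the mass of \<open>w\<close> lies
    in the eigenspace. The defect \<open>\<mu> i * b g g\<close> is absorbed because
    \<open>\<mu> i\<close> is of order \<open>x\<^sup>2\<close>.\<close>
  have "\<mu> i * b g g \<le> (1 + lam) * x\<^sup>2 * b g g"
    using \<mu>_bound[OF i] b.nonneg[of g] by (intro mult_right_mono) auto
  also have "\<dots> \<le> (1 + lam) * x\<^sup>2 * (2 * b z z + 2 * t\<^sup>2)" using bgg lam_nonneg by (intro mult_left_mono) auto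
  also have "\<dots> = (2 * (1 + lam) * x\<^sup>2) * b z z + x\<^sup>2 * (2 * (1 + lam) * t\<^sup>2)" by (simp add: algebra_simps)
  also have "\<dots> \<le> c / 6 * b z z + 1 * (2 * (1 + lam) * t\<^sup>2)"
    using c2 x2 lam_nonneg b.nonneg[of z] by (intro add_mono mult_right_mono) auto
  finally have "\<mu> i * b g g \<le> c / 6 * b z z + 2 * (1 + lam) * t\<^sup>2" by simp
  moreover have "\<mu> i * U\<^sup>2 = \<mu> i - \<mu> i * b g g"
  proof -
    have "U\<^sup>2 = 1 - b g g" using U1 by simp
    then show ?thesis by (simp only:) (simp add: algebra_simps)
  qed
  ultimately have "\<mu> i - (c * (D\<^sup>2 * A + 1) + A + 6 * lam\<^sup>2 / c + 2 * (1 + lam)) * t\<^sup>2 \<le> a w w"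
    using aw agg aV azz2 cross by (simp add: algebra_simps)
  moreover have "(c * (D\<^sup>2 * A + 1) + A + 6 * lam\<^sup>2 / c + 2 * (1 + lam)) * t\<^sup>2 \<le> \<tau> * x\<^sup>2"
  proof -
    have "U\<^sup>2 \<le> 1" using U1 b.nonneg[of g] by simp
    then have "t\<^sup>2 \<le> k\<^sup>2 * x\<^sup>2" unfolding t_def power_mult_distrib
      by (intro mult_left_le) auto
    then have "(c * (D\<^sup>2 * A + 1) + A + 6 * lam\<^sup>2 / c + 2 * (1 + lam)) * t\<^sup>2
      \<le> (c * (D\<^sup>2 * A + 1) + A + 6 * lam\<^sup>2 / c + 2 * (1 + lam)) * (k\<^sup>2 * x\<^sup>2)"
      using c_pos A0 lam_nonneg by (intro mult_left_mono) auto
    also have "\<dots> \<le> \<tau> * x\<^sup>2" using c1 by (simp add: mult_right_mono flip: mult.assoc)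
    finally show ?thesis .
  qed
  ultimately show ?thesis by simp
qed

text \<open>There are \<open>n + i\<close> conditions, namely \<open>n\<close> against
  \<open>f\<close> and \<open>i\<close> against the first eigenvectors, one fewer than the length of
  a competing family.\<close>

lemma lower_bound:
  defines "A \<equiv> real n * (1 + lam * D)\<^sup>2"
  assumes i: "i < m" and c1: "(c * (D\<^sup>2 * A + 1) + A + 6 * lam\<^sup>2 / c + 2 * (1 + lam)) * k\<^sup>2 \<le> \<tau>"
    and c2: "2 * (1 + lam) * x\<^sup>2 \<le> c / 6"
    and ex: "\<exists>g. (\<forall>j<n + Suc i. g j \<in> M) \<and> b.ortho (n + Suc i) g"
  shows "lam + \<mu> i - \<tau> * x\<^sup>2 \<le> minmax M (n + Suc i)"
proof -
  from ex obtain g0 where g0: "\<forall>j<n + Suc i. g0 j \<in> M" "b.ortho (n + Suc i) g0" by blast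
  show ?thesis
  proof (rule minmax_ge[OF g0])
    fix g assume g: "\<forall>j<n + Suc i. g j \<in> M" "b.ortho (n + Suc i) g"
    define T where "T = (\<lambda>l j. if l < n then a (g j) (f l) else b (g j) (e (l - n)))"
    obtain C where C: "(\<Sum>j<n + Suc i. (C j)\<^sup>2) = 1" "\<And>l. l < n + i \<Longrightarrow> (\<Sum>j<n + Suc i. C j * T l j) = 0"
      using exists_unit_kernel_vector[of "n + i" "n + Suc i" T] by auto
    define w where "w = (\<Sum>j<n + Suc i. C j *\<^sub>R g j)"
    have "w \<in> M" unfolding w_def using g M by (intro subspace_sum subspace_scale) auto
    moreover have bw: "b w w = 1"
      unfolding w_def b.ortho_sum[OF g(2)] using C(1) by (simp add: power2_eq_square)
    moreover have "a w (f l) = 0" if "l < n" for l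
      using C(2)[of l] that by (simp add: w_def a.lsum a.lin T_def)
    moreover have "b w (e l) = 0" if "l < i" for l
      using C(2)[of "n + l"] that by (simp add: w_def b.lsum b.lin T_def)
    ultimately have "\<mu> i - \<tau> * x\<^sup>2 \<le> a w w"
      using lower_vector[OF i c1[unfolded A_def] c2] by blast
    then have "lam + \<mu> i - \<tau> * x\<^sup>2 \<le> q w w" using bw by (simp add: a_def)
    then show "\<exists>c. (\<Sum>j<n + Suc i. (c j)\<^sup>2) = 1 \<and> lam + \<mu> i - \<tau> * x\<^sup>2
      \<le> q (\<Sum>j<n + Suc i. c j *\<^sub>R g j) (\<Sum>j<n + Suc i. c j *\<^sub>R g j)"
      using C(1) by (intro exI[of _ C]) (simp add: w_def)
  qed
qed

end


text \<open>The order of the quantifiers is the point: the threshold depends on \<open>n\<close>,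
  \<open>lam\<close>, \<open>D\<close>, \<open>c\<close> and \<tau> only, while the basis
  \<open>e\<close>, the space \<open>M\<close> and the potentials change with the
  perturbation.\<close>

lemma (in form_pair) minmax_perturbation:
  assumes "0 \<le> lam" "0 \<le> D" "0 < c" "0 < \<tau>"
  obtains \<kappa> where "0 < \<kappa>"
    "\<And>H m e f M we wf k x \<mu> i. perturbed_value q b H lam m n e f D c M we wf k x \<mu> \<Longrightarrow>
      k \<le> \<kappa> \<Longrightarrow> x \<le> \<kappa> \<Longrightarrow> i < m \<Longrightarrow> \<bar>minmax M (n + Suc i) - lam - \<mu> i\<bar> \<le> \<tau> * x\<^sup>2"
proof -
  define \<sigma> where "\<sigma> = min \<tau> 1"
  have \<sigma>: "0 < \<sigma>" "\<sigma> \<le> 1" "\<sigma> \<le> \<tau>" using assms by (auto simp: \<sigma>_def)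
  define A where "A = real n * (1 + lam * D)\<^sup>2"
  define C1 where "C1 = (2 + lam) * (4 * D + 6) + 4 * lam\<^sup>2 * (D + 1)\<^sup>2"
  define C2 where "C2 = D\<^sup>2 + (4 * D + 6)"
  define C5 where "C5 = c * (D\<^sup>2 * A + 1) + A + 6 * lam\<^sup>2 / c + 2 * (1 + lam)"
  have nn: "0 \<le> C1" "0 \<le> C2" "0 \<le> A" "0 \<le> C5"
    using assms by (auto simp: C1_def C2_def C5_def A_def)
  \<comment> \<open>Every smallness condition is continuous in \<open>t\<close> and strict at 0, so
    all of them hold for some positive \<open>t\<close>.\<close>
  have "eventually (\<lambda>t::real. t * C1 < \<sigma> \<and> (2 + lam) * t\<^sup>2 * C2 < 1/4 \<and> 2 * lam * D * t < 1/2 \<and>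
      t * (4 * D + 6) * (1 + lam) < 1 \<and> C5 * t\<^sup>2 < \<sigma> \<and> 2 * (1 + lam) * t\<^sup>2 < c / 6 \<and> 0 < t) (at_right 0)"
    by (intro eventually_conj order_tendstoD(2)[where y = 0] eventually_at_right_less)
      (use \<sigma> assms in \<open>auto intro!: tendsto_eq_intros\<close>)
  from eventually_happens[OF this] obtain \<kappa> where \<kappa>: "0 < \<kappa>" "\<kappa> * C1 < \<sigma>" "(2 + lam) * \<kappa>\<^sup>2 * C2 < 1/4"
    "2 * lam * D * \<kappa> < 1/2" "\<kappa> * (4 * D + 6) * (1 + lam) < 1" "C5 * \<kappa>\<^sup>2 < \<sigma>" "2 * (1 + lam) * \<kappa>\<^sup>2 < c / 6"
    by auto
  show ?thesis
  proof (rule that[OF \<kappa>(1)])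
    fix H :: "'v set" and m i :: nat and e f we wf :: "nat \<Rightarrow> 'v" and M k x \<mu>
    assume "perturbed_value q b H lam m n e f D c M we wf k x \<mu>"
    then interpret p: perturbed_value q b H lam m n e f D c M we wf k x \<mu> .
    assume le: "k \<le> \<kappa>" "x \<le> \<kappa>" and i: "i < m"
    have k2: "k\<^sup>2 \<le> \<kappa>\<^sup>2" "x\<^sup>2 \<le> \<kappa>\<^sup>2" using le p.k p.x by (auto intro: power_mono)
    have 1: "k * C1 \<le> \<sigma>" using mult_right_mono[OF le(1) nn(1)] \<kappa>(2) by linarith
    have "(2 + lam) * C2 * x\<^sup>2 \<le> (2 + lam) * C2 * \<kappa>\<^sup>2" using k2 nn assms by (intro mult_left_mono) auto
    then have 2: "(2 + lam) * x\<^sup>2 * C2 \<le> 1/4" using \<kappa>(3) by (simp add: mult_ac)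
    have 3: "2 * lam * D * k \<le> 1/2" using mult_left_mono[OF le(1), of "2 * lam * D"] \<kappa>(4) assms by simp
    have "k * ((4 * D + 6) * (1 + lam)) \<le> \<kappa> * ((4 * D + 6) * (1 + lam))"
      using le assms by (intro mult_right_mono) auto
    then have 4: "k * (4 * D + 6) * (1 + lam) < 1" using \<kappa>(5) by (simp add: mult.assoc)
    have 5: "C5 * k\<^sup>2 \<le> \<sigma>" using mult_left_mono[OF k2(1) nn(4)] \<kappa>(6) by linarith
    have 6: "2 * (1 + lam) * x\<^sup>2 \<le> c / 6"
    proof -
      have "2 * (1 + lam) * x\<^sup>2 \<le> 2 * (1 + lam) * \<kappa>\<^sup>2" using k2 assms by (intro mult_left_mono) auto
      then show ?thesis using \<kappa>(7) by linarith
    qed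
    note up = p.upper_bound[OF i \<sigma>(1,2) 1[unfolded C1_def] 2[unfolded C2_def] 3 4]
    have "lam + \<mu> i - \<sigma> * x\<^sup>2 \<le> minmax M (n + Suc i)"
      by (rule p.lower_bound[OF i 5[unfolded C5_def A_def] 6 up(2)])
    moreover have "\<sigma> * x\<^sup>2 \<le> \<tau> * x\<^sup>2" using \<sigma> by (intro mult_right_mono) auto
    ultimately show "\<bar>minmax M (n + Suc i) - lam - \<mu> i\<bar> \<le> \<tau> * x\<^sup>2"
      using up(1) by (simp add: abs_le_iff)
  qed
qed

text \<open>
  Removing the \<open>e\<close>-components from a nearly optimal min-max family does not change \<open>a\<close>, so its span remains negative
  definite; \<open>f\<close> is an orthonormal basis of it for \<open>- a\<close>. Coercivity of \<open>a\<close> at \<open>g\<close> comes from testing the next min-max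
  value with the span of \<open>f\<close>, \<open>e\<close> and \<open>g\<close>.
\<close>
lemma (in form_pair) degenerate_value_exists:
  assumes H: "subspace H" and null: "\<And>x. x \<in> H \<Longrightarrow> b x x = 0 \<Longrightarrow> q x x = 0"
    and lam: "0 \<le> lam" "lam = minmax H (Suc n)" "n = 0 \<or> minmax H n < lam" "lam < minmax H (Suc n + m)"
    and e: "\<forall>j<m. e j \<in> H" "b.ortho m e" "\<And>j v. j < m \<Longrightarrow> v \<in> H \<Longrightarrow> q (e j) v = lam * b (e j) v"
  obtains f D c where "degenerate_value q b H lam m n e f D c"
proof -
  define a where "a = (\<lambda>x y. q x y - lam * b x y)"
  interpret a: sym_form "\<lambda>x y. - a x y"
  proof
    show "bilinear (\<lambda>x y. - a x y)"
      unfolding bilinear_def a_def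
      by (intro conjI allI linearI) (simp_all add: q.lin b.lin algebra_simps)
    show "- a x y = - a y x" for x y by (simp add: a_def q.sym[of x] b.sym[of x])
  qed
  have ae: "a (\<Sum>j<m. d j *\<^sub>R e j) v = 0" if "v \<in> H" for d v
  proof -
    have "- a (\<Sum>j<m. d j *\<^sub>R e j) v = 0"
      unfolding a.lsum a.lmul by (intro sum.neutral ballI) (use that in \<open>simp add: a_def e\<close>)
    then show ?thesis by simp
  qed
  have "\<exists>f. (\<forall>j<n. f j \<in> H) \<and> a.ortho n f \<and> (\<forall>i<n. \<forall>j<m. b (f i) (e j) = 0)"
  proof (cases "n = 0")
    case False
    obtain f0 where f0: "\<forall>j<n. f0 j \<in> H" "b.ortho n f0" "rayleigh_sup n f0 < lam"
      using minmax_less_family[of n H "Suc n"] lam False by auto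
    have neg: "a (\<Sum>j<n. C j *\<^sub>R f0 j) (\<Sum>j<n. C j *\<^sub>R f0 j) < 0" if C: "\<exists>j<n. C j \<noteq> 0" for C
    proof -
      define S where "S = (\<Sum>j<n. (C j)\<^sup>2)"
      from C obtain r where r: "r < n" "C r \<noteq> 0" by blast
      have S: "S > 0" unfolding S_def using r by (intro sum_pos2[of _ r]) auto
      have 1: "(\<Sum>j<n. (C j / sqrt S)\<^sup>2) = 1"
        using S by (simp add: power_divide sum_divide_distrib[symmetric] S_def[symmetric])
      have 2: "(\<Sum>j<n. (C j / sqrt S) *\<^sub>R f0 j) = (1 / sqrt S) *\<^sub>R (\<Sum>j<n. C j *\<^sub>R f0 j)"
        by (simp add: scaleR_sum_right)
      have "q (\<Sum>j<n. C j *\<^sub>R f0 j) (\<Sum>j<n. C j *\<^sub>R f0 j) / S < lam"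
        using rayleigh_sup_ge[OF 1, of f0] f0(3) S unfolding 2 by (simp add: q.lin)
      moreover have "b (\<Sum>j<n. C j *\<^sub>R f0 j) (\<Sum>j<n. C j *\<^sub>R f0 j) = S"
        unfolding b.ortho_sum[OF f0(2)] S_def by (simp add: power2_eq_square)
      ultimately show ?thesis using S by (simp add: a_def field_simps)
    qed
    define f1 where "f1 = (\<lambda>j. f0 j - (\<Sum>l<m. b (f0 j) (e l) *\<^sub>R e l))"
    have f1H: "\<forall>j<n. f1 j \<in> H"
      unfolding f1_def using f0 e H by (auto intro!: subspace_diff subspace_sum subspace_scale)
    have pos: "- a (\<Sum>j<n. C j *\<^sub>R f1 j) (\<Sum>j<n. C j *\<^sub>R f1 j) > 0" if C: "\<exists>j<n. C j \<noteq> 0" for C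
    proof -
      define E where "E = (\<Sum>l<m. (\<Sum>j<n. C j * b (f0 j) (e l)) *\<^sub>R e l)"
      define F where "F = (\<Sum>j<n. C j *\<^sub>R f0 j)"
      have EH: "E \<in> H" "F \<in> H"
        unfolding E_def F_def using f0 e H by (auto intro!: subspace_diff subspace_sum subspace_scale)
      have "(\<Sum>j<n. C j *\<^sub>R f1 j) = F - E"
        by (simp add: f1_def F_def E_def scaleR_diff_right sum_subtractf scaleR_sum_right scaleR_sum_left)
          (rule sum.swap)
      moreover have "a E E = 0" "a E F = 0" using ae EH by (auto simp: E_def)
      moreover have "a F E = 0" using \<open>a E F = 0\<close> a.sym[of F E] by simp
      ultimately have "- a (\<Sum>j<n. C j *\<^sub>R f1 j) (\<Sum>j<n. C j *\<^sub>R f1 j) = - a F F"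
        by (simp only: a.lin)
      then show ?thesis using neg[OF C] by (simp add: F_def)
    qed
    from a.gram_schmidt[OF pos] obtain f where f: "\<forall>j<n. f j \<in> span (f1 ` {..<n})" "a.ortho n f" by blast
    have "span (f1 ` {..<n}) \<subseteq> H" using f1H H by (intro span_minimal) auto
    then have 1: "\<forall>j<n. f j \<in> H" using f by blast
    have "b (f1 i) (e j) = 0" if "i < n" "j < m" for i j
      using b.ortho_coeff[OF e(2) that(2), of "\<lambda>l. b (f0 i) (e l)"] by (simp add: f1_def b.lin)
    then have "b v (e j) = 0" if "v \<in> span (f1 ` {..<n})" "j < m" for v j
      using that unfolding span_image_lessThan by (auto simp: b.lsum b.lin)
    then show ?thesis using 1 f by blast
  qed (auto simp: a.ortho_def)
  then obtain f where f: "\<forall>j<n. f j \<in> H" "a.ortho n f" "\<forall>i<n. \<forall>j<m. b (f i) (e j) = 0" by blast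
  define D where "D = (\<Sum>j<n. b.nrm (f j))"
  have D0: "0 \<le> D" by (auto simp: D_def intro!: sum_nonneg b.nrm_nonneg)
  have D: "b (\<Sum>j<n. d j *\<^sub>R f j) (\<Sum>j<n. d j *\<^sub>R f j) \<le> D\<^sup>2 * (\<Sum>j<n. (d j)\<^sup>2)" for d
  proof -
    have "b.nrm (\<Sum>j<n. d j *\<^sub>R f j) \<le> sqrt (\<Sum>j<n. (d j)\<^sup>2) * D"
      unfolding D_def by (rule b.nrm_sum_unit) (auto simp: sum_nonneg)
    then have "(b.nrm (\<Sum>j<n. d j *\<^sub>R f j))\<^sup>2 \<le> (sqrt (\<Sum>j<n. (d j)\<^sup>2) * D)\<^sup>2"
      by (intro power_mono b.nrm_nonneg)
    then show ?thesis by (simp add: b.nrm_sq power_mult_distrib sum_nonneg mult.commute)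
  qed
  define \<eta> where "\<eta> = minmax H (Suc n + m) - lam"
  have \<eta>: "\<eta> > 0" using lam by (simp add: \<eta>_def)
  \<comment> \<open>The term \<open>4 / \<eta>\<close> pays for the \<open>L\<^sup>2\<close> norm of
    the test vector out of half the gap; \<open>2 * D\<^sup>2\<close> pays for subtracting its
    \<open>f\<close>-part.\<close>
  define K where "K = 4 / \<eta> + 2 * D\<^sup>2"
  have K: "K > 0" using \<eta> by (auto simp: K_def intro: add_pos_nonneg)
  have coercive: "1 / K * b g g \<le> a g g"
    if g: "g \<in> H" "\<forall>i<n. a g (f i) = 0" "\<forall>j<m. b g (e j) = 0" for g
  proof (cases "b g g = 0")
    case True
    then show ?thesis using q.nonneg by (simp add: a_def)
  next
    case False
    define y where "y = (\<lambda>j. if j < n then f j else if j < n + m then e (j - n) else g)"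
    have comb: "(\<Sum>j<n + Suc m. C j *\<^sub>R y j) =
       (\<Sum>j<n. C j *\<^sub>R f j) + ((\<Sum>j<m. C (n + j) *\<^sub>R e j) + C (n + m) *\<^sub>R g)" for C
      unfolding sum_lessThan_add by (simp add: y_def)
    have yH: "\<forall>j<n + Suc m. y j \<in> H" using f e g by (auto simp: y_def)
    have fH: "(\<Sum>j<n. d j *\<^sub>R f j) \<in> H" for d using f H by (auto intro!: subspace_sum subspace_scale)
    have eH: "(\<Sum>j<m. d j *\<^sub>R e j) \<in> H" for d using e H by (auto intro!: subspace_sum subspace_scale)
    have bef: "b (\<Sum>j<n. d j *\<^sub>R f j) (e l) = 0" if "l < m" for d l
      unfolding b.lsum b.lin by (intro sum.neutral ballI) (use f that in simp)
    have agf: "a g (\<Sum>j<n. d j *\<^sub>R f j) = 0" for d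
    proof -
      have "- a g (\<Sum>j<n. d j *\<^sub>R f j) = 0"
        unfolding a.rsum a.lin by (intro sum.neutral ballI) (use g in simp)
      then show ?thesis by simp
    qed
    have indep: "\<forall>j<n + Suc m. C j = 0"
      if z: "b (\<Sum>j<n + Suc m. C j *\<^sub>R y j) (\<Sum>j<n + Suc m. C j *\<^sub>R y j) = 0" for C
    proof -
      define v where "v = (\<Sum>j<n + Suc m. C j *\<^sub>R y j)"
      have vH: "v \<in> H" unfolding v_def by (intro subspace_sum subspace_scale H) (use yH in blast)
      have bv: "b w v = 0" for w using z by (auto simp: v_def intro: b.null_right)
      \<comment> \<open>An \<open>L\<^sup>2\<close>-null vector of \<open>H\<close> is also
        energy-null, hence invisible to \<open>a\<close>. This allows the coefficients along
        \<open>f\<close> to be read off with \<open>a\<close>.\<close>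
      have qv: "q w v = 0" for w using null[OF vH] z by (auto simp: v_def intro: q.null_right)
      have Ce: "C (n + l) = 0" if "l < m" for l
      proof -
        have "b v (e l) = C (n + l)"
          unfolding v_def comb using bef[OF that] b.ortho_coeff[OF e(2) that, of "\<lambda>j. C (n + j)"] g(3) that
          by (simp add: b.lin)
        then show ?thesis using bv[of "e l"] b.sym[of v "e l"] by simp
      qed
      then have v: "v = (\<Sum>j<n. C j *\<^sub>R f j) + C (n + m) *\<^sub>R g"
        unfolding v_def comb by simp
      have Cf: "C l = 0" if "l < n" for l
      proof -
        have "- a v (f l) = C l"
          using a.ortho_coeff[OF f(2) that, of C] g(2) that unfolding v a.lin by simp
        then show ?thesis using bv[of "f l"] qv[of "f l"] b.sym[of v "f l"] q.sym[of v "f l"]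
          by (simp add: a_def)
      qed
      then have "v = C (n + m) *\<^sub>R g" using v by simp
      moreover have "b v v = 0" by (rule bv)
      ultimately have "C (n + m) = 0" using False by (simp add: b.lin)
      with Ce Cf show ?thesis
        by (metis add_diff_inverse_nat add_Suc_right less_Suc_eq nat_add_left_cancel_less)
    qed
    obtain z where z: "\<forall>j<n + Suc m. z j \<in> span (y ` {..<n + Suc m})" "\<forall>j<n + Suc m. z j \<in> H" "b.ortho (n + Suc m) z"
      using ortho_family_of_independent[OF H yH indep] by blast
    \<comment> \<open>The maximum over the span is not assumed to be attained; giving up half of the
      gap leaves room for a nearly maximal vector.\<close>
    have "lam + \<eta> / 2 < minmax H (n + Suc m)" using \<eta> by (simp add: \<eta>_def field_simps)
    then obtain C where C: "(\<Sum>j<n + Suc m. (C j)\<^sup>2) = 1"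
        "lam + \<eta> / 2 < q (\<Sum>j<n + Suc m. C j *\<^sub>R z j) (\<Sum>j<n + Suc m. C j *\<^sub>R z j)"
      using minmax_gt[OF _ z(2,3)] by auto
    define v where "v = (\<Sum>j<n + Suc m. C j *\<^sub>R z j)"
    have bv1: "b v v = 1" unfolding v_def b.ortho_sum[OF z(3)] using C(1) by (simp add: power2_eq_square)
    have av: "\<eta> / 2 * b v v < a v v" using C(2) bv1 by (simp add: a_def v_def)
    obtain d where d: "v = (\<Sum>j<n + Suc m. d j *\<^sub>R y j)"
      unfolding v_def by (rule span_comb[OF z(1)])
    define F E t where "F = (\<Sum>j<n. d j *\<^sub>R f j)" and "E = (\<Sum>j<m. d (n + j) *\<^sub>R e j)" and "t = d (n + m)"
    define G where "G = F + t *\<^sub>R g"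
    have v: "v = E + G" unfolding d comb by (simp add: F_def E_def G_def t_def)
    have GH: "G \<in> H" "E \<in> H" unfolding G_def F_def E_def using fH eH g H
      by (auto intro!: subspace_add subspace_scale)
    have aE: "a E E = 0" "a E G = 0" using ae GH by (auto simp: E_def)
    have "a G E = 0" using aE a.sym[of G E] by simp
    have "- a F F = (\<Sum>j<n. d j * d j)" unfolding F_def by (rule a.ortho_sum[OF f(2)])
    then have aF: "- a F F = (\<Sum>j<n. (d j)\<^sup>2)" by (simp add: power2_eq_square)
    have agF: "a g F = 0" "a F g = 0" using agf a.sym[of F g] by (auto simp: F_def)
    have "- a v v = - a G G" unfolding v a.lin using aE \<open>a G E = 0\<close> by simp
    also have "\<dots> = - a F F - t\<^sup>2 * a g g"
      unfolding G_def a.lin using agF by (simp add: power2_eq_square)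
    finally have tg: "t\<^sup>2 * a g g = a v v + (\<Sum>j<n. (d j)\<^sup>2)" using aF by simp
    have bGe: "b G (e l) = 0" if "l < m" for l
      unfolding G_def b.lin using bef[OF that] g that by (simp add: F_def)
    have "b G E = 0" unfolding E_def b.rsum b.lin by (intro sum.neutral ballI) (simp add: bGe)
    then have "b G G \<le> b v v" using b.nonneg[of E] b.sym[of E G] by (simp add: v b.lin)
    moreover have "b (t *\<^sub>R g) (t *\<^sub>R g) \<le> 2 * b G G + 2 * b F F"
    proof -
      have "b (G + F) (G + F) \<ge> 0" by (rule b.nonneg)
      moreover have "t *\<^sub>R g = G - F" by (simp add: G_def)
      ultimately show ?thesis using b.sym[of G F] by (simp add: b.lin)
    qed
    moreover have "b F F \<le> D\<^sup>2 * (\<Sum>j<n. (d j)\<^sup>2)" unfolding F_def by (rule D)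
    ultimately have "t\<^sup>2 * b g g \<le> 2 * b v v + 2 * D\<^sup>2 * (\<Sum>j<n. (d j)\<^sup>2)"
      by (simp add: b.lin power2_eq_square)
    also have "\<dots> = 4 / \<eta> * (\<eta> / 2 * b v v) + 2 * D\<^sup>2 * (\<Sum>j<n. (d j)\<^sup>2)" using \<eta> by simp
    also have "\<dots> \<le> K * (\<eta> / 2 * b v v) + K * (\<Sum>j<n. (d j)\<^sup>2)"
      using \<eta> b.nonneg[of v] by (intro add_mono mult_right_mono) (auto simp: K_def intro!: sum_nonneg)
    also have "\<dots> \<le> K * (a v v) + K * (\<Sum>j<n. (d j)\<^sup>2)" using K av by simp
    also have "\<dots> = t\<^sup>2 * (K * a g g)" using tg by (simp add: algebra_simps)
    finally have 1: "t\<^sup>2 * b g g \<le> t\<^sup>2 * (K * a g g)" .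
    \<comment> \<open>The vector found must involve \<open>g\<close>: without it, \<open>a\<close>
      would not be positive there. So \<open>t\<^sup>2\<close> can be cancelled.\<close>
    have "t\<^sup>2 * a g g > 0" unfolding tg using av bv1 \<eta> by (intro add_pos_nonneg) (auto intro!: sum_nonneg)
    then have "t\<^sup>2 > 0" by (cases "t = 0") auto
    then have "b g g \<le> K * a g g" using 1 by simp
    then show ?thesis using K by (simp add: field_simps)
  qed
  have "degenerate_value q b H lam m n e f D (1 / K)"
  proof unfold_locales
    show "q (f i) (f j) - lam * b (f i) (f j) = (if i = j then -1 else 0)" if "i < n" "j < n" for i j
    proof -
      have "- a (f i) (f j) = (if i = j then 1 else 0)" using f(2) that unfolding a.ortho_def by blast
      then show ?thesis by (simp add: a_def split: if_splits)
    qed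
    show "1 / K * b g g \<le> q g g - lam * b g g"
      if "g \<in> H" "\<forall>i<n. q g (f i) - lam * b g (f i) = 0" "\<forall>j<m. b g (e j) = 0" for g
      using coercive that by (simp add: a_def)
  qed (use H lam(1) e f D0 D K in auto)
  then show ?thesis by (rule that)
qed

subsection \<open>Riesz representation\<close>

text \<open>The representative minimises \<open>B v v - 2 * \<phi> v\<close> on \<open>M\<close>. In
  the parallelogram law the linear terms cancel, which makes every minimising sequence Cauchy, and
  definiteness does not enter.\<close>

lemma (in psd_form) riesz:
  assumes M: "subspace M"
    and complete: "\<And>X. \<forall>n::nat. X n \<in> M \<Longrightarrow> \<forall>\<epsilon>>0. \<exists>N. \<forall>m\<ge>N. \<forall>n\<ge>N. nrm (X m - X n) < \<epsilon> \<Longrightarrow>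
      \<exists>l\<in>M. (\<lambda>n. nrm (X n - l)) \<longlonglongrightarrow> 0"
    and \<phi>: "linear \<phi>" and bounded: "\<And>v. v \<in> M \<Longrightarrow> \<bar>\<phi> v\<bar> \<le> C * nrm v"
  obtains w where "w \<in> M" "\<And>v. v \<in> M \<Longrightarrow> B w v = \<phi> v"
proof -
  interpret \<phi>: linear \<phi> by (rule \<phi>)
  define J where "J v = B v v - 2 * \<phi> v" for v
  have low: "- (C\<^sup>2) \<le> J v" if "v \<in> M" for v
  proof -
    have "0 \<le> (nrm v - C)\<^sup>2" by simp
    then have "2 * (C * nrm v) \<le> B v v + C\<^sup>2" by (simp add: power2_diff nrm_sq mult_ac)
    then show ?thesis using bounded[OF that] by (simp add: J_def)
  qed
  define I where "I = Inf (J ` M)"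
  have bdd: "bdd_below (J ` M)" using low by (auto intro!: bdd_belowI[of _ "- (C\<^sup>2)"])
  have Ile: "I \<le> J v" if "v \<in> M" for v unfolding I_def using bdd that by (intro cInf_lower) auto
  have "\<exists>v\<in>M. J v < I + 1 / real (Suc n)" for n
  proof -
    have "J ` M \<noteq> {}" using subspace_0[OF M] by auto
    moreover have "Inf (J ` M) < I + 1 / real (Suc n)" by (simp add: I_def)
    ultimately show ?thesis using cInf_lessD[of "J ` M" "I + 1 / real (Suc n)"] by auto
  qed
  then obtain X where X: "\<And>n. X n \<in> M" "\<And>n. J (X n) < I + 1 / real (Suc n)" by metis
  have par: "B (x - y) (x - y) = 2 * J x + 2 * J y - 4 * J ((1/2) *\<^sub>R (x + y))" for x y
    by (simp add: J_def lin \<phi>.scaleR \<phi>.add sym[of y x] algebra_simps)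
  have cauchy: "B (X m - X n) (X m - X n) \<le> 4 / real (Suc N)" if "m \<ge> N" "n \<ge> N" for m n N
  proof -
    have "I \<le> J ((1/2) *\<^sub>R (X m + X n))" using X M by (intro Ile subspace_scale subspace_add) auto
    moreover have "1 / real (Suc m) \<le> 1 / real (Suc N)" "1 / real (Suc n) \<le> 1 / real (Suc N)"
      using that by (auto simp: field_simps)
    then have "J (X m) \<le> I + 1 / real (Suc N)" "J (X n) \<le> I + 1 / real (Suc N)"
      using X(2)[of m] X(2)[of n] by linarith+
    ultimately show ?thesis unfolding par by simp
  qed
  have "\<exists>N. \<forall>m\<ge>N. \<forall>n\<ge>N. nrm (X m - X n) < \<epsilon>" if eps: "\<epsilon> > 0" for \<epsilon>
  proof -
    obtain N where N: "4 / real (Suc N) < (\<epsilon>/2)\<^sup>2"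
    proof -
      have "(\<epsilon>/2)\<^sup>2 / 4 > 0" using eps by simp
      then obtain N where "inverse (real (Suc N)) < (\<epsilon>/2)\<^sup>2 / 4" using reals_Archimedean by blast
      then show ?thesis by (intro that[of N]) (simp add: field_simps)
    qed
    have "nrm (X m - X n) \<le> \<epsilon>/2" if "m \<ge> N" "n \<ge> N" for m n
      using cauchy[OF that] N \<open>\<epsilon> > 0\<close> by (subst nrm_le_iff) auto
    then show ?thesis using \<open>\<epsilon> > 0\<close> by (intro exI[of _ N]) force
  qed
  then obtain l where l: "l \<in> M" "(\<lambda>n. nrm (X n - l)) \<longlonglongrightarrow> 0"
    using complete[of X] X(1) by blast
  have "B l v = \<phi> v" if v: "v \<in> M" for v
  proof -
    have "(\<lambda>n. nrm (X n - l) * nrm v) \<longlonglongrightarrow> 0" using tendsto_mult_left_zero[OF l(2)] by simp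
    then have "(\<lambda>n. B (X n - l) v) \<longlonglongrightarrow> 0"
      by (rule Lim_null_comparison[rotated]) (simp add: cauchy_schwarz)
    then have lim: "(\<lambda>n. B (X n) v) \<longlonglongrightarrow> B l v" unfolding lin by (rule LIM_zero_cancel)
    \<comment> \<open>Perturbing a nearly minimal \<open>X n\<close> by a multiple of
      \<open>v\<close> costs at most the defect \<open>1 / Suc n\<close>, which disappears in the
      limit.\<close>
    have ineq: "0 \<le> 2 * t * (B l v - \<phi> v) + t\<^sup>2 * B v v" for t
    proof -
      have "- (1 / real (Suc n)) \<le> 2 * t * (B (X n) v - \<phi> v) + t\<^sup>2 * B v v" for n
      proof -
        have "I \<le> J (X n + t *\<^sub>R v)" using X v M by (intro Ile subspace_add subspace_scale) auto
        moreover have "J (X n + t *\<^sub>R v) = J (X n) + (2 * t * (B (X n) v - \<phi> v) + t\<^sup>2 * B v v)"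
          by (simp add: J_def lin \<phi>.scaleR \<phi>.add sym[of v "X n"] power2_eq_square algebra_simps)
        ultimately show ?thesis using X(2)[of n] by linarith
      qed
      moreover have "(\<lambda>n. - (1 / real (Suc n))) \<longlonglongrightarrow> - 0"
        by (intro tendsto_minus LIMSEQ_Suc lim_1_over_n)
      moreover have "(\<lambda>n. 2 * t * (B (X n) v - \<phi> v) + t\<^sup>2 * B v v) \<longlonglongrightarrow> 2 * t * (B l v - \<phi> v) + t\<^sup>2 * B v v"
        by (intro tendsto_intros lim)
      ultimately have "- 0 \<le> 2 * t * (B l v - \<phi> v) + t\<^sup>2 * B v v" by (blast intro: LIMSEQ_le)
      then show ?thesis by simp
    qed
    show ?thesis
    proof (rule ccontr)
      define s where "s = B l v - \<phi> v"
      assume "B l v \<noteq> \<phi> v"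
      then have s: "s \<noteq> 0" by (simp add: s_def)
      \<comment> \<open>Approximately the minimiser of the quadratic polynomial; adding 1 keeps the
        denominator positive for null vectors \<open>v\<close>.\<close>
      define t where "t = - s / (1 + B v v)"
      have p: "1 + B v v > 0" using nonneg[of v] by linarith
      have ts: "t * (1 + B v v) = - s" using p by (simp add: t_def)
      have "t * s = - (s\<^sup>2 / (1 + B v v))" by (simp add: t_def power2_eq_square)
      also have "\<dots> < 0" using s p by simp
      finally have "t * s < 0" .
      moreover have "t\<^sup>2 * B v v \<le> t * (t * (1 + B v v))" by (simp add: power2_eq_square algebra_simps)
      ultimately have "2 * t * s + t\<^sup>2 * B v v < 0" unfolding ts by simp
      then show False using ineq[of t] by (simp add: s_def)
    qed
  qed
  then show ?thesis using that l(1) by blast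
qed

subsection \<open>Smooth functions\<close>

text \<open>These functions are smooth because the family is closed under differentiation.\<close>
definition flat :: "real poly \<Rightarrow> real \<Rightarrow> real" where
  "flat p t = (if t \<le> 0 then 0 else poly p (1 / t) * exp (- (1 / t)))"

lemma poly_exp_tendsto_0: "((\<lambda>t. poly p t * exp (- t)) \<longlongrightarrow> (0::real)) at_top"
proof -
  have "((\<lambda>t. \<Sum>i\<le>degree p. coeff p i * (t ^ i / exp t)) \<longlongrightarrow> (\<Sum>i\<le>degree p. coeff p i * 0)) at_top"
    by (intro tendsto_sum tendsto_mult tendsto_const tendsto_power_div_exp_0)
  then show ?thesis
    by (simp add: poly_altdef sum_distrib_right exp_minus divide_inverse mult.assoc)
qed

text \<open>With \<open>s = 1 / t\<close> the operator \<open>d/dt\<close> becomes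
  \<open>- s\<^sup>2 d/ds\<close>, which maps \<open>p(s) exp(-s)\<close> to
  \<open>s\<^sup>2 (p - p')(s) exp(-s)\<close>.\<close>

lemma flat_has_derivative: "(flat p has_real_derivative flat ([:0, 0, 1:] * (p - pderiv p)) t) (at t)"
proof -
  consider "t < 0" | "t = 0" | "t > 0" by linarith
  then show ?thesis
  proof cases
    case 1
    have "((\<lambda>_. 0) has_real_derivative 0) (at t)" by simp
    then have "(flat p has_real_derivative 0) (at t)"
      by (rule DERIV_cong_ev[THEN iffD1, rotated -1])
        (use 1 in \<open>auto simp: flat_def intro: eventually_mono[OF eventually_nhds_in_open[of "{..<0}"]]\<close>)
    then show ?thesis using 1 by (simp add: flat_def)
  next
    case 2
    \<comment> \<open>The right difference quotient at 0 carries one more factor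
      \<open>1 / t\<close>, that is, the polynomial is multiplied by the variable.\<close>
    have "((\<lambda>t. poly ([:0, 1:] * p) t * exp (- t)) \<longlongrightarrow> (0::real)) at_top" by (rule poly_exp_tendsto_0)
    then have "((\<lambda>t. poly ([:0, 1:] * p) (inverse t) * exp (- (inverse t))) \<longlongrightarrow> (0::real)) (at_right 0)"
      unfolding at_top_to_right filterlim_filtermap .
    then have "((\<lambda>y. (flat p y - flat p 0) / (y - 0)) \<longlongrightarrow> 0) (at_right 0)"
      by (rule Lim_transform_eventually)
        (auto simp: flat_def divide_inverse eventually_at_right_field intro: exI[of _ 1])
    moreover have "((\<lambda>y. (flat p y - flat p 0) / (y - 0)) \<longlongrightarrow> 0) (at_left 0)"
      by (rule tendsto_eventually) (auto simp: flat_def eventually_at_left_field intro: exI[of _ "-1"])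
    ultimately have "((\<lambda>y. (flat p y - flat p 0) / (y - 0)) \<longlongrightarrow> 0) (at 0)"
      by (simp add: filterlim_at_split)
    then show ?thesis using 2 by (simp add: has_field_derivative_iff flat_def)
  next
    case 3
    have "((\<lambda>t. poly p (1 / t) * exp (- (1 / t))) has_real_derivative
        poly ([:0, 0, 1:] * (p - pderiv p)) (1 / t) * exp (- (1 / t))) (at t)"
      using 3 by (auto intro!: derivative_eq_intros DERIV_chain2[OF poly_DERIV] simp: field_simps power2_eq_square)
    then have "(flat p has_real_derivative poly ([:0, 0, 1:] * (p - pderiv p)) (1 / t) * exp (- (1 / t))) (at t)"
      by (rule DERIV_cong_ev[THEN iffD1, rotated -1])
        (use 3 in \<open>auto simp: flat_def intro: eventually_mono[OF eventually_nhds_in_open[of "{0<..}"]]\<close>)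
    then show ?thesis using 3 by (simp add: flat_def)
  qed
qed

text \<open>Smoothness quantifies over all iterated derivatives, so closure under products or
  inverses has no direct induction. This class contains the smooth functions and is closed under
  directional derivatives; hence it consists of smooth functions, and its closure rules become
  theorems on smoothness.\<close>

inductive_set smooth_alg :: "('a::euclidean_space \<Rightarrow> real) set" where
  const: "(\<lambda>_. c) \<in> smooth_alg"
| flat: "(\<lambda>x. flat p (x \<bullet> v + c)) \<in> smooth_alg"
| smooth: "smooth_fun f \<Longrightarrow> f \<in> smooth_alg"
| add: "f \<in> smooth_alg \<Longrightarrow> g \<in> smooth_alg \<Longrightarrow> (\<lambda>x. f x + g x) \<in> smooth_alg"
| mult: "f \<in> smooth_alg \<Longrightarrow> g \<in> smooth_alg \<Longrightarrow> (\<lambda>x. f x * g x) \<in> smooth_alg"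
| inverse: "f \<in> smooth_alg \<Longrightarrow> \<forall>x. f x \<noteq> 0 \<Longrightarrow> (\<lambda>x. inverse (f x)) \<in> smooth_alg"

lemma iter_dderiv_append: "iter_dderiv (vs @ [v]) f = iter_dderiv vs (\<lambda>x. frechet_derivative f (at x) v)"
  by (induction vs) auto

lemma smooth_fun_dderiv: "smooth_fun f \<Longrightarrow> smooth_fun (\<lambda>x. frechet_derivative f (at x) v)"
  unfolding smooth_fun_def by (metis iter_dderiv_append)

lemma smooth_fun_differentiable: "smooth_fun f \<Longrightarrow> f differentiable (at x)"
  unfolding smooth_fun_def by (metis iter_dderiv.simps(1))

lemma smooth_fun_has_derivative: "smooth_fun f \<Longrightarrow> (f has_derivative frechet_derivative f (at x)) (at x)"
  using smooth_fun_differentiable frechet_derivative_works by blast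

lemma smooth_alg_deriv:
  "f \<in> smooth_alg \<Longrightarrow> \<exists>D. (\<forall>x. (f has_derivative (\<lambda>v. D v x)) (at x)) \<and> (\<forall>v. D v \<in> smooth_alg)"
proof (induction rule: smooth_alg.induct)
  case (const c)
  then show ?case by (intro exI[of _ "\<lambda>_ _. 0"]) (auto intro: smooth_alg.const)
next
  case (flat p v c)
  let ?p = "[:0, 0, 1:] * (p - pderiv p)"
  have "((\<lambda>x. flat p (x \<bullet> v + c)) has_derivative (\<lambda>w. (w \<bullet> v) * flat ?p (x \<bullet> v + c))) (at x)" for x
    by (rule has_derivative_compose[OF _ flat_has_derivative[THEN has_field_derivative_imp_has_derivative], THEN has_derivative_eq_rhs])
      (auto intro!: derivative_eq_intros simp: mult.commute)
  then show ?case
    by (intro exI[of _ "\<lambda>w x. (w \<bullet> v) * flat ?p (x \<bullet> v + c)"])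
      (auto intro!: smooth_alg.mult smooth_alg.const smooth_alg.flat)
next
  case (smooth f)
  then show ?case
    by (intro exI[of _ "\<lambda>v x. frechet_derivative f (at x) v"])
      (auto intro: smooth_fun_has_derivative smooth_alg.smooth smooth_fun_dderiv)
next
  case (add f g)
  then obtain D E where "\<forall>x. (f has_derivative (\<lambda>v. D v x)) (at x)" "\<forall>v. D v \<in> smooth_alg"
    "\<forall>x. (g has_derivative (\<lambda>v. E v x)) (at x)" "\<forall>v. E v \<in> smooth_alg" by blast
  then show ?case
    by (intro exI[of _ "\<lambda>v x. D v x + E v x"]) (auto intro: has_derivative_add smooth_alg.add)
next
  case (mult f g)
  then obtain D E where "\<forall>x. (f has_derivative (\<lambda>v. D v x)) (at x)" "\<forall>v. D v \<in> smooth_alg"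
    "\<forall>x. (g has_derivative (\<lambda>v. E v x)) (at x)" "\<forall>v. E v \<in> smooth_alg" by blast
  then show ?case using mult.hyps
    by (intro exI[of _ "\<lambda>v x. f x * E v x + D v x * g x"] conjI allI has_derivative_mult
        smooth_alg.add smooth_alg.mult) auto
next
  case (inverse f)
  then obtain D where D: "\<forall>x. (f has_derivative (\<lambda>v. D v x)) (at x)" "\<forall>v. D v \<in> smooth_alg" by blast
  have h1: "((\<lambda>x. inverse (f x)) has_derivative (\<lambda>v. (- 1) * (inverse (f x) * D v x * inverse (f x)))) (at x)" for x
    by (rule has_derivative_eq_rhs[OF Deriv.has_derivative_inverse]) (use D inverse.hyps in auto)
  have h2: "(\<lambda>x. (- 1) * (inverse (f x) * D v x * inverse (f x))) \<in> smooth_alg" for v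
    using D inverse.hyps by (intro smooth_alg.mult smooth_alg.const smooth_alg.inverse) auto
  show ?case
    by (intro exI[of _ "\<lambda>v x. (- 1) * (inverse (f x) * D v x * inverse (f x))"] conjI allI h1 h2)
qed

lemma smooth_alg_dderiv:
  assumes "f \<in> smooth_alg"
  shows "(\<lambda>x. frechet_derivative f (at x) v) \<in> smooth_alg" "f differentiable (at x)"
proof -
  obtain D where D: "\<forall>x. (f has_derivative (\<lambda>v. D v x)) (at x)" "\<forall>v. D v \<in> smooth_alg"
    using smooth_alg_deriv[OF assms] by blast
  then have "frechet_derivative f (at x) = (\<lambda>v. D v x)" for x
    using frechet_derivative_at by metis
  then show "(\<lambda>x. frechet_derivative f (at x) v) \<in> smooth_alg" using D by simp
  show "f differentiable (at x)" using D by (auto simp: differentiable_def)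
qed

lemma smooth_alg_iff: "f \<in> smooth_alg \<longleftrightarrow> smooth_fun f"
proof
  assume f: "f \<in> smooth_alg"
  have "iter_dderiv vs f \<in> smooth_alg" for vs
    by (induction vs) (use f in \<open>auto intro: smooth_alg_dderiv\<close>)
  then show "smooth_fun f" by (auto simp: smooth_fun_def intro: smooth_alg_dderiv)
qed (rule smooth_alg.smooth)

lemmas smooth_fun_const = smooth_alg.const[unfolded smooth_alg_iff]
  and smooth_fun_flat = smooth_alg.flat[unfolded smooth_alg_iff]
  and smooth_fun_add = smooth_alg.add[unfolded smooth_alg_iff]
  and smooth_fun_mult = smooth_alg.mult[unfolded smooth_alg_iff]
  and smooth_fun_inverse = smooth_alg.inverse[unfolded smooth_alg_iff]

lemma smooth_fun_diff: "smooth_fun f \<Longrightarrow> smooth_fun g \<Longrightarrow> smooth_fun (\<lambda>x. f x - g x)"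
  using smooth_fun_add[OF _ smooth_fun_mult[OF smooth_fun_const[of "-1"]], of f g] by simp

lemma smooth_fun_prod: "(\<And>i. i \<in> I \<Longrightarrow> smooth_fun (f i)) \<Longrightarrow> smooth_fun (\<lambda>x. \<Prod>i\<in>I. f i x)"
  by (induction I rule: infinite_finite_induct) (auto intro: smooth_fun_const smooth_fun_mult)

lemma smooth_fun_continuous: "smooth_fun f \<Longrightarrow> continuous_on S f"
  by (meson smooth_fun_differentiable differentiable_imp_continuous_within continuous_at_imp_continuous_on)

lemma smooth_fun_dderiv_continuous: "smooth_fun f \<Longrightarrow> continuous_on S (\<lambda>x. frechet_derivative f (at x) v)"
  by (intro smooth_fun_continuous smooth_fun_dderiv)

section \<open>Smooth cut-off functions\<close>

definition step :: "real \<Rightarrow> real" where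
  "step t = flat 1 t * inverse (flat 1 t + flat 1 (1 - t))"

lemma flat_1: "0 \<le> flat 1 t" "t \<le> 0 \<Longrightarrow> flat 1 t = 0" "0 < t \<Longrightarrow> 0 < flat 1 t"
  by (auto simp: flat_def)

lemma step_simps: "t \<le> 0 \<Longrightarrow> step t = 0" "1 \<le> t \<Longrightarrow> step t = 1"
proof -
  show "t \<le> 0 \<Longrightarrow> step t = 0" by (simp add: step_def flat_1)
  assume "1 \<le> t"
  then show "step t = 1" using flat_1(3)[of t] flat_1(2)[of "1 - t"] by (simp add: step_def)
qed

lemma smooth_fun_step: "smooth_fun (\<lambda>x. step (x \<bullet> v + c))"
proof -
  \<comment> \<open>An argument and its difference from 1 are never both nonpositive, so the
    denominator has no zero.\<close>
  have pos: "flat 1 (x \<bullet> v + c) + flat 1 (1 - (x \<bullet> v + c)) \<noteq> 0" for x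
    using flat_1(1,3)[of "x \<bullet> v + c"] flat_1(1,3)[of "1 - (x \<bullet> v + c)"]
    by (cases "0 < x \<bullet> v + c") (auto simp: add_nonneg_eq_0_iff)
  have "smooth_fun (\<lambda>x. flat 1 (1 - (x \<bullet> v + c)))"
    using smooth_fun_flat[of 1 "- v" "1 - c"] by (simp add: algebra_simps)
  then show ?thesis unfolding step_def
    by (intro smooth_fun_mult smooth_fun_inverse smooth_fun_add smooth_fun_flat) (use pos in auto)
qed

text \<open>Coordinates are treated separately, so balls are replaced by cubes. Each factor is 1
  where the coordinate differs from that of \<open>z\<close> by at most \<open>r\<close>, and 0 from
  \<open>2 * r\<close> on.\<close>

definition plateau :: "'a::euclidean_space \<Rightarrow> real \<Rightarrow> 'a \<Rightarrow> real" where
  "plateau z r x = (\<Prod>b\<in>Basis. step ((x - z) \<bullet> b / r + 2) * step (2 - (x - z) \<bullet> b / r))"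

lemma smooth_fun_plateau: "smooth_fun (plateau z r)"
proof -
  have "smooth_fun (\<lambda>x. step ((x - z) \<bullet> b / r + 2))" for b :: 'a
    using smooth_fun_step[of "b /\<^sub>R r" "2 - z \<bullet> b / r"] by (simp add: algebra_simps divide_inverse)
  moreover have "smooth_fun (\<lambda>x. step (2 - (x - z) \<bullet> b / r))" for b :: 'a
    using smooth_fun_step[of "- (b /\<^sub>R r)" "2 + z \<bullet> b / r"] by (simp add: algebra_simps divide_inverse)
  ultimately show ?thesis unfolding plateau_def by (intro smooth_fun_prod smooth_fun_mult) auto
qed

lemma plateau_eq_1: "0 < r \<Longrightarrow> x \<in> cbox (z - r *\<^sub>R One) (z + r *\<^sub>R One) \<Longrightarrow> plateau z r x = 1"
  unfolding plateau_def by (intro prod.neutral) (auto simp: mem_box step_simps field_simps inner_simps)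

lemma plateau_eq_0:
  assumes "0 < r" "x \<notin> cbox (z - (2 * r) *\<^sub>R One) (z + (2 * r) *\<^sub>R One)"
  shows "plateau z r x = 0"
proof -
  obtain b where b: "b \<in> Basis" "(x - z) \<bullet> b < - 2 * r \<or> 2 * r < (x - z) \<bullet> b"
    using assms(2) by (force simp: mem_box inner_simps)
  then have "step ((x - z) \<bullet> b / r + 2) * step (2 - (x - z) \<bullet> b / r) = 0"
    using assms(1) by (auto simp: step_simps field_simps)
  then show ?thesis unfolding plateau_def using b by (intro prod_zero) auto
qed

lemma test_functionsI:
  assumes "smooth_fun f" "compact S" "S \<subseteq> U" "\<And>x. x \<notin> S \<Longrightarrow> f x = 0"
  shows "f \<in> test_functions U"
proof -
  have "fsupport f \<subseteq> S" unfolding fsupport_def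
    using assms compact_imp_closed by (intro closure_minimal) auto
  moreover have "closed (fsupport f)" by (simp add: fsupport_def)
  ultimately show ?thesis using assms compact_Int_closed[of S "fsupport f"]
    by (auto simp: test_functions_def inf.absorb2)
qed

text \<open>For finitely many plateaus whose inner cubes cover \<open>K\<close>, the function
  \<open>1 - (\<Prod>z\<in>F. 1 - plateau z (r z) x)\<close> is 1 where any of them is 1 and 0 where
  all of them are 0. The lemma also validates the choice of \<eta> in
  \<open>capacity\<close>.\<close>

lemma cutoff_exists:
  fixes K \<Omega> :: "'a::euclidean_space set"
  assumes "compact K" "K \<subseteq> \<Omega>" "open \<Omega>"
  shows "\<exists>\<eta>. \<eta> \<in> test_functions \<Omega> \<and> (\<exists>W. open W \<and> K \<subseteq> W \<and> (\<forall>x\<in>W. \<eta> x = 1))"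
proof -
  have "\<exists>r>0. cbox (z - (2 * r) *\<^sub>R One) (z + (2 * r) *\<^sub>R One) \<subseteq> \<Omega>" if "z \<in> K" for z
  proof -
    have "z \<in> \<Omega>" using assms that by blast
    then obtain d where d: "d > 0" "ball z d \<subseteq> \<Omega>" using openE[OF assms(3)] by metis
    \<comment> \<open>The norm is at most the sum of \<open>DIM('a)\<close> coordinates of size
      \<open>2 * r\<close>, so the doubled cube stays within distance \<open>d / 2\<close> of
      \<open>z\<close>.\<close>
    define r where "r = d / (4 * DIM('a))"
    have r: "r > 0" using d by (simp add: r_def)
    have "x \<in> ball z d" if x: "x \<in> cbox (z - (2 * r) *\<^sub>R One) (z + (2 * r) *\<^sub>R One)" for x
    proof -
      have "norm (x - z) \<le> (\<Sum>b\<in>Basis. \<bar>(x - z) \<bullet> b\<bar>)" by (rule norm_le_l1)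
      also have "\<dots> \<le> (\<Sum>b\<in>(Basis::'a set). 2 * r)"
        using x by (intro sum_mono) (auto simp: mem_box inner_simps abs_le_iff algebra_simps)
      also have "\<dots> = d / 2" by (simp add: r_def)
      finally show ?thesis using d by (simp add: dist_norm norm_minus_commute)
    qed
    then show ?thesis using d r by blast
  qed
  then obtain r where r: "\<And>z. z \<in> K \<Longrightarrow> r z > 0"
    "\<And>z. z \<in> K \<Longrightarrow> cbox (z - (2 * r z) *\<^sub>R One) (z + (2 * r z) *\<^sub>R One) \<subseteq> \<Omega>" by metis
  define Q where "Q z = box (z - r z *\<^sub>R One) (z + r z *\<^sub>R One)" for z
  have "K \<subseteq> (\<Union>z\<in>K. Q z)" using r by (force simp: Q_def mem_box inner_simps)
  then obtain F where F: "F \<subseteq> K" "finite F" "K \<subseteq> (\<Union>z\<in>F. Q z)"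
    using compactE_image[OF assms(1), of K Q] by (metis Q_def open_box)
  define \<eta> where "\<eta> x = 1 - (\<Prod>z\<in>F. 1 - plateau z (r z) x)" for x
  have "smooth_fun \<eta>" unfolding \<eta>_def[abs_def]
    by (intro smooth_fun_diff smooth_fun_const smooth_fun_prod smooth_fun_plateau)
  moreover have "compact (\<Union>z\<in>F. cbox (z - (2 * r z) *\<^sub>R One) (z + (2 * r z) *\<^sub>R One))"
    using F by (intro compact_UN) auto
  moreover have "\<eta> x = 0" if "x \<notin> (\<Union>z\<in>F. cbox (z - (2 * r z) *\<^sub>R One) (z + (2 * r z) *\<^sub>R One))" for x
  proof -
    have "plateau z (r z) x = 0" if "z \<in> F" for z
      using \<open>x \<notin> _\<close> that F r(1) by (intro plateau_eq_0) auto
    then show ?thesis by (simp add: \<eta>_def)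
  qed
  ultimately have "\<eta> \<in> test_functions \<Omega>" using r(2) F by (intro test_functionsI) auto
  moreover have "\<eta> x = 1" if "x \<in> (\<Union>z\<in>F. Q z)" for x
  proof -
    from that obtain z where z: "z \<in> F" "x \<in> Q z" by blast
    then have "plateau z (r z) x = 1"
      using F r by (intro plateau_eq_1) (auto simp: Q_def dest: subsetD[OF box_subset_cbox])
    then show ?thesis unfolding \<eta>_def using z F by (auto intro!: prod_zero bexI[of _ z])
  qed
  moreover have "open (\<Union>z\<in>F. Q z)" by (auto simp: Q_def)
  ultimately show ?thesis using F by blast
qed

subsection \<open>Square integrable functions\<close>

definition sq_int :: "('a::euclidean_space \<Rightarrow> 'b::euclidean_space) \<Rightarrow> bool" where
  "sq_int f \<longleftrightarrow> f \<in> borel_measurable lebesgue \<and> integrable lebesgue (\<lambda>x. (norm (f x))\<^sup>2)"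

lemma L2fun_iff: "L2fun u \<longleftrightarrow> sq_int u" and L2vec_iff: "L2vec g \<longleftrightarrow> sq_int g"
  by (simp_all add: L2fun_def L2vec_def sq_int_def)

lemma sq_int_measurable [measurable_dest]: "sq_int f \<Longrightarrow> f \<in> borel_measurable lebesgue"
  by (simp add: sq_int_def)

lemma sq_int_dominated:
  assumes "sq_int f" "sq_int g" "h \<in> borel_measurable lebesgue"
    "\<And>x. norm (h x) \<le> C * (norm (f x) + norm (g x))" "0 \<le> C"
  shows "sq_int h"
  unfolding sq_int_def
proof
  show "integrable lebesgue (\<lambda>x. (norm (h x))\<^sup>2)"
  proof (rule Bochner_Integration.integrable_bound)
    show "integrable lebesgue (\<lambda>x. 2 * C\<^sup>2 * ((norm (f x))\<^sup>2 + (norm (g x))\<^sup>2))"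
      using assms by (auto simp: sq_int_def)
    show "(\<lambda>x. (norm (h x))\<^sup>2) \<in> borel_measurable lebesgue" using assms(3) by measurable
    have "(norm (h x))\<^sup>2 \<le> 2 * C\<^sup>2 * ((norm (f x))\<^sup>2 + (norm (g x))\<^sup>2)" for x
    proof -
      have "(norm (h x))\<^sup>2 \<le> (C * (norm (f x) + norm (g x)))\<^sup>2" using assms(4) by (intro power_mono) auto
      also have "\<dots> = C\<^sup>2 * (norm (f x) + norm (g x))\<^sup>2" by (simp add: power_mult_distrib)
      also have "\<dots> \<le> C\<^sup>2 * (2 * ((norm (f x))\<^sup>2 + (norm (g x))\<^sup>2))"
        using sum_squares_bound[of "norm (f x)" "norm (g x)"]
        by (intro mult_left_mono) (simp_all add: power2_sum)
      finally show ?thesis by (simp add: algebra_simps)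
    qed
    then show "AE x in lebesgue. norm ((norm (h x))\<^sup>2) \<le> norm (2 * C\<^sup>2 * ((norm (f x))\<^sup>2 + (norm (g x))\<^sup>2))"
      by (intro AE_I2) (auto intro: order_trans)
  qed
qed (rule assms)

lemma sq_int_add: "sq_int f \<Longrightarrow> sq_int g \<Longrightarrow> sq_int (\<lambda>x. f x + g x)"
  by (rule sq_int_dominated[where f = f and g = g and C = 1]) (auto simp: sq_int_def norm_triangle_ineq)

lemma sq_int_diff: "sq_int f \<Longrightarrow> sq_int g \<Longrightarrow> sq_int (\<lambda>x. f x - g x)"
  by (rule sq_int_dominated[where f = f and g = g and C = 1]) (auto simp: sq_int_def norm_triangle_ineq4)

lemma sq_int_scale: "sq_int f \<Longrightarrow> sq_int (\<lambda>x. c *\<^sub>R f x)"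
  by (rule sq_int_dominated[where f = f and g = f and C = "\<bar>c\<bar>"]) (auto simp: sq_int_def)

lemma sq_int_zero: "sq_int (\<lambda>_. 0)"
  by (simp add: sq_int_def)

lemma sq_int_inner_integrable:
  assumes "sq_int f" "sq_int g"
  shows "integrable lebesgue (\<lambda>x. f x \<bullet> g x)"
proof (rule Bochner_Integration.integrable_bound)
  show "integrable lebesgue (\<lambda>x. (norm (f x))\<^sup>2 + (norm (g x))\<^sup>2)" using assms by (auto simp: sq_int_def)
  show "(\<lambda>x. f x \<bullet> g x) \<in> borel_measurable lebesgue" using assms by measurable
  have "\<bar>f x \<bullet> g x\<bar> \<le> (norm (f x))\<^sup>2 + (norm (g x))\<^sup>2" for x
  proof -
    have "\<bar>f x \<bullet> g x\<bar> \<le> norm (f x) * norm (g x)" by (rule Cauchy_Schwarz_ineq2)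
    also have "\<dots> \<le> (norm (f x))\<^sup>2 + (norm (g x))\<^sup>2"
      using sum_squares_bound[of "norm (f x)" "norm (g x)"]
        mult_nonneg_nonneg[OF norm_ge_zero[of "f x"] norm_ge_zero[of "g x"]] by linarith
    finally show ?thesis .
  qed
  then show "AE x in lebesgue. norm (f x \<bullet> g x) \<le> norm ((norm (f x))\<^sup>2 + (norm (g x))\<^sup>2)"
    by (intro AE_I2) (auto intro: order_trans)
qed

lemma sq_int_mult_integrable:
  fixes f g :: "'a::euclidean_space \<Rightarrow> real"
  shows "sq_int f \<Longrightarrow> sq_int g \<Longrightarrow> integrable lebesgue (\<lambda>x. f x * g x)"
  using sq_int_inner_integrable[of f g] by simp

text \<open>Riesz-Fischer: a rapidly Cauchy subsequence converges almost everywhere, and Fatou's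
  lemma carries the Cauchy bounds of the whole sequence over to the limit.\<close>

lemma sq_int_complete:
  fixes X :: "nat \<Rightarrow> 'a::euclidean_space \<Rightarrow> 'b::euclidean_space"
  assumes X: "\<And>n. sq_int (X n)"
    and cauchy: "\<forall>\<epsilon>>0. \<exists>N. \<forall>m\<ge>N. \<forall>n\<ge>N. (\<integral>x. (norm (X m x - X n x))\<^sup>2 \<partial>lebesgue) < \<epsilon>"
  shows "\<exists>l. sq_int l \<and> (\<lambda>n. \<integral>x. (norm (X n x - l x))\<^sup>2 \<partial>lebesgue) \<longlonglongrightarrow> 0"
proof -
  have [measurable]: "X n \<in> borel_measurable lebesgue" for n using X by measurable
  have int: "integrable lebesgue (\<lambda>x. (norm (X m x - X n x))\<^sup>2)" for m n
    using sq_int_diff[OF X X] by (simp add: sq_int_def)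
  \<comment> \<open>The rate \<open>(1/8) ^ k\<close> beats the weight \<open>4 ^ k\<close> used
    below and leaves a geometric series. The weight in turn forces pointwise increments of order
    \<open>(1/2) ^ k\<close>.\<close>
  have "\<forall>k. \<exists>N. \<forall>m\<ge>N. \<forall>n\<ge>N. (\<integral>x. (norm (X m x - X n x))\<^sup>2 \<partial>lebesgue) < (1/8) ^ k"
    using cauchy by simp
  then obtain R where R: "\<And>k m n. m \<ge> R k \<Longrightarrow> n \<ge> R k \<Longrightarrow> (\<integral>x. (norm (X m x - X n x))\<^sup>2 \<partial>lebesgue) < (1/8) ^ k"
    by metis
  \<comment> \<open>Partial sums make the indices monotone; the summand \<open>k\<close> makes them
    unbounded.\<close>
  define r where "r k = (\<Sum>j\<le>k. R j) + k" for k
  have rR: "R k \<le> r k" for k unfolding r_def by (intro trans_le_add1 member_le_sum) auto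
  have rS: "r k \<le> r (Suc k)" for k by (simp add: r_def)
  have rk: "k \<le> r k" for k by (simp add: r_def)
  define d where "d k x = norm (X (r (Suc k)) x - X (r k) x)" for k x
  have [measurable]: "d k \<in> borel_measurable lebesgue" for k unfolding d_def by measurable
  have "(\<integral>\<^sup>+x. (\<Sum>k. ennreal (4 ^ k * (d k x)\<^sup>2)) \<partial>lebesgue) = (\<Sum>k. \<integral>\<^sup>+x. ennreal (4 ^ k * (d k x)\<^sup>2) \<partial>lebesgue)"
    by (rule nn_integral_suminf) measurable
  also have "\<dots> \<le> (\<Sum>k. ennreal ((1/2) ^ k))"
  proof (rule suminf_le)
    fix k
    have "(\<integral>\<^sup>+x. ennreal (4 ^ k * (d k x)\<^sup>2) \<partial>lebesgue) = ennreal (\<integral>x. 4 ^ k * (d k x)\<^sup>2 \<partial>lebesgue)"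
      by (rule nn_integral_eq_integral) (use int in \<open>auto simp: d_def\<close>)
    also have "(\<integral>x. 4 ^ k * (d k x)\<^sup>2 \<partial>lebesgue) = 4 ^ k * (\<integral>x. (d k x)\<^sup>2 \<partial>lebesgue)" by simp
    also have "\<dots> \<le> 4 ^ k * (1/8) ^ k"
      unfolding d_def using rR[of k] rS[of k] by (intro mult_left_mono less_imp_le[OF R]) auto
    also have "4 ^ k * (1/8) ^ k = (1/2::real) ^ k" by (simp add: power_mult_distrib[symmetric])
    finally show "(\<integral>\<^sup>+x. ennreal (4 ^ k * (d k x)\<^sup>2) \<partial>lebesgue) \<le> ennreal ((1/2) ^ k)"
      by (simp add: ennreal_leI)
  qed auto
  also have "\<dots> = ennreal (\<Sum>k. (1/2) ^ k)" by (rule suminf_ennreal2) (auto intro: summable_geometric)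
  finally have "(\<integral>\<^sup>+x. (\<Sum>k. ennreal (4 ^ k * (d k x)\<^sup>2)) \<partial>lebesgue) < \<infinity>"
    by (rule le_less_trans) simp
  then have "(\<integral>\<^sup>+x. (\<Sum>k. ennreal (4 ^ k * (d k x)\<^sup>2)) \<partial>lebesgue) \<noteq> \<infinity>" by simp
  then have "AE x in lebesgue. (\<Sum>k. ennreal (4 ^ k * (d k x)\<^sup>2)) \<noteq> \<infinity>"
    by (intro nn_integral_noteq_infinite) measurable
  then have conv: "AE x in lebesgue. convergent (\<lambda>k. X (r k) x)"
  proof eventually_elim
    case (elim x)
    define T where "T = (\<Sum>k. ennreal (4 ^ k * (d k x)\<^sup>2))"
    have "T \<noteq> \<infinity>" using elim unfolding T_def .
    then obtain C where "T = ennreal C" "0 \<le> C" by (cases T rule: ennreal_cases) auto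
    then have C: "(\<Sum>k. ennreal (4 ^ k * (d k x)\<^sup>2)) = ennreal C" "0 \<le> C" by (simp_all only: T_def)
    have "d k x \<le> sqrt C * (1/2) ^ k" for k
    proof -
      have "ennreal (4 ^ k * (d k x)\<^sup>2) = (\<Sum>j\<in>{k}. ennreal (4 ^ j * (d j x)\<^sup>2))" by simp
      also have "\<dots> \<le> (\<Sum>k. ennreal (4 ^ k * (d k x)\<^sup>2))"
        by (rule sum_le_suminf) auto
      finally have "4 ^ k * (d k x)\<^sup>2 \<le> C" using C by (simp add: ennreal_le_iff)
      then have "sqrt (4 ^ k * (d k x)\<^sup>2) \<le> sqrt C" by (rule real_sqrt_le_mono)
      moreover have "sqrt (4 ^ k * (d k x)\<^sup>2) = 2 ^ k * d k x"
      proof -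
        have "(4::real) ^ k = (2 ^ k)\<^sup>2" by (simp add: power_mult[symmetric] mult.commute[of k] power_mult)
        then show ?thesis by (simp add: real_sqrt_mult d_def)
      qed
      ultimately show ?thesis by (simp add: field_simps power_one_over)
    qed
    moreover have "summable (\<lambda>k. sqrt C * (1/2::real) ^ k)" by (intro summable_mult summable_geometric) auto
    ultimately have "summable (\<lambda>k. X (r (Suc k)) x - X (r k) x)"
      by (intro summable_comparison_test[OF _ \<open>summable _\<close>]) (auto simp: d_def)
    then have "convergent (\<lambda>k. (\<Sum>j<k. X (r (Suc j)) x - X (r j) x) + X (r 0) x)"
      by (intro convergent_add) (auto simp: summable_iff_convergent convergent_const)
    then show ?case by (simp add: sum_lessThan_telescope[of "\<lambda>j. X (r j) x"])
  qed
  define l where "l x = lim (\<lambda>k. X (r k) x)" for x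
  have lm [measurable]: "l \<in> borel_measurable lebesgue" unfolding l_def by measurable
  have lim: "AE x in lebesgue. (\<lambda>k. X (r k) x) \<longlonglongrightarrow> l x"
    using conv by eventually_elim (simp add: l_def convergent_LIMSEQ_iff)
  have fatou: "(\<integral>\<^sup>+x. ennreal ((norm (X n x - l x))\<^sup>2) \<partial>lebesgue) \<le> ennreal \<epsilon>"
    if \<epsilon>: "\<And>m. m \<ge> N \<Longrightarrow> (\<integral>x. (norm (X n x - X m x))\<^sup>2 \<partial>lebesgue) \<le> \<epsilon>" for n N \<epsilon>
  proof -
    have "(\<integral>\<^sup>+x. ennreal ((norm (X n x - l x))\<^sup>2) \<partial>lebesgue)
      = (\<integral>\<^sup>+x. liminf (\<lambda>k. ennreal ((norm (X n x - X (r k) x))\<^sup>2)) \<partial>lebesgue)"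
    proof (rule nn_integral_cong_AE)
      show "AE x in lebesgue. ennreal ((norm (X n x - l x))\<^sup>2)
          = liminf (\<lambda>k. ennreal ((norm (X n x - X (r k) x))\<^sup>2))"
        using lim
      proof eventually_elim
        case (elim x)
        then have "(\<lambda>k. ennreal ((norm (X n x - X (r k) x))\<^sup>2)) \<longlonglongrightarrow> ennreal ((norm (X n x - l x))\<^sup>2)"
          by (intro tendsto_ennrealI tendsto_intros)
        then show ?case by (rule lim_imp_Liminf[symmetric, OF trivial_limit_sequentially])
      qed
    qed
    also have "\<dots> \<le> liminf (\<lambda>k. \<integral>\<^sup>+x. ennreal ((norm (X n x - X (r k) x))\<^sup>2) \<partial>lebesgue)"
      by (rule nn_integral_liminf) measurable
    also have "\<dots> \<le> liminf (\<lambda>k. ennreal \<epsilon>)"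
    proof (rule Liminf_mono)
      have "(\<integral>\<^sup>+x. ennreal ((norm (X n x - X (r k) x))\<^sup>2) \<partial>lebesgue) \<le> ennreal \<epsilon>" if "k \<ge> N" for k
        using \<epsilon>[of "r k"] rk[of k] that int
        by (subst nn_integral_eq_integral) (auto intro!: ennreal_leI)
      then show "\<forall>\<^sub>F k in sequentially. (\<integral>\<^sup>+x. ennreal ((norm (X n x - X (r k) x))\<^sup>2) \<partial>lebesgue) \<le> ennreal \<epsilon>"
        by (auto simp: eventually_sequentially)
    qed
    also have "\<dots> = ennreal \<epsilon>" by (simp add: Liminf_const)
    finally show ?thesis .
  qed
  have sq: "sq_int (\<lambda>x. X n x - l x)" if "\<And>m. m \<ge> N \<Longrightarrow> (\<integral>x. (norm (X n x - X m x))\<^sup>2 \<partial>lebesgue) \<le> \<epsilon>" for n N \<epsilon>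
    unfolding sq_int_def
  proof
    show "integrable lebesgue (\<lambda>x. (norm (X n x - l x))\<^sup>2)"
    proof (rule integrableI_bounded)
      have "(\<integral>\<^sup>+x. ennreal (norm ((norm (X n x - l x))\<^sup>2)) \<partial>lebesgue) \<le> ennreal \<epsilon>"
        using fatou[OF that] by simp
      then show "(\<integral>\<^sup>+x. ennreal (norm ((norm (X n x - l x))\<^sup>2)) \<partial>lebesgue) < \<infinity>"
        by (rule order.strict_trans1) simp
    qed measurable
  qed measurable
  obtain N1 where N1: "\<And>m. m \<ge> N1 \<Longrightarrow> (\<integral>x. (norm (X N1 x - X m x))\<^sup>2 \<partial>lebesgue) \<le> 1"
    using cauchy[rule_format, of 1] by (auto intro: less_imp_le)
  have "sq_int (\<lambda>x. X N1 x - (X N1 x - l x))" by (rule sq_int_diff[OF X sq[OF N1]])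
  then have "sq_int l" by simp
  moreover have "(\<lambda>n. \<integral>x. (norm (X n x - l x))\<^sup>2 \<partial>lebesgue) \<longlonglongrightarrow> 0"
  proof (rule LIMSEQ_I)
    fix \<epsilon> :: real assume \<epsilon>: "0 < \<epsilon>"
    from cauchy[rule_format, of "\<epsilon>/2"] \<epsilon> obtain N where
      N: "\<And>m n. m \<ge> N \<Longrightarrow> n \<ge> N \<Longrightarrow> (\<integral>x. (norm (X m x - X n x))\<^sup>2 \<partial>lebesgue) < \<epsilon>/2" by auto
    have "(\<integral>x. (norm (X n x - l x))\<^sup>2 \<partial>lebesgue) \<le> \<epsilon>/2" if "n \<ge> N" for n
    proof -
      have le: "\<And>m. m \<ge> N \<Longrightarrow> (\<integral>x. (norm (X n x - X m x))\<^sup>2 \<partial>lebesgue) \<le> \<epsilon>/2"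
        using N[OF that] by (auto intro: less_imp_le)
      show ?thesis
      proof (rule integral_real_bounded)
        show "(\<integral>\<^sup>+x. ennreal ((norm (X n x - l x))\<^sup>2) \<partial>lebesgue) \<le> ennreal (\<epsilon>/2)"
          by (rule fatou[OF le])
      qed (use \<epsilon> in auto)
    qed
    then show "\<exists>N. \<forall>n\<ge>N. norm ((\<integral>x. (norm (X n x - l x))\<^sup>2 \<partial>lebesgue) - 0) < \<epsilon>"
      using \<epsilon> by (intro exI[of _ N]) force
  qed
  ultimately show ?thesis by blast
qed

subsection \<open>Pairs of a function and a candidate for its gradient\<close>

text \<open>The gradient is carried as data because \<open>wgrad\<close> is a choice and therefore
  linear only almost everywhere. On pairs both forms are bilinear on a genuine vector space, without
  passing to a quotient.\<close>

typedef (overloaded) 'a::euclidean_space pair_space =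
  "{(u :: 'a \<Rightarrow> real, g :: 'a \<Rightarrow> 'a). sq_int u \<and> sq_int g}"
  by (auto intro!: exI[of _ "\<lambda>_. 0"] simp: sq_int_zero)

setup_lifting type_definition_pair_space

lift_definition pfun :: "'a::euclidean_space pair_space \<Rightarrow> 'a \<Rightarrow> real" is fst .
lift_definition pgrad :: "'a::euclidean_space pair_space \<Rightarrow> 'a \<Rightarrow> 'a" is snd .

definition mk_pair :: "('a::euclidean_space \<Rightarrow> real) \<Rightarrow> ('a \<Rightarrow> 'a) \<Rightarrow> 'a pair_space" where
  "mk_pair u g = Abs_pair_space (u, g)"

lemma mk_pair: "sq_int u \<Longrightarrow> sq_int g \<Longrightarrow> pfun (mk_pair u g) = u" "sq_int u \<Longrightarrow> sq_int g \<Longrightarrow> pgrad (mk_pair u g) = g"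
  by (simp_all add: mk_pair_def pfun.rep_eq pgrad.rep_eq Abs_pair_space_inverse)

lemma sq_int_pair: "sq_int (pfun X)" "sq_int (pgrad X)"
  by (transfer, auto)+

lemma pair_eqI: "pfun X = pfun Y \<Longrightarrow> pgrad X = pgrad Y \<Longrightarrow> X = Y"
  by transfer auto

instantiation pair_space :: (euclidean_space) real_vector
begin

definition "0 = mk_pair (\<lambda>_::'a. 0) (\<lambda>_. 0)"
definition "X + Y = mk_pair (\<lambda>x::'a. pfun X x + pfun Y x) (\<lambda>x. pgrad X x + pgrad Y x)"
definition "X - Y = mk_pair (\<lambda>x::'a. pfun X x - pfun Y x) (\<lambda>x. pgrad X x - pgrad Y x)"
definition "- X = mk_pair (\<lambda>x::'a. - pfun X x) (\<lambda>x. - pgrad X x)"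
definition "c *\<^sub>R X = mk_pair (\<lambda>x::'a. c * pfun X x) (\<lambda>x. c *\<^sub>R pgrad X x)"

lemma pair_ops:
  "pfun (0 :: 'a pair_space) = (\<lambda>_. 0)" "pgrad (0 :: 'a pair_space) = (\<lambda>_. 0)"
  "pfun (X + Y :: 'a pair_space) = (\<lambda>x. pfun X x + pfun Y x)"
  "pgrad (X + Y) = (\<lambda>x. pgrad X x + pgrad Y x)"
  "pfun (X - Y) = (\<lambda>x. pfun X x - pfun Y x)"
  "pgrad (X - Y) = (\<lambda>x. pgrad X x - pgrad Y x)"
  "pfun (- X) = (\<lambda>x. - pfun X x)" "pgrad (- X) = (\<lambda>x. - pgrad X x)"
  "pfun (c *\<^sub>R X) = (\<lambda>x. c * pfun X x)" "pgrad (c *\<^sub>R X) = (\<lambda>x. c *\<^sub>R pgrad X x)"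
  using sq_int_pair[of X] sq_int_pair[of Y] sq_int_scale[of "pfun X" c] sq_int_scale[of "pfun X" "-1"] sq_int_scale[of "pgrad X" "-1"]
  by (simp_all add: zero_pair_space_def plus_pair_space_def minus_pair_space_def uminus_pair_space_def
      scaleR_pair_space_def mk_pair sq_int_zero sq_int_add sq_int_diff sq_int_scale)

instance
  by standard (rule pair_eqI; simp add: pair_ops algebra_simps)+

end

definition b_form :: "'a::euclidean_space pair_space \<Rightarrow> 'a pair_space \<Rightarrow> real" where
  "b_form X Y = (\<integral>x. pfun X x * pfun Y x \<partial>lebesgue)"

definition q_form :: "'a::euclidean_space pair_space \<Rightarrow> 'a pair_space \<Rightarrow> real" where
  "q_form X Y = (\<integral>x. pgrad X x \<bullet> pgrad Y x \<partial>lebesgue)"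

global_interpretation form_pair q_form b_form
proof unfold_locales
  have i: "integrable lebesgue (\<lambda>x. pfun X x * pfun Y x)" "integrable lebesgue (\<lambda>x. pgrad X x \<bullet> pgrad Y x)"
    for X Y :: "'a pair_space"
    by (rule sq_int_mult_integrable sq_int_inner_integrable sq_int_pair)+
  show "bilinear (b_form :: 'a pair_space \<Rightarrow> _)" "bilinear (q_form :: 'a pair_space \<Rightarrow> _)"
    unfolding bilinear_def b_form_def q_form_def
    by (intro conjI allI linearI; simp add: pair_ops algebra_simps inner_simps i)+
  show "b_form X Y = b_form Y X" "q_form X Y = q_form Y X" for X Y :: "'a pair_space"
    by (simp_all add: b_form_def q_form_def mult.commute inner_commute)
  show "0 \<le> b_form X X" "0 \<le> q_form X X" for X :: "'a pair_space"
    unfolding b_form_def q_form_def by (auto intro: integral_nonneg_AE)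
qed

subsection \<open>Test functions\<close>

lemma compact_support_integrable:
  fixes f :: "'a::euclidean_space \<Rightarrow> 'b::euclidean_space"
  assumes "continuous_on UNIV f" "compact S" "\<And>x. x \<notin> S \<Longrightarrow> f x = 0"
  shows "f \<in> borel_measurable borel" "integrable lborel f" "integrable lebesgue f"
proof -
  show m: "f \<in> borel_measurable borel" by (rule borel_measurable_continuous_onI) fact
  have "(\<lambda>x. indicator S x *\<^sub>R f x) = f" using assms(3) by (auto simp: indicator_def fun_eq_iff)
  then show i: "integrable lborel f"
    using borel_integrable_compact[OF assms(2), of f] assms(1) continuous_on_subset by fastforce
  show "integrable lebesgue f" using i m by (subst integrable_completion) auto
qed

lemma compact_support_sq_int:
  fixes f :: "'a::euclidean_space \<Rightarrow> 'b::euclidean_space"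
  assumes "continuous_on UNIV f" "compact S" "\<And>x. x \<notin> S \<Longrightarrow> f x = 0"
  shows "sq_int f"
  unfolding sq_int_def
proof
  show "f \<in> borel_measurable lebesgue"
    using compact_support_integrable(1)[OF assms] by (simp add: measurable_completion)
  have "continuous_on UNIV (\<lambda>x. (norm (f x))\<^sup>2)" by (intro continuous_intros assms)
  then show "integrable lebesgue (\<lambda>x. (norm (f x))\<^sup>2)"
    by (rule compact_support_integrable(3)[OF _ assms(2)]) (use assms(3) in auto)
qed

lemma compact_support_bounded:
  fixes f :: "'a::euclidean_space \<Rightarrow> 'b::euclidean_space"
  assumes "continuous_on UNIV f" "compact S" "\<And>x. x \<notin> S \<Longrightarrow> f x = 0"
  obtains C where "0 \<le> C" "\<And>x. norm (f x) \<le> C"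
proof -
  have "bounded (f ` S)"
    by (intro compact_imp_bounded compact_continuous_image assms(2) continuous_on_subset[OF assms(1)]) auto
  then obtain C where C: "\<And>x. x \<in> S \<Longrightarrow> norm (f x) \<le> C" by (auto simp: bounded_iff)
  show ?thesis
  proof (rule that[of "\<bar>C\<bar>"])
    show "norm (f x) \<le> \<bar>C\<bar>" for x using C[of x] assms(3)[of x] by (cases "x \<in> S") auto
  qed simp
qed

lemma test_smooth: "\<phi> \<in> test_functions U \<Longrightarrow> smooth_fun \<phi>"
  and test_compact: "\<phi> \<in> test_functions U \<Longrightarrow> compact (fsupport \<phi>)"
  and test_support: "\<phi> \<in> test_functions U \<Longrightarrow> fsupport \<phi> \<subseteq> U"
  by (auto simp: test_functions_def)

lemma fsupport_zero: "x \<notin> fsupport \<phi> \<Longrightarrow> \<phi> x = 0"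
  using closure_subset[of "{x. \<phi> x \<noteq> 0}"] by (auto simp: fsupport_def)

lemma fsupport_deriv_zero:
  assumes "x \<notin> fsupport \<phi>"
  shows "frechet_derivative \<phi> (at x) v = 0"
proof -
  have "open (- fsupport \<phi>)" "x \<in> - fsupport \<phi>" using assms by (auto simp: fsupport_def)
  then have "(\<phi> has_derivative (\<lambda>_. 0)) (at x)"
    by (rule has_derivative_transform_within_open[OF has_derivative_const]) (auto simp: fsupport_zero)
  then show ?thesis using frechet_derivative_at by metis
qed

lemma grad_fun_inner: "smooth_fun f \<Longrightarrow> grad_fun f x \<bullet> v = frechet_derivative f (at x) v"
proof -
  assume "smooth_fun f"
  then interpret linear "frechet_derivative f (at x)"
    using smooth_fun_has_derivative has_derivative_linear by blast
  have "frechet_derivative f (at x) v = frechet_derivative f (at x) (\<Sum>b\<in>Basis. (v \<bullet> b) *\<^sub>R b)"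
    by (simp add: euclidean_representation)
  then show ?thesis by (simp add: grad_fun_def sum scaleR inner_sum_left inner_sum_right inner_commute mult.commute)
qed

lemma grad_fun_continuous: "smooth_fun f \<Longrightarrow> continuous_on S (grad_fun f)"
  unfolding grad_fun_def[abs_def] by (intro continuous_intros smooth_fun_dderiv_continuous)

lemma grad_fun_zero: "x \<notin> fsupport \<phi> \<Longrightarrow> grad_fun \<phi> x = 0"
  by (simp add: grad_fun_def fsupport_deriv_zero)

lemma smooth_derivs:
  assumes "smooth_fun f" "smooth_fun g"
  shows "frechet_derivative (\<lambda>x. f x + g x) (at x) v = frechet_derivative f (at x) v + frechet_derivative g (at x) v"
    and "frechet_derivative (\<lambda>x. f x * g x) (at x) v
      = f x * frechet_derivative g (at x) v + frechet_derivative f (at x) v * g x"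
    and "frechet_derivative (\<lambda>x. c * f x) (at x) v = c * frechet_derivative f (at x) v"
proof -
  note d = smooth_fun_has_derivative[OF assms(1), of x] smooth_fun_has_derivative[OF assms(2), of x]
  show "frechet_derivative (\<lambda>x. f x + g x) (at x) v = frechet_derivative f (at x) v + frechet_derivative g (at x) v"
    using frechet_derivative_at[OF has_derivative_add[OF d]] by metis
  show "frechet_derivative (\<lambda>x. f x * g x) (at x) v
      = f x * frechet_derivative g (at x) v + frechet_derivative f (at x) v * g x"
    using frechet_derivative_at[OF has_derivative_mult[OF d]] by metis
  show "frechet_derivative (\<lambda>x. c * f x) (at x) v = c * frechet_derivative f (at x) v"
    using frechet_derivative_at[OF has_derivative_mult_right[OF d(1), of c]] by metis
qed

lemma grad_fun_ops:
  assumes "smooth_fun f" "smooth_fun g"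
  shows "grad_fun (\<lambda>x. f x + g x) x = grad_fun f x + grad_fun g x"
    and "grad_fun (\<lambda>x. f x * g x) x = f x *\<^sub>R grad_fun g x + g x *\<^sub>R grad_fun f x"
    and "grad_fun (\<lambda>x. c * f x) x = c *\<^sub>R grad_fun f x"
  by (simp_all add: grad_fun_def smooth_derivs[OF assms] sum.distrib scaleR_add_left scaleR_sum_right mult.commute)

lemma test_mono: "U \<subseteq> V \<Longrightarrow> test_functions U \<subseteq> test_functions V"
  by (auto simp: test_functions_def)

lemma test_ops:
  assumes "\<phi> \<in> test_functions U"
  shows "\<psi> \<in> test_functions U \<Longrightarrow> (\<lambda>x. \<phi> x + \<psi> x) \<in> test_functions U"
    and "(\<lambda>x. c * \<phi> x) \<in> test_functions U"
    and "smooth_fun f \<Longrightarrow> (\<lambda>x. f x * \<phi> x) \<in> test_functions U"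
proof -
  show "(\<lambda>x. \<phi> x + \<psi> x) \<in> test_functions U" if "\<psi> \<in> test_functions U"
    by (rule test_functionsI[where S = "fsupport \<phi> \<union> fsupport \<psi>"])
      (use assms that in \<open>auto intro: smooth_fun_add simp: test_functions_def fsupport_zero\<close>)
  show *: "(\<lambda>x. f x * \<phi> x) \<in> test_functions U" if "smooth_fun f" for f
    by (rule test_functionsI[where S = "fsupport \<phi>"])
      (use assms that in \<open>auto intro: smooth_fun_mult simp: test_functions_def fsupport_zero\<close>)
  show "(\<lambda>x. c * \<phi> x) \<in> test_functions U" by (rule *[OF smooth_fun_const])
qed

lemma zero_test: "(\<lambda>_. 0) \<in> test_functions U"
  by (rule test_functionsI[of _ "{}"]) (auto intro: smooth_fun_const)

lemma test_sq_int:
  assumes "\<phi> \<in> test_functions U"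
  shows "sq_int \<phi>" "sq_int (grad_fun \<phi>)" "sq_int (\<lambda>x. frechet_derivative \<phi> (at x) v)" "sq_int (\<lambda>x. \<phi> x *\<^sub>R w)"
  using test_compact[OF assms] smooth_fun_continuous[OF test_smooth[OF assms]]
    grad_fun_continuous[OF test_smooth[OF assms]] smooth_fun_dderiv_continuous[OF test_smooth[OF assms]]
  by (auto intro!: compact_support_sq_int[where S = "fsupport \<phi>"] continuous_intros
      simp: fsupport_zero grad_fun_zero fsupport_deriv_zero)

definition tpair :: "('a::euclidean_space \<Rightarrow> real) \<Rightarrow> 'a pair_space" where
  "tpair \<phi> = mk_pair \<phi> (grad_fun \<phi>)"

lemma tpair: "\<phi> \<in> test_functions U \<Longrightarrow> pfun (tpair \<phi>) = \<phi>" "\<phi> \<in> test_functions U \<Longrightarrow> pgrad (tpair \<phi>) = grad_fun \<phi>"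
  by (simp_all add: tpair_def mk_pair test_sq_int)

lemma tpair_ops:
  assumes "\<phi> \<in> test_functions U"
  shows "\<psi> \<in> test_functions U \<Longrightarrow> tpair (\<lambda>x. \<phi> x + \<psi> x) = tpair \<phi> + tpair \<psi>"
    and "tpair (\<lambda>x. c * \<phi> x) = c *\<^sub>R tpair \<phi>"
proof -
  note s = test_smooth[OF assms]
  show "tpair (\<lambda>x. \<phi> x + \<psi> x) = tpair \<phi> + tpair \<psi>" if "\<psi> \<in> test_functions U"
    using grad_fun_ops(1)[OF s test_smooth[OF that]]
    by (intro pair_eqI) (auto simp: pair_ops tpair[OF assms] tpair[OF that] tpair[OF test_ops(1)[OF assms that]])
  show "tpair (\<lambda>x. c * \<phi> x) = c *\<^sub>R tpair \<phi>"
    using grad_fun_ops(3)[OF s s]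
    by (intro pair_eqI) (auto simp: pair_ops tpair[OF assms] tpair[OF test_ops(2)[OF assms]])
qed

section \<open>Translation invariance and integration by parts\<close>

lemma integral_translate:
  fixes f :: "'a::euclidean_space \<Rightarrow> real"
  assumes "f \<in> borel_measurable borel"
  shows "(\<integral>x. f (x + v) \<partial>lborel) = (\<integral>x. f x \<partial>lborel)"
proof -
  have "(\<integral>x. f x \<partial>lborel) = (\<integral>x. f x \<partial>distr lborel borel ((+) v))" by (simp add: lborel_distr_plus)
  also have "\<dots> = (\<integral>x. f (v + x) \<partial>lborel)" by (rule integral_distr) (use assms in auto)
  finally show ?thesis by (simp add: add.commute)
qed

lemma line_has_derivative:
  assumes "smooth_fun \<phi>"
  shows "((\<lambda>t. \<phi> (x + t *\<^sub>R w)) has_real_derivative frechet_derivative \<phi> (at (x + t *\<^sub>R w)) w) (at t within S)"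
proof -
  have d: "(\<phi> has_derivative frechet_derivative \<phi> (at (x + t *\<^sub>R w))) (at (x + t *\<^sub>R w))"
    by (rule smooth_fun_has_derivative) fact
  then interpret linear "frechet_derivative \<phi> (at (x + t *\<^sub>R w))" by (rule has_derivative_linear)
  have "((\<lambda>t. x + t *\<^sub>R w) has_derivative (\<lambda>s. s *\<^sub>R w)) (at t within S)"
    by (auto intro!: derivative_eq_intros)
  from has_derivative_compose[OF this d] show ?thesis
    by (simp add: has_field_derivative_def scaleR mult.commute[of _ "frechet_derivative _ _ _"])
qed

text \<open>Translation invariance makes the difference quotients integrate to zero.\<close>
lemma integral_dderiv_zero:
  fixes \<phi> :: "'a::euclidean_space \<Rightarrow> real"
  assumes "\<phi> \<in> test_functions U"
  shows "(\<integral>x. frechet_derivative \<phi> (at x) v \<partial>lebesgue) = 0"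
proof -
  note s = test_smooth[OF assms] and c = test_compact[OF assms]
  note cD = smooth_fun_dderiv_continuous[OF s, of UNIV v]
  have D0: "x \<notin> fsupport \<phi> \<Longrightarrow> frechet_derivative \<phi> (at x) v = 0" for x by (rule fsupport_deriv_zero)
  obtain C where C: "0 \<le> C" "\<And>x. norm (frechet_derivative \<phi> (at x) v) \<le> C"
    using compact_support_bounded[OF cD c D0] by blast
  obtain R where R: "\<And>x. x \<in> fsupport \<phi> \<Longrightarrow> norm x \<le> R"
    using compact_imp_bounded[OF c] by (auto simp: bounded_iff)
  define Q where "Q n x = real (Suc n) * (\<phi> (x + (1 / real (Suc n)) *\<^sub>R v) - \<phi> x)" for n x
  have m: "\<phi> \<in> borel_measurable borel" and i: "integrable lborel \<phi>"
    by (rule compact_support_integrable[OF smooth_fun_continuous[OF s] c fsupport_zero[of _ \<phi>]], assumption)+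
  have Dm: "(\<lambda>x. frechet_derivative \<phi> (at x) v) \<in> borel_measurable borel"
    by (rule borel_measurable_continuous_onI[OF cD])
  have "integrable lborel (\<lambda>x. \<phi> (x + w))" for w
  proof -
    have "integrable (distr lborel borel ((+) w)) \<phi>" using i by (simp add: lborel_distr_plus)
    then show ?thesis by (subst (asm) integrable_distr_eq) (use m in \<open>auto simp: add.commute\<close>)
  qed
  then have Q0: "(\<integral>x. Q n x \<partial>lborel) = 0" for n
    using i by (simp add: Q_def integral_translate[OF m])
  \<comment> \<open>Dominated convergence: by the mean value theorem the quotients are bounded by
    \<open>C\<close>, and since the shifts have length at most \<open>norm v\<close> they vanish
    outside the ball of radius \<open>R + norm v\<close>.\<close>
  have "(\<lambda>n. \<integral>x. Q n x \<partial>lborel) \<longlonglongrightarrow> (\<integral>x. frechet_derivative \<phi> (at x) v \<partial>lborel)"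
  proof (rule integral_dominated_convergence[where w = "\<lambda>x. C * indicator (cball 0 (R + norm v)) x"])
    show "integrable lborel (\<lambda>x::'a. C * indicator (cball 0 (R + norm v)) x)"
      by (intro integrable_mult_right integrable_real_indicator)
        (use emeasure_bounded_finite[OF bounded_cball, of 0 "R + norm v"] in auto)
    show "AE x in lborel. (\<lambda>n. Q n x) \<longlonglongrightarrow> frechet_derivative \<phi> (at x) v"
    proof (rule AE_I2)
      fix x
      have "((\<lambda>t. \<phi> (x + t *\<^sub>R v)) has_real_derivative frechet_derivative \<phi> (at x) v) (at 0)"
        using line_has_derivative[OF s, of x v 0 UNIV] by simp
      then have "((\<lambda>t. (\<phi> (x + t *\<^sub>R v) - \<phi> x) / t) \<longlongrightarrow> frechet_derivative \<phi> (at x) v) (at 0)"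
        by (simp add: has_field_derivative_iff)
      moreover have "filterlim (\<lambda>n. 1 / real (Suc n)) (at 0) sequentially"
        unfolding filterlim_at using LIMSEQ_Suc[OF lim_1_over_n[where 'a = real]] by simp
      ultimately have "(\<lambda>n. (\<phi> (x + (1 / real (Suc n)) *\<^sub>R v) - \<phi> x) / (1 / real (Suc n)))
          \<longlonglongrightarrow> frechet_derivative \<phi> (at x) v"
        by (rule filterlim_compose)
      then show "(\<lambda>n. Q n x) \<longlonglongrightarrow> frechet_derivative \<phi> (at x) v"
        by (simp add: Q_def mult.commute)
    qed
    have "norm (Q n x) \<le> C * indicator (cball 0 (R + norm v)) x" for n x
    proof (cases "x \<in> cball 0 (R + norm v)")
      case True
      let ?t = "1 / real (Suc n)"
      obtain z where "\<phi> (x + ?t *\<^sub>R v) - \<phi> (x + 0 *\<^sub>R v) = (?t - 0) * frechet_derivative \<phi> (at (x + z *\<^sub>R v)) v"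
        using MVT2[of 0 ?t "\<lambda>t. \<phi> (x + t *\<^sub>R v)" "\<lambda>t. frechet_derivative \<phi> (at (x + t *\<^sub>R v)) v"]
          line_has_derivative[OF s] by auto
      then have "Q n x = frechet_derivative \<phi> (at (x + z *\<^sub>R v)) v" by (simp add: Q_def)
      then show ?thesis using C(2) True by simp
    next
      case False
      then have n: "norm x > R + norm v" by simp
      then have "x \<notin> fsupport \<phi>" using R[of x] norm_ge_zero[of v] by force
      moreover have "x + (1 / real (Suc n)) *\<^sub>R v \<notin> fsupport \<phi>"
      proof
        assume "x + (1 / real (Suc n)) *\<^sub>R v \<in> fsupport \<phi>"
        then have "norm (x + (1 / real (Suc n)) *\<^sub>R v) \<le> R" by (rule R)
        moreover have "norm x \<le> norm (x + (1 / real (Suc n)) *\<^sub>R v) + norm ((1 / real (Suc n)) *\<^sub>R v)"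
          by (metis add_diff_cancel_right' norm_triangle_ineq4)
        moreover have "norm ((1 / real (Suc n)) *\<^sub>R v) \<le> 1 * norm v"
          unfolding norm_scaleR by (intro mult_right_mono) auto
        ultimately show False using n by simp
      qed
      ultimately show ?thesis using C by (simp add: Q_def fsupport_zero indicator_def)
    qed
    then show "AE x in lborel. norm (Q n x) \<le> C * indicator (cball 0 (R + norm v)) x" for n by simp
    show "(\<lambda>x. Q n x) \<in> borel_measurable lborel" for n unfolding Q_def using m by measurable
  qed (use Dm in simp)
  then have "(\<integral>x. frechet_derivative \<phi> (at x) v \<partial>lborel) = 0"
    using LIMSEQ_unique[OF _ tendsto_const] by (simp add: Q0)
  then show ?thesis using Dm by (subst integral_completion) auto
qed

lemma integration_by_parts:
  assumes "\<phi> \<in> test_functions UNIV" "\<psi> \<in> test_functions U"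
  shows "(\<integral>x. \<psi> x * frechet_derivative \<phi> (at x) v \<partial>lebesgue) = - (\<integral>x. \<phi> x * (grad_fun \<psi> x \<bullet> v) \<partial>lebesgue)"
proof -
  note s = test_smooth[OF assms(1)] test_smooth[OF assms(2)]
  have "(\<lambda>x. \<psi> x * \<phi> x) \<in> test_functions UNIV" by (rule test_ops(3)[OF assms(1) s(2)])
  from integral_dderiv_zero[OF this, of v]
  have "(\<integral>x. \<psi> x * frechet_derivative \<phi> (at x) v + frechet_derivative \<psi> (at x) v * \<phi> x \<partial>lebesgue) = 0"
    by (simp only: smooth_derivs(2)[OF s(2,1)])
  moreover have "integrable lebesgue (\<lambda>x. \<psi> x * frechet_derivative \<phi> (at x) v)"
    "integrable lebesgue (\<lambda>x. frechet_derivative \<psi> (at x) v * \<phi> x)"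
    by (intro sq_int_mult_integrable test_sq_int[OF assms(1)] test_sq_int[OF assms(2)])+
  ultimately show ?thesis by (simp add: grad_fun_inner[OF s(2)] mult.commute)
qed

subsection \<open>The fundamental lemma of the calculus of variations\<close>

lemma flat_1_le: "flat 1 t \<le> 1" by (auto simp: flat_def)

text \<open>Dilations of \<open>flat 1\<close> approximate the indicator of the open half-line;
  products over the coordinates do the same for open boxes.\<close>

lemma flat_1_limit: "(\<lambda>n. flat 1 (real (Suc n) * s)) \<longlonglongrightarrow> (if s > 0 then 1 else 0)"
proof (cases "s > 0")
  case True
  have "(\<lambda>n. exp (- (1 / real (Suc n) * (1 / s)))) \<longlonglongrightarrow> exp (- (0 * (1 / s)))"
    by (intro tendsto_intros LIMSEQ_Suc lim_1_over_n)
  moreover have "flat 1 (real (Suc n) * s) = exp (- (1 / real (Suc n) * (1 / s)))" for n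
  proof -
    have "0 < real (Suc n) * s" using True by simp
    then show ?thesis by (simp add: flat_def not_le[symmetric])
  qed
  ultimately show ?thesis using True by simp
next
  case False
  then show ?thesis by (simp add: flat_1(2) mult_nonneg_nonpos)
qed

lemma box_lebesgue: "box a c \<in> sets lebesgue"
  by (simp add: sets_completionI_sets)

lemma sq_int_indicator_box: "sq_int (indicator (box a c) :: 'a::euclidean_space \<Rightarrow> real)"
proof -
  have "(\<lambda>x. (norm (indicator (box a c) x :: real))\<^sup>2) = indicator (box a c)"
    by (auto simp: fun_eq_iff indicator_def)
  moreover have "emeasure lebesgue (box a c) < \<infinity>"
    using emeasure_bounded_finite[OF bounded_box, of a c] by simp
  ultimately show ?thesis
    using box_lebesgue[of a c]
    by (auto simp: sq_int_def intro!: integrable_real_indicator borel_measurable_indicator)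
qed

lemma box_integral_zero:
  fixes f :: "'a::euclidean_space \<Rightarrow> real"
  assumes f: "sq_int f" and z: "\<And>\<phi>. \<phi> \<in> test_functions UNIV \<Longrightarrow> (\<integral>x. \<phi> x * f x \<partial>lebesgue) = 0"
  shows "(\<integral>x. indicator (box a c) x * f x \<partial>lebesgue) = 0"
proof -
  \<comment> \<open>These vanish off the open box, its boundary included, so they are dominated by
    its indicator and converge to it at every point.\<close>
  define \<phi> where "\<phi> n x = (\<Prod>b\<in>Basis. flat 1 (real (Suc n) * ((x - a) \<bullet> b)) * flat 1 (real (Suc n) * ((c - x) \<bullet> b)))" for n x
  have s1: "smooth_fun (\<lambda>x. flat 1 (real (Suc n) * ((x - a) \<bullet> b)))" for n b
    using smooth_fun_flat[of 1 "real (Suc n) *\<^sub>R b" "- real (Suc n) * (a \<bullet> b)"]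
    by (simp add: inner_simps algebra_simps)
  have s2: "smooth_fun (\<lambda>x. flat 1 (real (Suc n) * ((c - x) \<bullet> b)))" for n b
    using smooth_fun_flat[of 1 "- (real (Suc n) *\<^sub>R b)" "real (Suc n) * (c \<bullet> b)"]
    by (simp add: inner_simps algebra_simps)
  have sm: "smooth_fun (\<phi> n)" for n
    unfolding \<phi>_def[abs_def] by (intro smooth_fun_prod smooth_fun_mult s1 s2)
  have out: "\<phi> n x = 0" if "x \<notin> box a c" for n x
  proof -
    obtain b where b: "b \<in> Basis" "(x - a) \<bullet> b \<le> 0 \<or> (c - x) \<bullet> b \<le> 0"
      using \<open>x \<notin> box a c\<close> by (force simp: mem_box inner_simps)
    then have "flat 1 (real (Suc n) * ((x - a) \<bullet> b)) * flat 1 (real (Suc n) * ((c - x) \<bullet> b)) = 0"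
      by (auto simp: flat_1(2) mult_nonneg_nonpos)
    then show ?thesis unfolding \<phi>_def using b by (intro prod_zero) auto
  qed
  have t: "\<phi> n \<in> test_functions UNIV" for n
    by (rule test_functionsI[OF sm compact_cbox[of a c]]) (auto intro!: out dest: subsetD[OF box_subset_cbox])
  have bd: "\<bar>\<phi> n x\<bar> \<le> indicator (box a c) x" for n x
  proof (cases "x \<in> box a c")
    case True
    have "\<bar>\<phi> n x\<bar> = (\<Prod>b\<in>Basis. \<bar>flat 1 (real (Suc n) * ((x - a) \<bullet> b)) * flat 1 (real (Suc n) * ((c - x) \<bullet> b))\<bar>)"
      by (simp add: \<phi>_def abs_prod)
    also have "\<dots> \<le> (\<Prod>b\<in>(Basis::'a set). 1)"
      by (intro prod_mono) (auto simp: abs_mult flat_1 flat_1_le intro!: mult_le_one)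
    finally show ?thesis using True by simp
  qed (simp add: out)
  have lim: "(\<lambda>n. \<phi> n x) \<longlonglongrightarrow> indicator (box a c) x" for x
  proof -
    have "(\<lambda>n. \<phi> n x) \<longlonglongrightarrow> (\<Prod>b\<in>Basis. (if (x - a) \<bullet> b > 0 then 1 else 0) * (if (c - x) \<bullet> b > 0 then 1 else 0))"
      unfolding \<phi>_def by (intro tendsto_prod tendsto_mult flat_1_limit)
    also have "(\<Prod>b\<in>Basis. (if (x - a) \<bullet> b > 0 then 1 else 0) * (if (c - x) \<bullet> b > 0 then 1 else 0 :: real))
       = indicator (box a c) x"
    proof (cases "x \<in> box a c")
      case True
      then show ?thesis by (auto simp: mem_box inner_simps intro!: prod.neutral)
    next
      case False
      then obtain b where "b \<in> Basis" "\<not> ((x - a) \<bullet> b > 0) \<or> \<not> ((c - x) \<bullet> b > 0)"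
        by (force simp: mem_box inner_simps)
      then show ?thesis using False by (auto intro!: prod_zero bexI[of _ b])
    qed
    finally show ?thesis .
  qed
  have ind: "sq_int (indicator (box a c) :: 'a \<Rightarrow> real)"
    by (rule sq_int_indicator_box)
  have "(\<lambda>n. \<integral>x. \<phi> n x * f x \<partial>lebesgue) \<longlonglongrightarrow> (\<integral>x. indicator (box a c) x * f x \<partial>lebesgue)"
  proof (rule integral_dominated_convergence[where w = "\<lambda>x. \<bar>indicator (box a c) x * f x\<bar>"])
    show "integrable lebesgue (\<lambda>x. \<bar>indicator (box a c) x * f x\<bar>)"
      by (intro integrable_abs sq_int_mult_integrable ind f)
    show "AE x in lebesgue. (\<lambda>n. \<phi> n x * f x) \<longlonglongrightarrow> indicator (box a c) x * f x"
      by (intro AE_I2 tendsto_mult lim tendsto_const)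
    show "AE x in lebesgue. norm (\<phi> n x * f x) \<le> \<bar>indicator (box a c) x * f x\<bar>" for n
      using bd by (intro AE_I2) (auto simp: abs_mult intro!: mult_right_mono)
    show "(\<lambda>x. \<phi> n x * f x) \<in> borel_measurable lebesgue" for n
      by (intro borel_measurable_times sq_int_measurable test_sq_int(1)[OF t] f)
  qed (use sq_int_measurable[OF f] box_lebesgue in \<open>auto intro!: borel_measurable_times borel_measurable_indicator\<close>)
  then show ?thesis using LIMSEQ_unique[OF _ tendsto_const] by (simp add: z[OF t])
qed

text \<open>Open boxes generate the Borel sets and are stable under intersection. The vanishing
  total integral handles complements in the induction over the generated algebra.\<close>

lemma integral_box_determined:
  fixes f :: "'a::euclidean_space \<Rightarrow> real"
  assumes f: "integrable lborel f" and U: "(\<integral>x. f x \<partial>lborel) = 0"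
    and box: "\<And>a c. (\<integral>x. indicator (box a c) x * f x \<partial>lborel) = 0"
  shows "AE x in lborel. f x = 0"
proof (rule density_unique_real)
  show "integrable lborel f" by (rule f)
  show "integrable lborel (\<lambda>_. 0 :: real)" by simp
  have i: "integrable lborel (\<lambda>x. indicator A x * f x)" if "A \<in> sets borel" for A
    using integrable_mult_indicator[OF _ f, of A] that by simp
  fix A :: "'a set" assume "A \<in> sets lborel"
  then have A: "A \<in> sigma_sets UNIV (range (\<lambda>(a, c). box a c))"
    by (simp add: borel_eq_box)
  have "Int_stable (range (\<lambda>(a :: 'a, c). box a c))"
  proof (rule Int_stableI)
    fix A B assume "A \<in> range (\<lambda>(a :: 'a, c). box a c)" "B \<in> range (\<lambda>(a :: 'a, c). box a c)"
    then obtain a c a' c' where "A = box a c" "B = box a' c'" by auto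
    then have "A \<inter> B = box a c \<inter> box a' c'" by simp
    moreover have "box p r \<in> range (\<lambda>(a :: 'a, c). box a c)" for p r by auto
    ultimately show "A \<inter> B \<in> range (\<lambda>(a :: 'a, c). box a c)" unfolding box_Int_box by (simp only:)
  qed
  moreover have "range (\<lambda>(a :: 'a, c). box a c) \<subseteq> Pow UNIV" by simp
  ultimately have "(\<integral>x. indicator A x * f x \<partial>lborel) = 0"
    using A
  proof (induction rule: sigma_sets_induct_disjoint)
    case (basic A)
    then show ?case using box by auto
  next
    case empty
    then show ?case by simp
  next
    case (compl A)
    then have A: "A \<in> sets borel" by (simp add: borel_eq_box)
    have "(\<lambda>x. indicator (UNIV - A) x * f x) = (\<lambda>x. f x - indicator A x * f x)"
      by (auto simp: indicator_def fun_eq_iff)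
    then show ?case using compl i[OF A] f U by simp
  next
    case (union A)
    then have A: "A i \<in> sets borel" for i by (auto simp: borel_eq_box)
    have "(LINT x:(\<Union>i. A i)|lborel. f x) = (\<Sum>i. (LINT x:(A i)|lborel. f x))"
      by (rule lebesgue_integral_countable_add)
        (use A union i[of "\<Union>i. A i"] in \<open>auto simp: disjoint_family_on_def set_integrable_def\<close>)
    then show ?case using union by (simp add: set_lebesgue_integral_def)
  qed
  then show "(LINT x:A|lborel. f x) = (LINT x:A|lborel. 0)" by (simp add: set_lebesgue_integral_def)
qed


text \<open>A square integrable \<open>f\<close> may fail to be integrable, so its Borel version is
  cut off to the growing boxes \<open>Q n\<close>. Cutting off is compatible with the box criterion
  because the intersection of two boxes is a box.\<close>

lemma test_functions_separate:
  fixes f :: "'a::euclidean_space \<Rightarrow> real"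
  assumes f: "sq_int f" and z: "\<And>\<phi>. \<phi> \<in> test_functions UNIV \<Longrightarrow> (\<integral>x. \<phi> x * f x \<partial>lebesgue) = 0"
  shows "AE x in lebesgue. f x = 0"
proof -
  obtain f' where f': "f' \<in> borel_measurable lborel" "AE x in lborel. f x = f' x"
    using completion_ex_borel_measurable_real sq_int_measurable[OF f] by blast
  have ae: "AE x in lebesgue. f x = f' x" using f'(2) by (rule AE_completion)
  have m: "f \<in> borel_measurable lebesgue" "f' \<in> borel_measurable borel" "f' \<in> borel_measurable lebesgue"
    using f f' by (auto simp: measurable_completion)
  define Q :: "nat \<Rightarrow> 'a set" where "Q n = box (- real n *\<^sub>R One) (real n *\<^sub>R One)" for n
  have eq: "(\<integral>x. indicator (box a c) x * f' x \<partial>lborel) = 0" for a c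
  proof -
    have "(\<integral>x. indicator (box a c) x * f' x \<partial>lborel) = (\<integral>x. indicator (box a c) x * f' x \<partial>lebesgue)"
      by (rule integral_completion[symmetric]) (use m in auto)
    also have "\<dots> = (\<integral>x. indicator (box a c) x * f x \<partial>lebesgue)"
      by (rule integral_cong_AE)
        (use ae in \<open>auto intro!: borel_measurable_times borel_measurable_indicator m elim: eventually_mono\<close>)
    also have "\<dots> = 0" by (rule box_integral_zero[OF f z])
    finally show ?thesis .
  qed
  have "AE x in lborel. indicator (Q n) x * f' x = 0" for n
  proof (rule integral_box_determined)
    have "sq_int (indicator (Q n) :: 'a \<Rightarrow> real)"
      unfolding Q_def by (rule sq_int_indicator_box)
    then have "integrable lebesgue (\<lambda>x. indicator (Q n) x * f x)" by (rule sq_int_mult_integrable[OF _ f])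
    moreover have "AE x in lebesgue. indicator (Q n) x * f x = indicator (Q n) x * f' x"
      using ae by (auto elim: eventually_mono)
    ultimately have "integrable lebesgue (\<lambda>x. indicator (Q n) x * f' x)"
      by (subst (asm) integrable_cong_AE)
        (auto simp: Q_def intro!: borel_measurable_times borel_measurable_indicator m)
    then show "integrable lborel (\<lambda>x. indicator (Q n) x * f' x)"
      by (subst (asm) integrable_completion) (use m in \<open>auto simp: Q_def\<close>)
    show "(\<integral>x. indicator (Q n) x * f' x \<partial>lborel) = 0" unfolding Q_def by (rule eq)
    show "(\<integral>x. indicator (box a c) x * (indicator (Q n) x * f' x) \<partial>lborel) = 0" for a c
      using eq[of "\<Sum>i\<in>Basis. max (a \<bullet> i) ((- real n *\<^sub>R One) \<bullet> i) *\<^sub>R i" "\<Sum>i\<in>Basis. min (c \<bullet> i) ((real n *\<^sub>R One) \<bullet> i) *\<^sub>R i"]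
      unfolding Q_def mult.assoc[symmetric] indicator_inter_arith[symmetric] box_Int_box .
  qed
  then have "AE x in lborel. \<forall>n. indicator (Q n) x * f' x = 0" unfolding AE_all_countable by blast
  then have "AE x in lborel. f' x = 0"
  proof eventually_elim
    case (elim x)
    obtain n :: nat where n: "norm x < real n" using reals_Archimedean2 by blast
    have "x \<in> Q n"
      unfolding Q_def mem_box using n Basis_le_norm[of _ x] by (fastforce simp: abs_le_iff inner_simps)
    then show ?case using elim[rule_format, of n] by simp
  qed
  then have "AE x in lebesgue. f' x = 0" by (rule AE_completion)
  with ae show ?thesis by eventually_elim simp
qed

lemma weak_gradient_unique:
  fixes u :: "'a::euclidean_space \<Rightarrow> real"
  assumes "weak_gradient UNIV u g" "weak_gradient UNIV u g'" "sq_int g" "sq_int g'"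
  shows "AE x in lebesgue. g x = g' x"
proof -
  have "AE x in lebesgue. (g x - g' x) \<bullet> v = 0" for v
  proof (rule test_functions_separate)
    have d: "sq_int (\<lambda>x. g x - g' x)" by (rule sq_int_diff) fact+
    then show "sq_int (\<lambda>x. (g x - g' x) \<bullet> v)"
      by (intro sq_int_dominated[OF d d, where C = "norm v"])
        (auto simp: mult.commute intro: order_trans[OF Cauchy_Schwarz_ineq2] add_increasing2)
    fix \<phi> :: "'a \<Rightarrow> real" assume \<phi>: "\<phi> \<in> test_functions UNIV"
    have "integrable lebesgue (\<lambda>x. \<phi> x * (g x \<bullet> v))" "integrable lebesgue (\<lambda>x. \<phi> x * (g' x \<bullet> v))"
      "(\<integral>x. \<phi> x * (g x \<bullet> v) \<partial>lebesgue) = (\<integral>x. \<phi> x * (g' x \<bullet> v) \<partial>lebesgue)"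
      using assms(1,2)[unfolded weak_gradient_def, rule_format, OF \<phi>, of v] by simp_all
    then show "(\<integral>x. \<phi> x * ((g x - g' x) \<bullet> v) \<partial>lebesgue) = 0"
      by (simp add: inner_diff_left right_diff_distrib)
  qed
  then have "AE x in lebesgue. \<forall>b\<in>Basis. (g x - g' x) \<bullet> b = 0" by (intro AE_finite_allI) auto
  then show ?thesis by eventually_elim (simp add: euclidean_eq_iff[of "g _"] inner_diff_left)
qed

subsection \<open>The closure of the test functions\<close>

text \<open>The sum of the two forms is the \<open>H\<^sup>1\<close> inner product.\<close>

global_interpretation h: psd_form "\<lambda>X Y. b_form X Y + q_form X Y"
proof unfold_locales
  show "bilinear (\<lambda>X Y. b_form X Y + q_form X Y :: real)"
    unfolding bilinear_def by (intro conjI allI linearI) (simp_all add: b.lin q.lin algebra_simps)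
  show "b_form X Y + q_form X Y = b_form Y X + q_form Y X" for X Y by (simp add: b.sym[of X] q.sym[of X])
  show "0 \<le> b_form X X + q_form X X" for X by (simp add: b.nonneg q.nonneg)
qed

lemma b_le_h: "b.nrm X \<le> h.nrm X" and q_le_h: "q.nrm X \<le> h.nrm X"
  by (simp_all add: b.nrm_def q.nrm_def h.nrm_def b.nonneg q.nonneg)

lemma h_le: "h.nrm X \<le> b.nrm X + q.nrm X"
  unfolding b.nrm_def q.nrm_def h.nrm_def by (rule sqrt_add_le_add_sqrt) (simp_all add: b.nonneg q.nonneg)

text \<open>Besides a function with its weak gradient, the set contains every pair at
  \<open>H\<^sup>1\<close> distance zero from it, that is, all representatives.\<close>

definition H1 :: "'a::euclidean_space set \<Rightarrow> 'a pair_space set" where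
  "H1 U = {X. \<forall>\<epsilon>>0. \<exists>\<phi>\<in>test_functions U. h.nrm (tpair \<phi> - X) < \<epsilon>}"

lemma H1_mono: "U \<subseteq> V \<Longrightarrow> H1 U \<subseteq> H1 V"
  unfolding H1_def using test_mono[of U V] by blast

lemma tpair_H1: "\<phi> \<in> test_functions U \<Longrightarrow> tpair \<phi> \<in> H1 U"
  unfolding H1_def by (auto intro!: bexI[of _ \<phi>] simp: h.nrm_zero)

lemma H1_closed:
  assumes "\<And>\<epsilon>. \<epsilon> > 0 \<Longrightarrow> \<exists>Y\<in>H1 U. h.nrm (Y - X) < \<epsilon>"
  shows "X \<in> H1 U"
  unfolding H1_def
proof (intro CollectI allI impI)
  fix \<epsilon> :: real assume "\<epsilon> > 0"
  then obtain Y where Y: "Y \<in> H1 U" "h.nrm (Y - X) < \<epsilon>/2" using assms[of "\<epsilon>/2"] by auto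
  then obtain \<phi> where \<phi>: "\<phi> \<in> test_functions U" "h.nrm (tpair \<phi> - Y) < \<epsilon>/2"
    using half_gt_zero[OF \<open>\<epsilon> > 0\<close>] unfolding H1_def by blast
  have "h.nrm (tpair \<phi> - X) \<le> h.nrm (tpair \<phi> - Y) + h.nrm (Y - X)"
    using h.nrm_add[of "tpair \<phi> - Y" "Y - X"] by simp
  then show "\<exists>\<phi>\<in>test_functions U. h.nrm (tpair \<phi> - X) < \<epsilon>" using \<phi> Y by (intro bexI[of _ \<phi>]) auto
qed

lemma H1_null: "X \<in> H1 U \<Longrightarrow> h.nrm (X - Y) = 0 \<Longrightarrow> Y \<in> H1 U"
  by (rule H1_closed) (auto intro!: bexI[of _ X])

lemma H1_approx:
  assumes "X \<in> H1 U"
  obtains \<phi> where "\<And>n. \<phi> n \<in> test_functions U" "(\<lambda>n. h.nrm (tpair (\<phi> n) - X)) \<longlonglongrightarrow> 0"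
proof -
  have "\<forall>n. \<exists>\<phi>\<in>test_functions U. h.nrm (tpair \<phi> - X) < 1 / real (Suc n)"
    using assms unfolding H1_def by simp
  then obtain \<phi> where \<phi>: "\<And>n. \<phi> n \<in> test_functions U" "\<And>n. h.nrm (tpair (\<phi> n) - X) < 1 / real (Suc n)"
    by metis
  have "(\<lambda>n. h.nrm (tpair (\<phi> n) - X)) \<longlonglongrightarrow> 0"
    by (rule tendsto_sandwich[OF _ _ tendsto_const LIMSEQ_Suc[OF lim_1_over_n]])
      (use \<phi>(2) in \<open>auto intro!: always_eventually less_imp_le simp: h.nrm_nonneg simp del: of_nat_Suc\<close>)
  with \<phi>(1) show ?thesis by (rule that)
qed

lemma H1_subspace: "subspace (H1 U)"
  unfolding subspace_def
proof (intro conjI ballI allI)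
  have "tpair (\<lambda>_. 0) = (0 :: 'a pair_space)"
    using tpair_ops(2)[OF zero_test, of 0] by simp
  then show "0 \<in> H1 U" using tpair_H1[OF zero_test, of U] by simp
  fix X assume X: "X \<in> H1 U"
  show "c *\<^sub>R X \<in> H1 U" for c
  proof (rule H1_closed)
    fix \<epsilon> :: real assume "\<epsilon> > 0"
    then have "\<epsilon> / (\<bar>c\<bar> + 1) > 0" by simp
    then obtain \<phi> where \<phi>: "\<phi> \<in> test_functions U" "h.nrm (tpair \<phi> - X) < \<epsilon> / (\<bar>c\<bar> + 1)"
      using X unfolding H1_def by blast
    have "h.nrm (tpair (\<lambda>x. c * \<phi> x) - c *\<^sub>R X) = \<bar>c\<bar> * h.nrm (tpair \<phi> - X)"
      by (simp add: tpair_ops(2)[OF \<phi>(1)] h.nrm_scale flip: scaleR_diff_right)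
    also have "\<dots> \<le> (\<bar>c\<bar> + 1) * h.nrm (tpair \<phi> - X)"
      by (intro mult_right_mono h.nrm_nonneg) auto
    also have "\<dots> < \<epsilon>" using \<phi>(2) by (simp add: field_simps)
    finally show "\<exists>Y\<in>H1 U. h.nrm (Y - c *\<^sub>R X) < \<epsilon>"
      using tpair_H1[OF test_ops(2)[OF \<phi>(1)]] by blast
  qed
  fix Y assume Y: "Y \<in> H1 U"
  show "X + Y \<in> H1 U"
  proof (rule H1_closed)
    fix \<epsilon> :: real assume "\<epsilon> > 0"
    then have e: "\<epsilon> / 2 > 0" by simp
    obtain \<phi> where \<phi>: "\<phi> \<in> test_functions U" "h.nrm (tpair \<phi> - X) < \<epsilon> / 2"
      using X e unfolding H1_def by blast
    obtain \<psi> where \<psi>: "\<psi> \<in> test_functions U" "h.nrm (tpair \<psi> - Y) < \<epsilon> / 2"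
      using Y e unfolding H1_def by blast
    have "tpair (\<lambda>x. \<phi> x + \<psi> x) - (X + Y) = (tpair \<phi> - X) + (tpair \<psi> - Y)"
      by (simp add: tpair_ops(1)[OF \<phi>(1) \<psi>(1)])
    then have "h.nrm (tpair (\<lambda>x. \<phi> x + \<psi> x) - (X + Y)) < \<epsilon>"
      using h.nrm_add[of "tpair \<phi> - X" "tpair \<psi> - Y"] \<phi>(2) \<psi>(2) by (simp only:)
    then show "\<exists>Z\<in>H1 U. h.nrm (Z - (X + Y)) < \<epsilon>"
      using tpair_H1[OF test_ops(1)[OF \<phi>(1) \<psi>(1)]] by blast
  qed
qed

text \<open>The identity to be shown says that \<open>X\<close> is
  \<open>H\<^sup>1\<close>-orthogonal to the pair \<open>A\<close> built from a test function.
  Integration by parts gives this for test functions, and orthogonality survives limits by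
  Cauchy-Schwarz.\<close>

lemma H1_weak_gradient:
  assumes "X \<in> H1 U"
  shows "weak_gradient UNIV (pfun X) (pgrad X)"
  unfolding weak_gradient_def
proof (intro ballI allI)
  fix \<phi> :: "'a \<Rightarrow> real" and v assume \<phi>: "\<phi> \<in> test_functions UNIV"
  define A where "A = mk_pair (\<lambda>x. frechet_derivative \<phi> (at x) v) (\<lambda>x. \<phi> x *\<^sub>R v)"
  have A: "pfun A = (\<lambda>x. frechet_derivative \<phi> (at x) v)" "pgrad A = (\<lambda>x. \<phi> x *\<^sub>R v)"
    using mk_pair[OF test_sq_int(3,4)[OF \<phi>], of v v] by (simp_all add: A_def)
  have L: "b_form Y A + q_form Y A = (\<integral>x. pfun Y x * frechet_derivative \<phi> (at x) v \<partial>lebesgue)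
      + (\<integral>x. \<phi> x * (pgrad Y x \<bullet> v) \<partial>lebesgue)" for Y
    by (simp add: b_form_def q_form_def A)
  have small: "\<bar>b_form X A + q_form X A\<bar> \<le> 0 + \<epsilon> * h.nrm A" if "\<epsilon> > 0" for \<epsilon>
  proof -
    from assms that obtain \<psi> where \<psi>: "\<psi> \<in> test_functions U" "h.nrm (tpair \<psi> - X) < \<epsilon>"
      unfolding H1_def by blast
    have "b_form (tpair \<psi>) A + q_form (tpair \<psi>) A = 0"
      unfolding L tpair[OF \<psi>(1)] using integration_by_parts[OF \<phi> \<psi>(1), of v] by simp
    then have "\<bar>b_form X A + q_form X A\<bar> = \<bar>b_form (tpair \<psi> - X) A + q_form (tpair \<psi> - X) A\<bar>"
      by (simp add: b.lin q.lin)
    also have "\<dots> \<le> h.nrm (tpair \<psi> - X) * h.nrm A" by (rule h.cauchy_schwarz)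
    also have "\<dots> \<le> \<epsilon> * h.nrm A" using \<psi> by (intro mult_right_mono h.nrm_nonneg) auto
    finally show ?thesis by simp
  qed
  have "\<bar>b_form X A + q_form X A\<bar> \<le> 0"
  proof (rule field_le_epsilon)
    fix \<epsilon> :: real assume "\<epsilon> > 0"
    then have "\<bar>b_form X A + q_form X A\<bar> \<le> \<epsilon> / (h.nrm A + 1) * h.nrm A"
      using small[of "\<epsilon> / (h.nrm A + 1)"] h.nrm_nonneg[of A] by simp
    also have "\<dots> \<le> \<epsilon>" using \<open>\<epsilon> > 0\<close> h.nrm_nonneg[of A] by (simp add: field_simps)
    finally show "\<bar>b_form X A + q_form X A\<bar> \<le> 0 + \<epsilon>" by simp
  qed
  then have z: "b_form X A + q_form X A = 0" by simp
  have "integrable lebesgue (\<lambda>x. pfun X x * frechet_derivative \<phi> (at x) v)"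
    by (intro sq_int_mult_integrable sq_int_pair test_sq_int[OF \<phi>])
  moreover have "integrable lebesgue (\<lambda>x. pgrad X x \<bullet> (\<phi> x *\<^sub>R v))"
    by (intro sq_int_inner_integrable sq_int_pair test_sq_int[OF \<phi>])
  ultimately show "integrable lebesgue (\<lambda>x. pfun X x * frechet_derivative \<phi> (at x) v) \<and>
      integrable lebesgue (\<lambda>x. \<phi> x * (pgrad X x \<bullet> v)) \<and>
      (\<integral>x. pfun X x * frechet_derivative \<phi> (at x) v \<partial>lebesgue) = - (\<integral>x. \<phi> x * (pgrad X x \<bullet> v) \<partial>lebesgue)"
    using z unfolding L by simp
qed

lemma sq_diff_forms:
  "b_form (X - Y) (X - Y) = (\<integral>x. (pfun X x - pfun Y x)\<^sup>2 \<partial>lebesgue)"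
  "q_form (X - Y) (X - Y) = (\<integral>x. (norm (pgrad X x - pgrad Y x))\<^sup>2 \<partial>lebesgue)"
  by (simp_all add: b_form_def q_form_def pair_ops power2_eq_square dot_square_norm)

lemma H10_iff: "u \<in> H10 U \<longleftrightarrow> (\<exists>X\<in>H1 U. pfun X = u)"
proof
  assume "u \<in> H10 U"
  then obtain g \<phi> where u: "sq_int u" "sq_int g" and \<phi>: "\<And>n. \<phi> n \<in> test_functions U"
    and lim: "(\<lambda>n. \<integral>x. (\<phi> n x - u x)\<^sup>2 \<partial>lebesgue) \<longlonglongrightarrow> 0"
      "(\<lambda>n. \<integral>x. (norm (grad_fun (\<phi> n) x - g x))\<^sup>2 \<partial>lebesgue) \<longlonglongrightarrow> 0"
    unfolding H10_def L2fun_iff L2vec_iff by blast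
  define X where "X = mk_pair u g"
  have X: "pfun X = u" "pgrad X = g" using u by (auto simp: X_def mk_pair)
  have "(\<lambda>n. sqrt (b_form (tpair (\<phi> n) - X) (tpair (\<phi> n) - X) + q_form (tpair (\<phi> n) - X) (tpair (\<phi> n) - X)))
      \<longlonglongrightarrow> sqrt (0 + 0)"
    unfolding sq_diff_forms tpair[OF \<phi>] X by (intro tendsto_intros lim)
  then have lim: "(\<lambda>n. h.nrm (tpair (\<phi> n) - X)) \<longlonglongrightarrow> 0" by (simp add: h.nrm_def)
  have "X \<in> H1 U"
  proof (rule H1_closed)
    fix \<epsilon> :: real assume "\<epsilon> > 0"
    then obtain n where "h.nrm (tpair (\<phi> n) - X) < \<epsilon>"
      using order_tendstoD(2)[OF lim, of \<epsilon>] by (auto simp: eventually_sequentially)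
    then show "\<exists>Y\<in>H1 U. h.nrm (Y - X) < \<epsilon>" using tpair_H1[OF \<phi>] by blast
  qed
  then show "\<exists>X\<in>H1 U. pfun X = u" using X by blast
next
  assume "\<exists>X\<in>H1 U. pfun X = u"
  then obtain X where X: "X \<in> H1 U" "pfun X = u" by blast
  obtain \<phi> where \<phi>: "\<And>n. \<phi> n \<in> test_functions U" and lim: "(\<lambda>n. h.nrm (tpair (\<phi> n) - X)) \<longlonglongrightarrow> 0"
    using H1_approx[OF X(1)] by blast
  have sq: "(\<lambda>n. (h.nrm (tpair (\<phi> n) - X))\<^sup>2) \<longlonglongrightarrow> 0" using tendsto_power[OF lim, of 2] by simp
  have "(\<lambda>n. b_form (tpair (\<phi> n) - X) (tpair (\<phi> n) - X)) \<longlonglongrightarrow> 0"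
    by (rule tendsto_sandwich[OF _ _ tendsto_const sq]) (simp_all add: b.nonneg q.nonneg h.nrm_sq)
  moreover have "(\<lambda>n. q_form (tpair (\<phi> n) - X) (tpair (\<phi> n) - X)) \<longlonglongrightarrow> 0"
    by (rule tendsto_sandwich[OF _ _ tendsto_const sq]) (simp_all add: b.nonneg q.nonneg h.nrm_sq)
  ultimately have "(\<lambda>n. \<integral>x. (\<phi> n x - pfun X x)\<^sup>2 \<partial>lebesgue) \<longlonglongrightarrow> 0"
    "(\<lambda>n. \<integral>x. (norm (grad_fun (\<phi> n) x - pgrad X x))\<^sup>2 \<partial>lebesgue) \<longlonglongrightarrow> 0"
    unfolding sq_diff_forms tpair[OF \<phi>] by auto
  then show "u \<in> H10 U"
    unfolding H10_def L2fun_iff L2vec_iff using X \<phi> sq_int_pair H1_weak_gradient[OF X(1)] by blast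
qed

lemma wgrad_eq:
  assumes "X \<in> H1 U"
  shows "AE x in lebesgue. wgrad (pfun X) x = pgrad X x"
    and "wgrad (pfun X) \<in> borel_measurable lebesgue"
proof -
  have "\<exists>g. L2vec g \<and> weak_gradient UNIV (pfun X) g"
    using H1_weak_gradient[OF assms] sq_int_pair by (auto simp: L2vec_iff)
  then have "L2vec (wgrad (pfun X)) \<and> weak_gradient UNIV (pfun X) (wgrad (pfun X))"
    unfolding wgrad_def by (rule someI_ex)
  then have w: "sq_int (wgrad (pfun X))" "weak_gradient UNIV (pfun X) (wgrad (pfun X))"
    by (auto simp: L2vec_iff)
  show "AE x in lebesgue. wgrad (pfun X) x = pgrad X x"
    by (rule weak_gradient_unique[OF w(2) H1_weak_gradient[OF assms] w(1) sq_int_pair(2)])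
  show "wgrad (pfun X) \<in> borel_measurable lebesgue" using w(1) by (rule sq_int_measurable)
qed

lemma forms_eq:
  assumes "X \<in> H1 U" "Y \<in> H1 V"
  shows "dirichlet_form (pfun X) (pfun Y) = q_form X Y" "l2_inner (pfun X) (pfun Y) = b_form X Y"
    "energy (pfun X) = q_form X X"
proof -
  note m [measurable] = wgrad_eq(2)[OF assms(1)] wgrad_eq(2)[OF assms(2)]
    sq_int_pair(2)[of X, THEN sq_int_measurable] sq_int_pair(2)[of Y, THEN sq_int_measurable]
  show "dirichlet_form (pfun X) (pfun Y) = q_form X Y"
    unfolding dirichlet_form_def q_form_def
  proof (rule integral_cong_AE)
    show "AE x in lebesgue. wgrad (pfun X) x \<bullet> wgrad (pfun Y) x = pgrad X x \<bullet> pgrad Y x"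
      using wgrad_eq(1)[OF assms(1)] wgrad_eq(1)[OF assms(2)] by eventually_elim simp
  qed measurable
  show "l2_inner (pfun X) (pfun Y) = b_form X Y" by (simp add: l2_inner_def b_form_def)
  show "energy (pfun X) = q_form X X"
    unfolding energy_def q_form_def
  proof (rule integral_cong_AE)
    show "AE x in lebesgue. (norm (wgrad (pfun X) x))\<^sup>2 = pgrad X x \<bullet> pgrad X x"
      using wgrad_eq(1)[OF assms(1)] by eventually_elim (simp add: dot_square_norm)
  qed measurable
qed

text \<open>A weak gradient is determined by its function, so the second component adds no freedom.
  This is the passage from statements on functions in \<open>H10\<close> to statements on
  pairs.\<close>

lemma H1_same_fun:
  assumes "X \<in> H1 U" "Y \<in> H1 V" "AE x in lebesgue. pfun X x = pfun Y x"
  shows "h.nrm (X - Y) = 0"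
proof -
  have "weak_gradient UNIV (pfun X) (pgrad Y)"
    unfolding weak_gradient_def
  proof (intro ballI allI)
    fix \<phi> :: "'a \<Rightarrow> real" and v assume \<phi>: "\<phi> \<in> test_functions UNIV"
    note w = H1_weak_gradient[OF assms(1), unfolded weak_gradient_def, rule_format, OF \<phi>, of v]
      H1_weak_gradient[OF assms(2), unfolded weak_gradient_def, rule_format, OF \<phi>, of v]
    have "(\<integral>x. pfun X x * frechet_derivative \<phi> (at x) v \<partial>lebesgue) = (\<integral>x. pfun Y x * frechet_derivative \<phi> (at x) v \<partial>lebesgue)"
      by (rule integral_cong_AE) (use w assms(3) in \<open>auto elim: eventually_mono\<close>)
    then show "integrable lebesgue (\<lambda>x. pfun X x * frechet_derivative \<phi> (at x) v) \<and>
      integrable lebesgue (\<lambda>x. \<phi> x * (pgrad Y x \<bullet> v)) \<and>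
      (\<integral>x. pfun X x * frechet_derivative \<phi> (at x) v \<partial>lebesgue) = - (\<integral>x. \<phi> x * (pgrad Y x \<bullet> v) \<partial>lebesgue)"
      using w by simp
  qed
  from weak_gradient_unique[OF H1_weak_gradient[OF assms(1)] this sq_int_pair(2) sq_int_pair(2)]
  have "AE x in lebesgue. pgrad X x = pgrad Y x" .
  then have "q_form (X - Y) (X - Y) = 0"
    unfolding sq_diff_forms by (intro integral_eq_zero_AE) (auto elim: eventually_mono)
  moreover have "b_form (X - Y) (X - Y) = 0"
    unfolding sq_diff_forms using assms(3) by (intro integral_eq_zero_AE) (auto elim: eventually_mono)
  ultimately show ?thesis by (simp add: h.nrm_def)
qed

lemma (in psd_form) tendsto_form:
  assumes "(\<lambda>n. nrm (X n - x)) \<longlonglongrightarrow> 0"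
  shows "(\<lambda>n. B (X n) y) \<longlonglongrightarrow> B x y" "(\<lambda>n. B (X n) (X n)) \<longlonglongrightarrow> B x x"
proof -
  have lim: "(\<lambda>n. B (X n) y) \<longlonglongrightarrow> B x y" for y
  proof -
    have "(\<lambda>n. nrm (X n - x) * nrm y) \<longlonglongrightarrow> 0" using tendsto_mult_left_zero[OF assms] by simp
    then have "(\<lambda>n. B (X n - x) y) \<longlonglongrightarrow> 0"
      by (rule Lim_null_comparison[rotated]) (simp add: cauchy_schwarz)
    then show ?thesis unfolding lin by (rule LIM_zero_cancel)
  qed
  show "(\<lambda>n. B (X n) y) \<longlonglongrightarrow> B x y" by (rule lim)
  have "(\<lambda>n. (nrm (X n - x))\<^sup>2 + 2 * B (X n) x - B x x) \<longlonglongrightarrow> 0\<^sup>2 + 2 * B x x - B x x"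
    by (intro tendsto_intros assms lim)
  moreover have "(nrm (X n - x))\<^sup>2 + 2 * B (X n) x - B x x = B (X n) (X n)" for n
    by (simp add: nrm_sq lin sym[of x "X n"])
  ultimately show "(\<lambda>n. B (X n) (X n)) \<longlonglongrightarrow> B x x" by simp
qed

lemma h_tendsto:
  assumes "(\<lambda>n. h.nrm (X n - x)) \<longlonglongrightarrow> 0"
  shows "(\<lambda>n. b.nrm (X n - x)) \<longlonglongrightarrow> 0" "(\<lambda>n. q.nrm (X n - x)) \<longlonglongrightarrow> 0"
  by (rule tendsto_sandwich[OF _ _ tendsto_const assms]; simp add: b.nrm_nonneg b_le_h q.nrm_nonneg q_le_h)+

subsection \<open>Poincare's inequality and completeness\<close>

lemma test_nn_integral:
  assumes "\<phi> \<in> test_functions U"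
  shows "(\<integral>\<^sup>+x. ennreal ((\<phi> x)\<^sup>2) \<partial>lborel) = ennreal (b_form (tpair \<phi>) (tpair \<phi>))"
    "(\<integral>\<^sup>+x. ennreal ((norm (grad_fun \<phi> x))\<^sup>2) \<partial>lborel) = ennreal (q_form (tpair \<phi>) (tpair \<phi>))"
proof -
  have "(\<integral>\<^sup>+x. ennreal ((\<phi> x)\<^sup>2) \<partial>lebesgue) = ennreal (\<integral>x. (\<phi> x)\<^sup>2 \<partial>lebesgue)"
    using test_sq_int(1)[OF assms] by (intro nn_integral_eq_integral) (auto simp: sq_int_def)
  then show "(\<integral>\<^sup>+x. ennreal ((\<phi> x)\<^sup>2) \<partial>lborel) = ennreal (b_form (tpair \<phi>) (tpair \<phi>))"
    by (simp add: nn_integral_completion b_form_def tpair[OF assms] power2_eq_square)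
  have "(\<integral>\<^sup>+x. ennreal ((norm (grad_fun \<phi> x))\<^sup>2) \<partial>lebesgue) = ennreal (\<integral>x. (norm (grad_fun \<phi> x))\<^sup>2 \<partial>lebesgue)"
    using test_sq_int(2)[OF assms] by (intro nn_integral_eq_integral) (auto simp: sq_int_def)
  then show "(\<integral>\<^sup>+x. ennreal ((norm (grad_fun \<phi> x))\<^sup>2) \<partial>lborel) = ennreal (q_form (tpair \<phi>) (tpair \<phi>))"
    by (simp add: nn_integral_completion q_form_def tpair[OF assms] dot_square_norm)
qed

text \<open>The increment \<open>d\<close> is the mean of the directional derivative along the
  segment, and a nonnegative variance bounds the square of a mean by the mean of the squares.
  Nonnegative integrals are used so that orders of integration can be exchanged freely
  later.\<close>

lemma line_estimate:
  assumes s: "smooth_fun \<phi>"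
  shows "ennreal ((\<phi> (x + w) - \<phi> x)\<^sup>2)
    \<le> (\<integral>\<^sup>+t. indicator {0..1} t * ennreal ((norm w)\<^sup>2 * (norm (grad_fun \<phi> (x + t *\<^sub>R w)))\<^sup>2) \<partial>lborel)"
proof -
  define f where "f t = frechet_derivative \<phi> (at (x + t *\<^sub>R w)) w" for t
  define d where "d = \<phi> (x + w) - \<phi> x"
  have cf: "continuous_on S f" for S
    unfolding f_def by (rule continuous_on_compose2[OF smooth_fun_dderiv_continuous[OF s, of UNIV w]])
      (auto intro!: continuous_intros)
  have cf2: "continuous_on {0..1} (\<lambda>t. (f t)\<^sup>2)" by (intro continuous_intros cf)
  have if1: "integrable lborel (\<lambda>t. indicator {0..1} t *\<^sub>R f t)"
    and if2: "integrable lborel (\<lambda>t. indicator {0..1} t *\<^sub>R (f t)\<^sup>2)"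
    by (rule borel_integrable_compact; auto intro: cf cf2)+
  have i1: "integrable lborel (indicator {0..1::real} :: real \<Rightarrow> real)"
    by (intro integrable_real_indicator) auto
  have "(\<integral>t. indicator {0..1} t *\<^sub>R f t \<partial>lborel) = \<phi> (x + 1 *\<^sub>R w) - \<phi> (x + 0 *\<^sub>R w)"
  proof (rule integral_FTC_atLeastAtMost)
    show "((\<lambda>t. \<phi> (x + t *\<^sub>R w)) has_vector_derivative f t) (at t within {0..1})" for t
      using line_has_derivative[OF s] unfolding f_def by (simp add: has_real_derivative_iff_has_vector_derivative)
  qed (auto intro: cf)
  then have int: "(\<integral>t. indicator {0..1} t * f t \<partial>lborel) = d" by (simp add: d_def)
  have "0 \<le> (\<integral>t. indicator {0..1} t * (f t - d)\<^sup>2 \<partial>lborel)" by (intro integral_nonneg_AE) auto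
  also have "\<dots> = (\<integral>t. indicator {0..1} t * (f t)\<^sup>2 - 2 * d * (indicator {0..1} t * f t) + d\<^sup>2 * indicator {0..1} t \<partial>lborel)"
    by (rule Bochner_Integration.integral_cong) (auto simp: power2_diff algebra_simps)
  also have "\<dots> = (\<integral>t. indicator {0..1} t * (f t)\<^sup>2 \<partial>lborel) - d\<^sup>2"
    using if1 if2 i1 by (simp add: int power2_eq_square)
  finally have "d\<^sup>2 \<le> (\<integral>t. indicator {0..1} t * (f t)\<^sup>2 \<partial>lborel)" by simp
  then have "ennreal (d\<^sup>2) \<le> ennreal (\<integral>t. indicator {0..1} t * (f t)\<^sup>2 \<partial>lborel)" by (rule ennreal_leI)
  also have "\<dots> = (\<integral>\<^sup>+t. ennreal (indicator {0..1} t * (f t)\<^sup>2) \<partial>lborel)"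
    using if2 by (intro nn_integral_eq_integral[symmetric]) auto
  also have "\<dots> \<le> (\<integral>\<^sup>+t. indicator {0..1} t * ennreal ((norm w)\<^sup>2 * (norm (grad_fun \<phi> (x + t *\<^sub>R w)))\<^sup>2) \<partial>lborel)"
  proof (rule nn_integral_mono)
    fix t
    have "\<bar>f t\<bar> \<le> norm (grad_fun \<phi> (x + t *\<^sub>R w)) * norm w"
      unfolding f_def grad_fun_inner[OF s, symmetric] by (rule Cauchy_Schwarz_ineq2)
    then have "\<bar>f t\<bar>\<^sup>2 \<le> (norm (grad_fun \<phi> (x + t *\<^sub>R w)) * norm w)\<^sup>2" by (intro power_mono) auto
    then show "ennreal (indicator {0..1} t * (f t)\<^sup>2)
       \<le> indicator {0..1} t * ennreal ((norm w)\<^sup>2 * (norm (grad_fun \<phi> (x + t *\<^sub>R w)))\<^sup>2)"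
      by (auto simp: indicator_def power_mult_distrib mult.commute intro: ennreal_leI)
  qed
  finally show ?thesis by (simp add: d_def)
qed

lemma nn_integral_translate:
  fixes f :: "'a::euclidean_space \<Rightarrow> ennreal"
  assumes "f \<in> borel_measurable borel"
  shows "(\<integral>\<^sup>+x. f (x + v) \<partial>lborel) = (\<integral>\<^sup>+x. f x \<partial>lborel)"
proof -
  have "(\<integral>\<^sup>+x. f x \<partial>lborel) = (\<integral>\<^sup>+x. f x \<partial>distr lborel borel ((+) v))" by (simp add: lborel_distr_plus)
  also have "\<dots> = (\<integral>\<^sup>+x. f (v + x) \<partial>lborel)" by (rule nn_integral_distr) (use assms in auto)
  finally show ?thesis by (simp add: add.commute)
qed

lemma grad_fun_measurable: "smooth_fun \<phi> \<Longrightarrow> grad_fun \<phi> \<in> borel_measurable borel"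
  by (intro borel_measurable_continuous_onI grad_fun_continuous)

text \<open>A shift by the diameter of the ball along one coordinate leaves \<open>U\<close>, so
  \<open>\<phi> x\<close> is minus the increment of \<phi> along that segment. Integrating the line
  estimate over \<open>x\<close> and exchanging the integrals gives the bound by translation
  invariance.\<close>

lemma poincare_test:
  fixes \<phi> :: "'a::euclidean_space \<Rightarrow> real"
  assumes \<phi>: "\<phi> \<in> test_functions U" and U: "U \<subseteq> ball 0 R"
  shows "b_form (tpair \<phi>) (tpair \<phi>) \<le> (2 * R)\<^sup>2 * q_form (tpair \<phi>) (tpair \<phi>)"
proof -
  note s = test_smooth[OF \<phi>]
  note [measurable] = grad_fun_measurable[OF s]
  obtain b0 :: 'a where b0: "b0 \<in> Basis" using nonempty_Basis by blast
  define w where "w = (2 * R) *\<^sub>R b0"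
  have nw: "(norm w)\<^sup>2 = (2 * R)\<^sup>2" using b0 by (simp add: w_def power_mult_distrib)
  define F where "F x t = indicator {0..1} t * ennreal ((norm w)\<^sup>2 * (norm (grad_fun \<phi> (x + t *\<^sub>R w)))\<^sup>2)" for x and t :: real
  have "ennreal ((\<phi> x)\<^sup>2) \<le> (\<integral>\<^sup>+t. F x t \<partial>lborel)" for x
  proof (cases "x \<in> U")
    case True
    have "x + w \<notin> U"
    proof
      assume "x + w \<in> U"
      then have "norm (x + w) < R" "norm x < R" using True U by auto
      moreover have "norm w \<le> norm (x + w) + norm x" using norm_triangle_ineq4[of "x + w" x] by simp
      moreover have "norm w = 2 * \<bar>R\<bar>" using b0 by (simp add: w_def)
      ultimately show False using norm_ge_zero[of x] by linarith
    qed
    then have "\<phi> (x + w) = 0" using test_support[OF \<phi>] fsupport_zero by blast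
    then show ?thesis using line_estimate[OF s, of x w] by (simp add: F_def)
  next
    case False
    then have "\<phi> x = 0" using test_support[OF \<phi>] fsupport_zero by blast
    then show ?thesis by simp
  qed
  then have "(\<integral>\<^sup>+x. ennreal ((\<phi> x)\<^sup>2) \<partial>lborel) \<le> (\<integral>\<^sup>+x. \<integral>\<^sup>+t. F x t \<partial>lborel \<partial>lborel)"
    by (rule nn_integral_mono)
  also have "\<dots> = (\<integral>\<^sup>+t. \<integral>\<^sup>+x. F x t \<partial>lborel \<partial>lborel)"
    by (rule lborel_pair.Fubini'[symmetric]) (unfold F_def, measurable)
  also have "\<dots> = (\<integral>\<^sup>+t. indicator {0..1::real} t * ennreal ((2 * R)\<^sup>2 * q_form (tpair \<phi>) (tpair \<phi>)) \<partial>lborel)"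
  proof (rule nn_integral_cong)
    fix t :: real
    have m: "(\<lambda>x. ennreal ((norm (grad_fun \<phi> (x + t *\<^sub>R w)))\<^sup>2)) \<in> borel_measurable lborel"
      by measurable
    have "(\<integral>\<^sup>+x. F x t \<partial>lborel) = indicator {0..1} t * ennreal ((norm w)\<^sup>2)
        * (\<integral>\<^sup>+x. ennreal ((norm (grad_fun \<phi> (x + t *\<^sub>R w)))\<^sup>2) \<partial>lborel)"
      unfolding F_def ennreal_mult''[OF zero_le_power2] mult.assoc[symmetric]
      by (rule nn_integral_cmult[OF m])
    also have "(\<integral>\<^sup>+x. ennreal ((norm (grad_fun \<phi> (x + t *\<^sub>R w)))\<^sup>2) \<partial>lborel) = ennreal (q_form (tpair \<phi>) (tpair \<phi>))"
      using nn_integral_translate[of "\<lambda>x. ennreal ((norm (grad_fun \<phi> x))\<^sup>2)" "t *\<^sub>R w"]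
      by (simp add: test_nn_integral(2)[OF \<phi>])
    finally show "(\<integral>\<^sup>+x. F x t \<partial>lborel) = indicator {0..1} t * ennreal ((2 * R)\<^sup>2 * q_form (tpair \<phi>) (tpair \<phi>))"
      by (simp add: nw ennreal_mult'' q.nonneg mult.assoc)
  qed
  also have "\<dots> = ennreal ((2 * R)\<^sup>2 * q_form (tpair \<phi>) (tpair \<phi>))"
    by (subst nn_integral_multc) auto
  finally show ?thesis
    unfolding test_nn_integral(1)[OF \<phi>] by (subst (asm) ennreal_le_iff) (auto simp: q.nonneg)
qed

lemma poincare:
  assumes "bounded U"
  obtains C where "0 < C" "\<And>X. X \<in> H1 U \<Longrightarrow> b.nrm X \<le> C * q.nrm X"
proof -
  obtain R where R: "0 < R" "U \<subseteq> ball 0 R" using bounded_subset_ballD[OF assms] by blast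
  have "b.nrm X \<le> (2 * R) * q.nrm X" if X: "X \<in> H1 U" for X
  proof -
    obtain \<phi> where \<phi>: "\<And>n. \<phi> n \<in> test_functions U" and lim: "(\<lambda>n. h.nrm (tpair (\<phi> n) - X)) \<longlonglongrightarrow> 0"
      using H1_approx[OF X] by blast
    have "b_form X X \<le> (2 * R)\<^sup>2 * q_form X X"
    proof (rule LIMSEQ_le)
      show "(\<lambda>n. b_form (tpair (\<phi> n)) (tpair (\<phi> n))) \<longlonglongrightarrow> b_form X X"
        by (rule b.tendsto_form(2)[OF h_tendsto(1)[OF lim]])
      show "(\<lambda>n. (2 * R)\<^sup>2 * q_form (tpair (\<phi> n)) (tpair (\<phi> n))) \<longlonglongrightarrow> (2 * R)\<^sup>2 * q_form X X"
        by (intro tendsto_mult tendsto_const q.tendsto_form(2)[OF h_tendsto(2)[OF lim]])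
    qed (use poincare_test[OF \<phi> R(2)] in auto)
    then show ?thesis using R(1) by (subst b.nrm_le_iff) (auto simp: power_mult_distrib q.nrm_sq q.nrm_nonneg)
  qed
  then show ?thesis using R(1) by (intro that[of "2 * R"]) auto
qed

text \<open>By Poincare's inequality a Cauchy sequence in energy is also Cauchy in
  \<open>L\<^sup>2\<close>. Both components then converge, and the limit pair lies in
  \<open>H1 U\<close> since that set is closed.\<close>

lemma H1_complete:
  fixes X :: "nat \<Rightarrow> 'a::euclidean_space pair_space"
  assumes U: "bounded U" and X: "\<forall>n. X n \<in> H1 U"
    and cauchy: "\<forall>\<epsilon>>0. \<exists>N. \<forall>m\<ge>N. \<forall>n\<ge>N. q.nrm (X m - X n) < \<epsilon>"
  shows "\<exists>l\<in>H1 U. (\<lambda>n. q.nrm (X n - l)) \<longlonglongrightarrow> 0"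
proof -
  obtain C where C: "0 < C" "\<And>X. X \<in> H1 U \<Longrightarrow> b.nrm X \<le> C * q.nrm X" using poincare[OF U] by blast
  have cq: "\<exists>N. \<forall>m\<ge>N. \<forall>n\<ge>N. q_form (X m - X n) (X m - X n) < \<epsilon>" if "\<epsilon> > 0" for \<epsilon>
  proof -
    have "sqrt \<epsilon> > 0" using that by simp
    then obtain N where "\<forall>m\<ge>N. \<forall>n\<ge>N. q.nrm (X m - X n) < sqrt \<epsilon>" using cauchy by blast
    then show ?thesis by (auto simp: q.nrm_def)
  qed
  have cb: "\<exists>N. \<forall>m\<ge>N. \<forall>n\<ge>N. b_form (X m - X n) (X m - X n) < \<epsilon>" if "\<epsilon> > 0" for \<epsilon>
  proof -
    have "sqrt \<epsilon> / C > 0" using that C by simp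
    then obtain N where N: "\<forall>m\<ge>N. \<forall>n\<ge>N. q.nrm (X m - X n) < sqrt \<epsilon> / C" using cauchy by blast
    have "b.nrm (X m - X n) < sqrt \<epsilon>" if "m \<ge> N" "n \<ge> N" for m n
    proof -
      have "b.nrm (X m - X n) \<le> C * q.nrm (X m - X n)"
        using X by (intro C subspace_diff[OF H1_subspace]) auto
      also have "\<dots> < C * (sqrt \<epsilon> / C)" using N that C by (intro mult_strict_left_mono) auto
      finally show ?thesis using C by simp
    qed
    then show ?thesis by (auto simp: b.nrm_def)
  qed
  have "\<exists>u. sq_int u \<and> (\<lambda>n. \<integral>x. (norm (pfun (X n) x - u x))\<^sup>2 \<partial>lebesgue) \<longlonglongrightarrow> 0"
    by (rule sq_int_complete) (use sq_int_pair cb in \<open>simp_all add: sq_diff_forms\<close>)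
  then obtain u where u: "sq_int u" "(\<lambda>n. \<integral>x. (norm (pfun (X n) x - u x))\<^sup>2 \<partial>lebesgue) \<longlonglongrightarrow> 0"
    by blast
  have "\<exists>g. sq_int g \<and> (\<lambda>n. \<integral>x. (norm (pgrad (X n) x - g x))\<^sup>2 \<partial>lebesgue) \<longlonglongrightarrow> 0"
    by (rule sq_int_complete) (use sq_int_pair cq in \<open>simp_all add: sq_diff_forms\<close>)
  then obtain g where g: "sq_int g" "(\<lambda>n. \<integral>x. (norm (pgrad (X n) x - g x))\<^sup>2 \<partial>lebesgue) \<longlonglongrightarrow> 0"
    by blast
  define l where "l = mk_pair u g"
  have l: "pfun l = u" "pgrad l = g" using u g by (auto simp: l_def mk_pair)
  have "(\<lambda>n. sqrt (b_form (X n - l) (X n - l) + q_form (X n - l) (X n - l))) \<longlonglongrightarrow> sqrt (0 + 0)"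
    unfolding sq_diff_forms l using u g by (intro tendsto_intros) auto
  then have lim: "(\<lambda>n. h.nrm (X n - l)) \<longlonglongrightarrow> 0" by (simp add: h.nrm_def)
  have "l \<in> H1 U"
  proof (rule H1_closed)
    fix \<epsilon> :: real assume "\<epsilon> > 0"
    then obtain n where "h.nrm (X n - l) < \<epsilon>"
      using order_tendstoD(2)[OF lim, of \<epsilon>] by (auto simp: eventually_sequentially)
    then show "\<exists>Y\<in>H1 U. h.nrm (Y - l) < \<epsilon>" using X by blast
  qed
  then show ?thesis using h_tendsto(2)[OF lim] by blast
qed

subsection \<open>Rellich's theorem in quantitative form\<close>

lemma nn_integral_affine_le:
  fixes F :: "'a::euclidean_space \<Rightarrow> ennreal"
  assumes F [measurable]: "F \<in> borel_measurable borel" and t: "1/2 \<le> t"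
  shows "(\<integral>\<^sup>+y. F (c + t *\<^sub>R y) \<partial>lborel) \<le> ennreal (2 ^ DIM('a)) * (\<integral>\<^sup>+y. F y \<partial>lborel)"
proof -
  define I where "I = (\<integral>\<^sup>+y. F (c + t *\<^sub>R y) \<partial>lborel)"
  have "(\<integral>\<^sup>+y. F y \<partial>lborel) = (\<integral>\<^sup>+y. F y \<partial>density (distr lborel borel (\<lambda>x. c + t *\<^sub>R x)) (\<lambda>_. ennreal (\<bar>t\<bar> ^ DIM('a))))"
    using lborel_affine[of t c] t by simp
  also have "\<dots> = ennreal (\<bar>t\<bar> ^ DIM('a)) * I"
    by (simp add: nn_integral_density nn_integral_distr nn_integral_cmult I_def)
  finally have eq: "(\<integral>\<^sup>+y. F y \<partial>lborel) = ennreal (\<bar>t\<bar> ^ DIM('a)) * I" .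
  have "1 \<le> (2 * t) ^ DIM('a)" using t by (intro one_le_power) auto
  then have "1 \<le> ennreal (2 ^ DIM('a)) * ennreal (\<bar>t\<bar> ^ DIM('a))"
    using t by (simp add: power_mult_distrib flip: ennreal_mult)
  then have "1 * I \<le> (ennreal (2 ^ DIM('a)) * ennreal (\<bar>t\<bar> ^ DIM('a))) * I" by (intro mult_right_mono) auto
  then show ?thesis by (simp add: eq I_def mult.assoc)
qed

text \<open>
  Inserting the midpoint of \<open>x\<close> and \<open>y\<close> yields segments on which the weight of one end point is at least \<open>1/2\<close>, so the
  affine substitution in that variable costs at most \<open>2\<^sup>d\<close>.
\<close>
lemma double_difference_le:
  fixes \<phi> :: "'a::euclidean_space \<Rightarrow> real"
  assumes s: "smooth_fun \<phi>" and Q [measurable]: "Q \<in> sets borel" and cv: "convex Q"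
    and diam: "\<And>x y. x \<in> Q \<Longrightarrow> y \<in> Q \<Longrightarrow> norm (y - x) \<le> D"
  shows "(\<integral>\<^sup>+x. \<integral>\<^sup>+y. indicator Q x * indicator Q y * ennreal ((\<phi> y - \<phi> x)\<^sup>2) \<partial>lborel \<partial>lborel)
    \<le> ennreal (D\<^sup>2 * 2 ^ DIM('a)) * emeasure lborel Q * (\<integral>\<^sup>+x. indicator Q x * ennreal ((norm (grad_fun \<phi> x))\<^sup>2) \<partial>lborel)"
proof -
  define G where "G x = ennreal ((norm (grad_fun \<phi> x))\<^sup>2)" for x
  define A where "A = (\<integral>\<^sup>+x. indicator Q x * G x \<partial>lborel)"
  have [measurable]: "\<phi> \<in> borel_measurable borel"
    by (intro borel_measurable_continuous_onI smooth_fun_continuous s)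
  have [measurable]: "G \<in> borel_measurable borel"
    unfolding G_def using grad_fun_measurable[OF s] by measurable
  \<comment> \<open>The line estimate for the half segment from the midpoint to \<open>y\<close>:
    the halved length yields \<open>D\<^sup>2 / 4\<close>, and the weight \<open>(1 + t) / 2\<close>
    of \<open>y\<close> is at least \<open>1/2\<close>. Exchanging the arguments covers the other
    half.\<close>
  define S where "S x y = indicator Q x * (\<integral>\<^sup>+t. indicator Q y * (indicator {0..1::real} t *
     (ennreal (D\<^sup>2 / 4) * G (((1 - t) / 2) *\<^sub>R x + ((1 + t) / 2) *\<^sub>R y))) \<partial>lborel)" for x y
  have Sm: "case_prod S \<in> borel_measurable (lborel \<Otimes>\<^sub>M lborel)"
    unfolding S_def by measurable
  have half: "ennreal ((\<phi> y - \<phi> ((1/2) *\<^sub>R (x + y)))\<^sup>2) \<le> S x y" if "x \<in> Q" "y \<in> Q" for x y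
  proof -
    let ?w = "(1/2) *\<^sub>R (y - x)"
    let ?m = "(1/2) *\<^sub>R (x + y)"
    have e1: "?m + ?w = y"
      using scaleR_add_left[of "1/2" "1/2" y] by (simp add: algebra_simps)
    have e2: "?m + t *\<^sub>R ?w = ((1 - t) / 2) *\<^sub>R x + ((1 + t) / 2) *\<^sub>R y" for t
      by (simp add: algebra_simps add_divide_distrib diff_divide_distrib)
    have "(norm ?w)\<^sup>2 \<le> D\<^sup>2 / 4"
      using power_mono[OF diam[OF that], of 2] by (simp add: power_divide)
    then have "(\<integral>\<^sup>+t. indicator {0..1} t * ennreal ((norm ?w)\<^sup>2 * (norm (grad_fun \<phi> (?m + t *\<^sub>R ?w)))\<^sup>2) \<partial>lborel) \<le> S x y"
    proof -
      have "ennreal ((norm ?w)\<^sup>2 * g) \<le> ennreal (D\<^sup>2 / 4) * ennreal g" if "0 \<le> g" for g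
        using \<open>(norm ?w)\<^sup>2 \<le> D\<^sup>2 / 4\<close> that unfolding ennreal_mult''[OF that, symmetric]
        by (intro ennreal_leI mult_right_mono)
      then show ?thesis
        unfolding S_def e2 G_def using that by (auto intro!: nn_integral_mono mult_left_mono)
    qed
    then show ?thesis using line_estimate[OF s, of ?m ?w] unfolding e1 by (rule order_trans[rotated])
  qed
  have pw: "indicator Q x * indicator Q y * ennreal ((\<phi> y - \<phi> x)\<^sup>2) \<le> 2 * S x y + 2 * S y x" for x y
  proof (cases "x \<in> Q \<and> y \<in> Q")
    case True
    let ?m = "(1/2) *\<^sub>R (x + y)"
    have "0 \<le> ((\<phi> y - \<phi> ?m) + (\<phi> x - \<phi> ?m))\<^sup>2" by simp
    then have "(\<phi> y - \<phi> x)\<^sup>2 \<le> 2 * (\<phi> y - \<phi> ?m)\<^sup>2 + 2 * (\<phi> x - \<phi> ?m)\<^sup>2"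
      by (simp add: power2_eq_square algebra_simps)
    then have "ennreal ((\<phi> y - \<phi> x)\<^sup>2) \<le> ennreal (2 * (\<phi> y - \<phi> ?m)\<^sup>2 + 2 * (\<phi> x - \<phi> ?m)\<^sup>2)"
      by (rule ennreal_leI)
    also have "\<dots> = 2 * ennreal ((\<phi> y - \<phi> ?m)\<^sup>2) + 2 * ennreal ((\<phi> x - \<phi> ?m)\<^sup>2)"
      by (simp add: ennreal_plus ennreal_mult)
    also have "\<dots> \<le> 2 * S x y + 2 * S y x"
      using half[of x y] half[of y x] True by (intro add_mono mult_left_mono) (auto simp: add.commute)
    finally show ?thesis using True by simp
  qed auto
  define C where "C = ennreal (D\<^sup>2 / 4) * (ennreal (2 ^ DIM('a)) * A)"
  have Sx: "(\<integral>\<^sup>+y. S x y \<partial>lborel) \<le> indicator Q x * C" for x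
  proof (cases "x \<in> Q")
    case x: True
    have "(\<integral>\<^sup>+y. S x y \<partial>lborel) = (\<integral>\<^sup>+y. \<integral>\<^sup>+t. indicator Q y * (indicator {0..1::real} t *
       (ennreal (D\<^sup>2 / 4) * G (((1 - t) / 2) *\<^sub>R x + ((1 + t) / 2) *\<^sub>R y))) \<partial>lborel \<partial>lborel)"
      using x by (simp add: S_def)
    also have "\<dots> = (\<integral>\<^sup>+t. \<integral>\<^sup>+y. indicator Q y * (indicator {0..1::real} t *
       (ennreal (D\<^sup>2 / 4) * G (((1 - t) / 2) *\<^sub>R x + ((1 + t) / 2) *\<^sub>R y))) \<partial>lborel \<partial>lborel)"
      by (rule lborel_pair.Fubini'[symmetric]) measurable
    also have "\<dots> \<le> (\<integral>\<^sup>+t. indicator {0..1::real} t * C \<partial>lborel)"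
    proof (rule nn_integral_mono)
      fix t :: real
      show "(\<integral>\<^sup>+y. indicator Q y * (indicator {0..1::real} t *
       (ennreal (D\<^sup>2 / 4) * G (((1 - t) / 2) *\<^sub>R x + ((1 + t) / 2) *\<^sub>R y))) \<partial>lborel) \<le> indicator {0..1} t * C"
      proof (cases "t \<in> {0..1}")
        case t: True
        have le: "indicator Q y * G (((1 - t) / 2) *\<^sub>R x + ((1 + t) / 2) *\<^sub>R y)
          \<le> indicator Q (((1 - t) / 2) *\<^sub>R x + ((1 + t) / 2) *\<^sub>R y) * G (((1 - t) / 2) *\<^sub>R x + ((1 + t) / 2) *\<^sub>R y)" for y
        proof (cases "y \<in> Q")
          case True
          have "((1 - t) / 2) *\<^sub>R x + ((1 + t) / 2) *\<^sub>R y \<in> Q"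
            by (rule convexD[OF cv x True]) (use t in \<open>auto simp: field_simps\<close>)
          then show ?thesis using True by simp
        qed simp
        have m: "(\<lambda>y. indicator Q (((1 - t) / 2) *\<^sub>R x + ((1 + t) / 2) *\<^sub>R y) * G (((1 - t) / 2) *\<^sub>R x + ((1 + t) / 2) *\<^sub>R y))
           \<in> borel_measurable lborel" by measurable
        have "(\<integral>\<^sup>+y. indicator Q y * (indicator {0..1::real} t *
            (ennreal (D\<^sup>2 / 4) * G (((1 - t) / 2) *\<^sub>R x + ((1 + t) / 2) *\<^sub>R y))) \<partial>lborel)
          \<le> (\<integral>\<^sup>+y. ennreal (D\<^sup>2 / 4) * (indicator Q (((1 - t) / 2) *\<^sub>R x + ((1 + t) / 2) *\<^sub>R y) *
              G (((1 - t) / 2) *\<^sub>R x + ((1 + t) / 2) *\<^sub>R y)) \<partial>lborel)"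
          using t mult_left_mono[OF le, of "ennreal (D\<^sup>2 / 4)"]
          by (intro nn_integral_mono) (simp add: mult_ac)
        also have "\<dots> = ennreal (D\<^sup>2 / 4) * (\<integral>\<^sup>+y. indicator Q (((1 - t) / 2) *\<^sub>R x + ((1 + t) / 2) *\<^sub>R y) *
              G (((1 - t) / 2) *\<^sub>R x + ((1 + t) / 2) *\<^sub>R y) \<partial>lborel)"
          by (rule nn_integral_cmult[OF m])
        also have "\<dots> \<le> C"
          unfolding C_def A_def using t
          by (intro mult_left_mono nn_integral_affine_le[where F = "\<lambda>z. indicator Q z * G z"]) auto
        finally show ?thesis using t by simp
      qed simp
    qed
    also have "\<dots> = C" by (subst nn_integral_multc) auto
    finally show ?thesis using x by simp
  qed (simp add: S_def)
  have SS: "(\<integral>\<^sup>+x. \<integral>\<^sup>+y. S x y \<partial>lborel \<partial>lborel) \<le> emeasure lborel Q * C"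
  proof -
    have "(\<integral>\<^sup>+x. \<integral>\<^sup>+y. S x y \<partial>lborel \<partial>lborel) \<le> (\<integral>\<^sup>+x. indicator Q x * C \<partial>lborel)"
      by (intro nn_integral_mono Sx)
    also have "\<dots> = emeasure lborel Q * C" by (subst nn_integral_multc) auto
    finally show ?thesis .
  qed
  have m1: "(\<lambda>x. \<integral>\<^sup>+y. S x y \<partial>lborel) \<in> borel_measurable lborel" "(\<lambda>x. \<integral>\<^sup>+y. S y x \<partial>lborel) \<in> borel_measurable lborel"
    using Sm by measurable
  have m2: "(\<lambda>y. S x y) \<in> borel_measurable lborel" "(\<lambda>y. S y x) \<in> borel_measurable lborel" for x
    using Sm by measurable
  have "(\<integral>\<^sup>+x. \<integral>\<^sup>+y. indicator Q x * indicator Q y * ennreal ((\<phi> y - \<phi> x)\<^sup>2) \<partial>lborel \<partial>lborel)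
     \<le> (\<integral>\<^sup>+x. \<integral>\<^sup>+y. 2 * S x y + 2 * S y x \<partial>lborel \<partial>lborel)"
    by (intro nn_integral_mono pw)
  also have "\<dots> = (\<integral>\<^sup>+x. 2 * (\<integral>\<^sup>+y. S x y \<partial>lborel) + 2 * (\<integral>\<^sup>+y. S y x \<partial>lborel) \<partial>lborel)"
    using m2 by (simp add: nn_integral_add nn_integral_cmult)
  also have "\<dots> = 2 * (\<integral>\<^sup>+x. \<integral>\<^sup>+y. S x y \<partial>lborel \<partial>lborel) + 2 * (\<integral>\<^sup>+x. \<integral>\<^sup>+y. S y x \<partial>lborel \<partial>lborel)"
    using m1 by (simp add: nn_integral_add nn_integral_cmult)
  also have "(\<integral>\<^sup>+x. \<integral>\<^sup>+y. S y x \<partial>lborel \<partial>lborel) = (\<integral>\<^sup>+x. \<integral>\<^sup>+y. S x y \<partial>lborel \<partial>lborel)"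
    by (rule lborel_pair.Fubini'[OF Sm])
  also have "2 * (\<integral>\<^sup>+x. \<integral>\<^sup>+y. S x y \<partial>lborel \<partial>lborel) + 2 * (\<integral>\<^sup>+x. \<integral>\<^sup>+y. S x y \<partial>lborel \<partial>lborel)
    \<le> 2 * (emeasure lborel Q * C) + 2 * (emeasure lborel Q * C)"
    by (intro add_mono mult_left_mono SS) auto
  also have "\<dots> = ennreal (D\<^sup>2 * 2 ^ DIM('a)) * emeasure lborel Q * A"
  proof -
    have "2 * (emeasure lborel Q * C) + 2 * (emeasure lborel Q * C) = emeasure lborel Q * ((4 * C))"
      by (simp add: algebra_simps flip: distrib_left mult_2)
    also have "4 * C = (4 * ennreal (D\<^sup>2 / 4)) * ennreal (2 ^ DIM('a)) * A"
      by (simp add: C_def mult.assoc)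
    also have "4 * ennreal (D\<^sup>2 / 4) = ennreal (D\<^sup>2)"
    proof -
      have "ennreal (4 * (D\<^sup>2 / 4)) = ennreal 4 * ennreal (D\<^sup>2 / 4)" by (rule ennreal_mult') simp
      then show ?thesis by simp
    qed
    also have "ennreal (D\<^sup>2) * ennreal (2 ^ DIM('a)) = ennreal (D\<^sup>2 * 2 ^ DIM('a))"
      by (simp add: ennreal_mult)
    finally show ?thesis by (simp add: mult_ac)
  qed
  finally show ?thesis by (simp add: A_def G_def)
qed

text \<open>Expanding the square, the double integral of
  \<open>(\<phi> y - \<phi> x)\<^sup>2\<close> over \<open>Q\<close> in both variables equals
  \<open>2 * a0 * a2 - 2 * a1\<^sup>2\<close>, a multiple of the variance on \<open>Q\<close>. The
  double difference estimate bounds it; dividing by the measure gives the claim.\<close>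

lemma cell_poincare:
  fixes \<phi> :: "'a::euclidean_space \<Rightarrow> real"
  assumes \<phi>: "\<phi> \<in> test_functions U" and Q [measurable]: "Q \<in> sets borel" and cv: "convex Q"
    and diam: "\<And>x y. x \<in> Q \<Longrightarrow> y \<in> Q \<Longrightarrow> norm (y - x) \<le> D"
    and fin: "emeasure lborel Q < \<infinity>" and pos: "0 < measure lborel Q"
  shows "(\<integral>x. indicator Q x * (\<phi> x)\<^sup>2 \<partial>lborel) \<le> (\<integral>x. indicator Q x * \<phi> x \<partial>lborel)\<^sup>2 / measure lborel Q
    + D\<^sup>2 * 2 ^ DIM('a) * (\<integral>x. indicator Q x * (norm (grad_fun \<phi> x))\<^sup>2 \<partial>lborel)"
proof -
  note s = test_smooth[OF \<phi>] and c = test_compact[OF \<phi>]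
  have int: "integrable lborel (\<lambda>x. indicator Q x * f x)"
    if "continuous_on UNIV f" "\<And>x. x \<notin> fsupport \<phi> \<Longrightarrow> f x = 0" for f :: "'a \<Rightarrow> real"
    using integrable_mult_indicator[OF _ compact_support_integrable(2)[OF that(1) c that(2)], of Q] by simp
  have i1: "integrable lborel (\<lambda>x. indicator Q x * \<phi> x)"
    by (rule int) (auto intro: smooth_fun_continuous s fsupport_zero)
  have i2: "integrable lborel (\<lambda>x. indicator Q x * (\<phi> x)\<^sup>2)"
    by (rule int) (auto intro!: continuous_on_power smooth_fun_continuous[OF s] simp: fsupport_zero)
  have i3: "integrable lborel (\<lambda>x. indicator Q x * (norm (grad_fun \<phi> x))\<^sup>2)"
    by (rule int) (auto intro!: continuous_intros grad_fun_continuous s simp: grad_fun_zero)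
  have i0: "integrable lborel (indicator Q :: 'a \<Rightarrow> real)" using fin by (intro integrable_real_indicator) auto
  define a0 a1 a2 where "a0 = measure lborel Q" and "a1 = (\<integral>x. indicator Q x * \<phi> x \<partial>lborel)"
    and "a2 = (\<integral>x. indicator Q x * (\<phi> x)\<^sup>2 \<partial>lborel)"
  define A where "A = (\<integral>x. indicator Q x * (norm (grad_fun \<phi> x))\<^sup>2 \<partial>lborel)"
  have a0: "(\<integral>x. indicator Q x \<partial>lborel) = a0" by (simp add: a0_def)
  have inner: "(\<integral>\<^sup>+y. indicator Q x * indicator Q y * ennreal ((\<phi> y - \<phi> x)\<^sup>2) \<partial>lborel)
     = ennreal (indicator Q x * a2 - 2 * a1 * (indicator Q x * \<phi> x) + a0 * (indicator Q x * (\<phi> x)\<^sup>2))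
     \<and> 0 \<le> indicator Q x * a2 - 2 * a1 * (indicator Q x * \<phi> x) + a0 * (indicator Q x * (\<phi> x)\<^sup>2)" for x
  proof -
    let ?g = "\<lambda>y. indicator Q x * (indicator Q y * (\<phi> y)\<^sup>2 - 2 * \<phi> x * (indicator Q y * \<phi> y) + (\<phi> x)\<^sup>2 * indicator Q y)"
    have g: "?g y = indicator Q x * indicator Q y * (\<phi> y - \<phi> x)\<^sup>2" for y
      by (simp add: power2_diff algebra_simps)
    have ig: "integrable lborel ?g" using i0 i1 i2 by auto
    have v: "(\<integral>y. ?g y \<partial>lborel) = indicator Q x * a2 - 2 * a1 * (indicator Q x * \<phi> x) + a0 * (indicator Q x * (\<phi> x)\<^sup>2)"
    proof -
      have "(\<integral>y. ?g y \<partial>lborel) = indicator Q x * (a2 - 2 * \<phi> x * a1 + (\<phi> x)\<^sup>2 * a0)"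
        using i0 i1 i2 by (simp add: a1_def a2_def flip: a0)
      then show ?thesis by (simp add: algebra_simps)
    qed
    have "(\<integral>\<^sup>+y. indicator Q x * indicator Q y * ennreal ((\<phi> y - \<phi> x)\<^sup>2) \<partial>lborel) = (\<integral>\<^sup>+y. ennreal (?g y) \<partial>lborel)"
      unfolding g by (intro nn_integral_cong) (auto simp: indicator_def)
    also have "\<dots> = ennreal (\<integral>y. ?g y \<partial>lborel)"
      by (rule nn_integral_eq_integral[OF ig]) (auto simp: g)
    finally show ?thesis unfolding v[symmetric] by (auto simp: g intro!: integral_nonneg_AE)
  qed
  let ?h = "\<lambda>x. indicator Q x * a2 - 2 * a1 * (indicator Q x * \<phi> x) + a0 * (indicator Q x * (\<phi> x)\<^sup>2)"
  have "(\<integral>\<^sup>+x. \<integral>\<^sup>+y. indicator Q x * indicator Q y * ennreal ((\<phi> y - \<phi> x)\<^sup>2) \<partial>lborel \<partial>lborel)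
      = (\<integral>\<^sup>+x. ennreal (?h x) \<partial>lborel)"
    using inner by simp
  also have "\<dots> = ennreal (\<integral>x. ?h x \<partial>lborel)"
    by (rule nn_integral_eq_integral) (use i0 i1 i2 inner in auto)
  also have "(\<integral>x. ?h x \<partial>lborel) = 2 * a0 * a2 - 2 * a1\<^sup>2"
    using i0 i1 i2 by (simp add: a0 flip: a1_def a2_def) (simp add: power2_eq_square a0_def)
  finally have J: "(\<integral>\<^sup>+x. \<integral>\<^sup>+y. indicator Q x * indicator Q y * ennreal ((\<phi> y - \<phi> x)\<^sup>2) \<partial>lborel \<partial>lborel)
      = ennreal (2 * a0 * a2 - 2 * a1\<^sup>2)" .
  have "(\<integral>\<^sup>+x. indicator Q x * ennreal ((norm (grad_fun \<phi> x))\<^sup>2) \<partial>lborel)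
      = (\<integral>\<^sup>+x. ennreal (indicator Q x * (norm (grad_fun \<phi> x))\<^sup>2) \<partial>lborel)"
    by (intro nn_integral_cong) (auto simp: indicator_def)
  also have "\<dots> = ennreal A" unfolding A_def by (rule nn_integral_eq_integral[OF i3]) auto
  finally have G: "(\<integral>\<^sup>+x. indicator Q x * ennreal ((norm (grad_fun \<phi> x))\<^sup>2) \<partial>lborel) = ennreal A" .
  have A0: "0 \<le> A" by (auto simp: A_def intro!: integral_nonneg_AE)
  have "emeasure lborel Q = ennreal a0" unfolding a0_def using fin by (intro emeasure_eq_ennreal_measure) auto
  then have "ennreal (2 * a0 * a2 - 2 * a1\<^sup>2) \<le> ennreal (D\<^sup>2 * 2 ^ DIM('a) * a0 * A)"
    using double_difference_le[OF s Q cv diam] pos A0 unfolding J G by (simp add: ennreal_mult a0_def)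
  then have "2 * a0 * a2 - 2 * a1\<^sup>2 \<le> D\<^sup>2 * 2 ^ DIM('a) * a0 * A"
    using pos A0 by (subst (asm) ennreal_le_iff) (auto simp: a0_def)
  moreover have "0 \<le> D\<^sup>2 * 2 ^ DIM('a) * a0 * A" using pos A0 by (simp add: a0_def)
  ultimately have "a0 * a2 \<le> a1\<^sup>2 + D\<^sup>2 * 2 ^ DIM('a) * a0 * A" by linarith
  then have "a2 \<le> a1\<^sup>2 / a0 + D\<^sup>2 * 2 ^ DIM('a) * A" using pos by (simp add: a0_def field_simps)
  then show ?thesis by (simp add: a0_def a1_def a2_def A_def)
qed

section \<open>Partition into small half-open cubes\<close>

definition cell :: "real \<Rightarrow> ('a::euclidean_space \<Rightarrow> int) \<Rightarrow> 'a set" where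
  "cell h k = {x. \<forall>b\<in>Basis. real_of_int (k b) * h \<le> x \<bullet> b \<and> x \<bullet> b < (real_of_int (k b) + 1) * h}"

lemma cell_borel: "cell h k \<in> sets borel"
  unfolding cell_def by measurable

lemma cell_convex: "convex (cell h k)"
proof (rule convexI)
  fix x y :: 'a and u v :: real
  assume *: "x \<in> cell h k" "y \<in> cell h k" "0 \<le> u" "0 \<le> v" "u + v = 1"
  show "u *\<^sub>R x + v *\<^sub>R y \<in> cell h k"
    unfolding cell_def
  proof (intro CollectI ballI)
    fix b :: 'a assume b: "b \<in> Basis"
    have "u * (- (x \<bullet> b)) + v * (- (y \<bullet> b)) \<le> - (real_of_int (k b) * h)"
      by (rule convex_bound_le) (use * b in \<open>auto simp: cell_def\<close>)
    moreover have "u * (x \<bullet> b) + v * (y \<bullet> b) < (real_of_int (k b) + 1) * h"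
      by (rule convex_bound_lt) (use * b in \<open>auto simp: cell_def\<close>)
    ultimately show "real_of_int (k b) * h \<le> (u *\<^sub>R x + v *\<^sub>R y) \<bullet> b \<and> (u *\<^sub>R x + v *\<^sub>R y) \<bullet> b < (real_of_int (k b) + 1) * h"
      by (simp add: inner_simps)
  qed
qed

lemma cell_diameter:
  fixes x y :: "'a::euclidean_space" and h :: real
  assumes "x \<in> cell h k" "y \<in> cell h k"
  shows "norm (y - x) \<le> DIM('a) * h"
proof -
  have "norm (y - x) \<le> (\<Sum>b\<in>Basis. \<bar>(y - x) \<bullet> b\<bar>)" by (rule norm_le_l1)
  also have "\<dots> \<le> (\<Sum>b\<in>(Basis::'a set). h)"
  proof (rule sum_mono)
    fix b :: 'a assume "b \<in> Basis"
    then have "real_of_int (k b) * h \<le> x \<bullet> b" "x \<bullet> b < real_of_int (k b) * h + h"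
      "real_of_int (k b) * h \<le> y \<bullet> b" "y \<bullet> b < real_of_int (k b) * h + h"
      using assms by (auto simp: cell_def algebra_simps)
    then show "\<bar>(y - x) \<bullet> b\<bar> \<le> h" unfolding inner_diff_left by linarith
  qed
  finally show ?thesis by simp
qed

lemma cell_measure:
  assumes "0 < h"
  shows "emeasure lborel (cell h k) < \<infinity>" "0 < measure lborel (cell h k)"
proof -
  define l u where "l = (\<Sum>b\<in>Basis. (real_of_int (k b) * h) *\<^sub>R (b :: 'a))"
    and "u = (\<Sum>b\<in>Basis. ((real_of_int (k b) + 1) * h) *\<^sub>R (b :: 'a))"
  have lu: "l \<bullet> b = real_of_int (k b) * h" "u \<bullet> b = (real_of_int (k b) + 1) * h" if "b \<in> Basis" for b
    using that by (simp_all add: l_def u_def)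
  have sub: "box l u \<subseteq> cell h k" "cell h k \<subseteq> cbox l u"
    by (auto simp: cell_def mem_box lu less_imp_le)
  have "emeasure lborel (cell h k) \<le> emeasure lborel (cbox l u)"
    using sub by (intro emeasure_mono) auto
  also have "\<dots> < \<infinity>" using emeasure_bounded_finite[OF bounded_cbox] by blast
  finally show fin: "emeasure lborel (cell h k) < \<infinity>" .
  have "0 < (\<Prod>b\<in>(Basis :: 'a set). h)" using assms by (intro prod_pos) auto
  also have "(\<Prod>b\<in>(Basis :: 'a set). h) = measure lborel (box l u)"
    using assms by (subst measure_lborel_box) (auto simp: lu inner_diff_left algebra_simps)
  also have "\<dots> \<le> measure lborel (cell h k)"
    using sub fin cell_borel[of h k] by (intro measure_mono_fmeasurable) (auto simp: fmeasurable_def)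
  finally show "0 < measure lborel (cell h k)" .
qed

text \<open>Half-open cells are disjoint without null-set arguments: a point lies only in the cell
  indexed by the floors of its scaled coordinates. The index range contains all floors that occur in
  the ball of radius \<open>R\<close>.\<close>

lemma cell_partition:
  fixes x :: "'a::euclidean_space"
  assumes "0 < h" "norm x < R"
  defines "I \<equiv> PiE (Basis :: 'a set) (\<lambda>_. {- \<lceil>R / h\<rceil> - 1 .. \<lceil>R / h\<rceil> + 1})"
  shows "(\<Sum>k\<in>I. indicator (cell h k) x) = (1 :: real)"
proof -
  have fin: "finite I" unfolding I_def by (intro finite_PiE) auto
  define k0 where "k0 = restrict (\<lambda>b. \<lfloor>x \<bullet> b / h\<rfloor>) (Basis :: 'a set)"
  have "k0 \<in> I"
    unfolding I_def k0_def
  proof (rule restrict_PiE_iff[THEN iffD2], rule ballI)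
    fix b :: 'a assume "b \<in> Basis"
    then have "\<bar>x \<bullet> b\<bar> < R" using Basis_le_norm[of b x] assms(2) by simp
    then have y: "x \<bullet> b / h < R / h" "- (R / h) < x \<bullet> b / h"
      using assms(1) by (auto simp: field_simps abs_less_iff)
    define c where "c = \<lceil>R / h\<rceil>"
    have c: "R / h \<le> real_of_int c" by (simp add: c_def)
    have "real_of_int (- c - 1) \<le> x \<bullet> b / h" "x \<bullet> b / h < real_of_int (c + 1) + 1"
      using y c unfolding of_int_diff of_int_add of_int_minus of_int_1 by linarith+
    then show "\<lfloor>x \<bullet> b / h\<rfloor> \<in> {- \<lceil>R / h\<rceil> - 1 .. \<lceil>R / h\<rceil> + 1}"
      unfolding atLeastAtMost_iff c_def[symmetric] le_floor_iff floor_le_iff by blast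
  qed
  have "x \<in> cell h k \<longleftrightarrow> k = k0" if "k \<in> I" for k
  proof -
    have "x \<in> cell h k \<longleftrightarrow> (\<forall>b\<in>Basis. \<lfloor>x \<bullet> b / h\<rfloor> = k b)"
      using assms(1) by (auto simp: cell_def floor_eq_iff field_simps)
    also have "\<dots> \<longleftrightarrow> k = k0"
      using that unfolding I_def k0_def by (auto simp: fun_eq_iff PiE_iff extensional_def restrict_def)
    finally show ?thesis .
  qed
  then have "(\<Sum>k\<in>I. indicator (cell h k) x) = (\<Sum>k\<in>I. if k = k0 then 1 else (0 :: real))"
    by (intro sum.cong) (auto simp: indicator_def)
  then show ?thesis using fin \<open>k0 \<in> I\<close> by simp
qed


lemma sq_int_indicator_cell: "0 < h \<Longrightarrow> sq_int (\<lambda>x. indicator (cell h k) x / r :: real)"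
proof -
  assume h: "0 < h"
  have m: "cell h k \<in> sets lebesgue" using cell_borel[of h k] by (simp add: sets_completionI_sets)
  have "(\<lambda>x. (norm (indicator (cell h k) x / r :: real))\<^sup>2) = (\<lambda>x. indicator (cell h k) x / r\<^sup>2)"
    by (auto simp: fun_eq_iff indicator_def power_divide)
  moreover have "integrable lebesgue (\<lambda>x. indicator (cell h k) x / r\<^sup>2 :: real)"
    using m cell_measure(1)[OF h, of k] cell_borel[of h k]
    by (intro integrable_divide integrable_real_indicator) auto
  moreover have "(\<lambda>x. indicator (cell h k) x / r :: real) \<in> borel_measurable lebesgue"
    using m by (intro borel_measurable_divide borel_measurable_indicator) auto
  ultimately show ?thesis by (simp add: sq_int_def)
qed

text \<open>Summing the cell inequalities splits the \<open>L\<^sup>2\<close> norm into cell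
  averages, a finite-rank part, and an energy term that is small with the mesh. The averages become
  pairings with indicators divided by the root of the cell measure; the zero second component of
  these pairs is invisible to \<open>b_form\<close>.\<close>

lemma rellich_test:
  fixes \<phi> :: "'a::euclidean_space \<Rightarrow> real" and h :: real
  assumes \<phi>: "\<phi> \<in> test_functions U" and U: "U \<subseteq> ball 0 R" and h: "0 < h"
  defines "I \<equiv> PiE (Basis :: 'a set) (\<lambda>_. {- \<lceil>R / h\<rceil> - 1 .. \<lceil>R / h\<rceil> + 1})"
  shows "b_form (tpair \<phi>) (tpair \<phi>) \<le> (DIM('a) * h)\<^sup>2 * 2 ^ DIM('a) * q_form (tpair \<phi>) (tpair \<phi>) +
    (\<Sum>k\<in>I. (b_form (tpair \<phi>) (mk_pair (\<lambda>x. indicator (cell h k) x / sqrt (measure lborel (cell h k))) (\<lambda>_. 0)))\<^sup>2)"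
proof -
  note s = test_smooth[OF \<phi>] and c = test_compact[OF \<phi>]
  have part: "(\<Sum>k\<in>I. indicator (cell h k) x * f x) = f x" if "\<And>x. x \<notin> fsupport \<phi> \<Longrightarrow> f x = 0" for x and f :: "'a \<Rightarrow> real"
  proof (cases "x \<in> U")
    case True
    then show ?thesis using U cell_partition[OF h, of x R] by (auto simp: I_def simp flip: sum_distrib_right)
  next
    case False
    then have "f x = 0" using test_support[OF \<phi>] that by blast
    then show ?thesis by simp
  qed
  have int: "integrable lborel f" "integrable lborel (\<lambda>x. indicator (cell h k) x * f x)" "f \<in> borel_measurable borel"
    if "continuous_on UNIV f" "\<And>x. x \<notin> fsupport \<phi> \<Longrightarrow> f x = 0" for f :: "'a \<Rightarrow> real" and k
    using compact_support_integrable[OF that(1) c that(2)]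
      integrable_mult_indicator[OF _ compact_support_integrable(2)[OF that(1) c that(2)], of "cell h k"] cell_borel[of h k]
    by auto
  have parti: "(\<Sum>k\<in>I. \<integral>x. indicator (cell h k) x * f x \<partial>lborel) = (\<integral>x. f x \<partial>lebesgue)"
    if "continuous_on UNIV f" "\<And>x. x \<notin> fsupport \<phi> \<Longrightarrow> f x = 0" for f :: "'a \<Rightarrow> real"
  proof -
    have "(\<Sum>k\<in>I. \<integral>x. indicator (cell h k) x * f x \<partial>lborel) = (\<integral>x. (\<Sum>k\<in>I. indicator (cell h k) x * f x) \<partial>lborel)"
      by (rule Bochner_Integration.integral_sum[symmetric]) (rule int(2)[OF that])
    also have "\<dots> = (\<integral>x. f x \<partial>lborel)" by (intro Bochner_Integration.integral_cong refl part that)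
    also have "\<dots> = (\<integral>x. f x \<partial>lebesgue)" using int(3)[OF that] by (simp add: integral_completion)
    finally show ?thesis .
  qed
  have c2: "continuous_on UNIV (\<lambda>x. (\<phi> x)\<^sup>2)" "continuous_on UNIV (\<lambda>x. (norm (grad_fun \<phi> x))\<^sup>2)"
    by (intro continuous_intros smooth_fun_continuous[OF s] grad_fun_continuous[OF s])+
  have "b_form (tpair \<phi>) (tpair \<phi>) = (\<Sum>k\<in>I. \<integral>x. indicator (cell h k) x * (\<phi> x)\<^sup>2 \<partial>lborel)"
    by (subst parti[OF c2(1)]) (simp_all add: fsupport_zero b_form_def tpair[OF \<phi>] power2_eq_square)
  also have "\<dots> \<le> (\<Sum>k\<in>I. (\<integral>x. indicator (cell h k) x * \<phi> x \<partial>lborel)\<^sup>2 / measure lborel (cell h k)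
    + (DIM('a) * h)\<^sup>2 * 2 ^ DIM('a) * (\<integral>x. indicator (cell h k) x * (norm (grad_fun \<phi> x))\<^sup>2 \<partial>lborel))"
    by (intro sum_mono cell_poincare[OF \<phi> cell_borel cell_convex cell_diameter cell_measure[OF h]])
  also have "\<dots> = (\<Sum>k\<in>I. (\<integral>x. indicator (cell h k) x * \<phi> x \<partial>lborel)\<^sup>2 / measure lborel (cell h k))
    + (DIM('a) * h)\<^sup>2 * 2 ^ DIM('a) * q_form (tpair \<phi>) (tpair \<phi>)"
    unfolding sum.distrib sum_distrib_left[symmetric]
    by (subst parti[OF c2(2)]) (simp_all add: grad_fun_zero q_form_def tpair[OF \<phi>] dot_square_norm)
  also have "(\<Sum>k\<in>I. (\<integral>x. indicator (cell h k) x * \<phi> x \<partial>lborel)\<^sup>2 / measure lborel (cell h k))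
    = (\<Sum>k\<in>I. (b_form (tpair \<phi>) (mk_pair (\<lambda>x. indicator (cell h k) x / sqrt (measure lborel (cell h k))) (\<lambda>_. 0)))\<^sup>2)"
  proof (intro sum.cong refl)
    fix k
    have "b_form (tpair \<phi>) (mk_pair (\<lambda>x. indicator (cell h k) x / sqrt (measure lborel (cell h k))) (\<lambda>_. 0))
      = (\<integral>x. indicator (cell h k) x * \<phi> x / sqrt (measure lborel (cell h k)) \<partial>lebesgue)"
      by (simp add: b_form_def tpair[OF \<phi>] mk_pair[OF sq_int_indicator_cell[OF h] sq_int_zero] mult.commute)
    also have "\<dots> = (\<integral>x. indicator (cell h k) x * \<phi> x \<partial>lborel) / sqrt (measure lborel (cell h k))"
      using int(2)[OF smooth_fun_continuous[OF s] fsupport_zero[of _ \<phi>], THEN borel_measurable_integrable]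
      by (simp add: integral_completion)
    finally show "(\<integral>x. indicator (cell h k) x * \<phi> x \<partial>lborel)\<^sup>2 / measure lborel (cell h k)
      = (b_form (tpair \<phi>) (mk_pair (\<lambda>x. indicator (cell h k) x / sqrt (measure lborel (cell h k))) (\<lambda>_. 0)))\<^sup>2"
      by (simp add: power_divide)
  qed
  finally show ?thesis by simp
qed

text \<open>Compactness of the embedding as an inequality: outside finitely many
  \<open>L\<^sup>2\<close> functionals the energy dominates with an arbitrarily small constant. No
  weak convergence has to be set up.\<close>

lemma rellich:
  fixes U :: "'a::euclidean_space set"
  assumes "bounded U" "0 < \<delta>"
  shows "\<exists>(I :: ('a \<Rightarrow> int) set) Y. finite I \<and>
    (\<forall>X\<in>H1 U. b_form X X \<le> \<delta> * q_form X X + (\<Sum>k\<in>I. (b_form X (Y k))\<^sup>2))"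
proof -
  obtain R where R: "0 < R" "U \<subseteq> ball 0 R" using bounded_subset_ballD[OF assms(1)] by blast
  \<comment> \<open>The mesh for which the factor \<open>(DIM('a) * h)\<^sup>2 * 2 ^ DIM('a)\<close>
    equals \<delta>.\<close>
  define h where "h = sqrt (\<delta> / 2 ^ DIM('a)) / DIM('a)"
  have h: "0 < h" using assms(2) by (simp add: h_def)
  have hd: "(DIM('a) * h)\<^sup>2 * 2 ^ DIM('a) = \<delta>" using assms(2) by (simp add: h_def)
  define I where "I = PiE (Basis :: 'a set) (\<lambda>_. {- \<lceil>R / h\<rceil> - 1 .. \<lceil>R / h\<rceil> + 1})"
  define Y where "Y k = mk_pair (\<lambda>x. indicator (cell h k) x / sqrt (measure lborel (cell h k))) (\<lambda>_. 0 :: 'a)" for k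
  show ?thesis
  proof (intro exI[of _ I] exI[of _ Y] conjI ballI)
    show "finite I" unfolding I_def by (intro finite_PiE) auto
    fix X assume "X \<in> H1 U"
    then obtain \<phi> where \<phi>: "\<And>n. \<phi> n \<in> test_functions U" and lim: "(\<lambda>n. h.nrm (tpair (\<phi> n) - X)) \<longlonglongrightarrow> 0"
      using H1_approx by blast
    show "b_form X X \<le> \<delta> * q_form X X + (\<Sum>k\<in>I. (b_form X (Y k))\<^sup>2)"
    proof (rule LIMSEQ_le)
      show "(\<lambda>n. b_form (tpair (\<phi> n)) (tpair (\<phi> n))) \<longlonglongrightarrow> b_form X X"
        by (rule b.tendsto_form(2)[OF h_tendsto(1)[OF lim]])
      show "(\<lambda>n. \<delta> * q_form (tpair (\<phi> n)) (tpair (\<phi> n)) + (\<Sum>k\<in>I. (b_form (tpair (\<phi> n)) (Y k))\<^sup>2))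
          \<longlonglongrightarrow> \<delta> * q_form X X + (\<Sum>k\<in>I. (b_form X (Y k))\<^sup>2)"
        by (intro tendsto_intros q.tendsto_form(2)[OF h_tendsto(2)[OF lim]] b.tendsto_form(1)[OF h_tendsto(1)[OF lim]])
      show "\<exists>N. \<forall>n\<ge>N. b_form (tpair (\<phi> n)) (tpair (\<phi> n))
          \<le> \<delta> * q_form (tpair (\<phi> n)) (tpair (\<phi> n)) + (\<Sum>k\<in>I. (b_form (tpair (\<phi> n)) (Y k))\<^sup>2)"
        using rellich_test[OF \<phi> R(2) h] unfolding hd I_def[symmetric] Y_def[symmetric] by blast
    qed
  qed
qed

subsection \<open>Sets of zero capacity\<close>

definition mul_pair :: "('a::euclidean_space \<Rightarrow> real) \<Rightarrow> 'a pair_space \<Rightarrow> 'a pair_space" where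
  "mul_pair \<phi> X = mk_pair (\<lambda>x. \<phi> x * pfun X x) (\<lambda>x. \<phi> x *\<^sub>R pgrad X x + pfun X x *\<^sub>R grad_fun \<phi> x)"

lemma mul_pair_bounded:
  fixes \<phi> :: "'a::euclidean_space \<Rightarrow> real"
  assumes \<phi>: "\<phi> \<in> test_functions U"
  shows "pfun (mul_pair \<phi> X) = (\<lambda>x. \<phi> x * pfun X x)"
    and "pgrad (mul_pair \<phi> X) = (\<lambda>x. \<phi> x *\<^sub>R pgrad X x + pfun X x *\<^sub>R grad_fun \<phi> x)"
    and "\<exists>C. \<forall>X. h.nrm (mul_pair \<phi> X) \<le> C * h.nrm X"
proof -
  note s = test_smooth[OF \<phi>] and c = test_compact[OF \<phi>]
  obtain C1 where C1: "0 \<le> C1" "\<And>x. norm (\<phi> x) \<le> C1"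
    using compact_support_bounded[OF smooth_fun_continuous[OF s] c fsupport_zero[of _ \<phi>]] by metis
  obtain C2 where C2: "0 \<le> C2" "\<And>x. norm (grad_fun \<phi> x) \<le> C2"
    using compact_support_bounded[OF grad_fun_continuous[OF s] c grad_fun_zero[of _ \<phi>]] by metis
  note m = sq_int_measurable[OF sq_int_pair(1)] sq_int_measurable[OF sq_int_pair(2)]
    sq_int_measurable[OF test_sq_int(1)[OF \<phi>]] sq_int_measurable[OF test_sq_int(2)[OF \<phi>]]
  have p: "sq_int (\<lambda>x. \<phi> x * pfun X x)" for X
    by (rule sq_int_dominated[OF sq_int_pair(1)[of X] sq_int_pair(1)[of X], where C = C1])
      (use C1 in \<open>auto simp: abs_mult intro!: borel_measurable_times m
        intro: mult_mono\<close>)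
  have g1: "sq_int (\<lambda>x. \<phi> x *\<^sub>R pgrad X x)" for X
    by (rule sq_int_dominated[OF sq_int_pair(2)[of X] sq_int_pair(2)[of X], where C = C1])
      (use C1 in \<open>auto intro!: borel_measurable_scaleR m
        intro: mult_mono\<close>)
  have g2: "sq_int (\<lambda>x. pfun X x *\<^sub>R grad_fun \<phi> x)" for X
  proof (rule sq_int_dominated[OF sq_int_pair(1)[of X] sq_int_pair(1)[of X], where C = C2])
    show "norm (pfun X x *\<^sub>R grad_fun \<phi> x) \<le> C2 * (norm (pfun X x) + norm (pfun X x))" for x
      using mult_left_mono[OF C2(2)[of x], of "\<bar>pfun X x\<bar>"] mult_nonneg_nonneg[OF C2(1), of "\<bar>pfun X x\<bar>"]
      by (simp add: algebra_simps)
  qed (use C2 in \<open>auto intro!: borel_measurable_scaleR m\<close>)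
  have 1: "pfun (mul_pair \<phi> X) = (\<lambda>x. \<phi> x * pfun X x)" for X
    unfolding mul_pair_def by (rule mk_pair[OF p sq_int_add[OF g1 g2]])
  have 2: "pgrad (mul_pair \<phi> X) = (\<lambda>x. \<phi> x *\<^sub>R pgrad X x + pfun X x *\<^sub>R grad_fun \<phi> x)" for X
    unfolding mul_pair_def by (rule mk_pair[OF p sq_int_add[OF g1 g2]])
  show "pfun (mul_pair \<phi> X) = (\<lambda>x. \<phi> x * pfun X x)" by (rule 1)
  show "pgrad (mul_pair \<phi> X) = (\<lambda>x. \<phi> x *\<^sub>R pgrad X x + pfun X x *\<^sub>R grad_fun \<phi> x)" by (rule 2)
  have sqb: "integrable lebesgue (\<lambda>x. (pfun X x)\<^sup>2)" "integrable lebesgue (\<lambda>x. (norm (pgrad X x))\<^sup>2)" for X :: "'a pair_space"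
    using sq_int_pair[of X] by (auto simp: sq_int_def)
  have bq: "b_form X X = (\<integral>x. (pfun X x)\<^sup>2 \<partial>lebesgue)" "q_form X X = (\<integral>x. (norm (pgrad X x))\<^sup>2 \<partial>lebesgue)" for X :: "'a pair_space"
    by (simp_all add: b_form_def q_form_def power2_eq_square dot_square_norm)
  define C where "C = C1\<^sup>2 + 2 * C1\<^sup>2 + 2 * C2\<^sup>2"
  have "b_form (mul_pair \<phi> X) (mul_pair \<phi> X) + q_form (mul_pair \<phi> X) (mul_pair \<phi> X) \<le> C * (b_form X X + q_form X X)" for X
  proof -
    have "b_form (mul_pair \<phi> X) (mul_pair \<phi> X) \<le> (\<integral>x. C1\<^sup>2 * (pfun X x)\<^sup>2 \<partial>lebesgue)"
      unfolding bq
    proof (rule integral_mono[OF sqb(1)])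
      show "(pfun (mul_pair \<phi> X) x)\<^sup>2 \<le> C1\<^sup>2 * (pfun X x)\<^sup>2" for x
        using power_mono[OF C1(2)[of x], of 2] by (simp add: 1 power_mult_distrib mult_right_mono)
    qed (use sqb in auto)
    also have "\<dots> = C1\<^sup>2 * b_form X X" by (simp add: bq)
    finally have b: "b_form (mul_pair \<phi> X) (mul_pair \<phi> X) \<le> C1\<^sup>2 * b_form X X" .
    have "q_form (mul_pair \<phi> X) (mul_pair \<phi> X)
      \<le> (\<integral>x. 2 * C1\<^sup>2 * (norm (pgrad X x))\<^sup>2 + 2 * C2\<^sup>2 * (pfun X x)\<^sup>2 \<partial>lebesgue)"
      unfolding bq
    proof (rule integral_mono[OF sqb(2)])
      fix x
      have "norm (pgrad (mul_pair \<phi> X) x) \<le> C1 * norm (pgrad X x) + C2 * \<bar>pfun X x\<bar>"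
      proof -
        have "norm (pgrad (mul_pair \<phi> X) x) \<le> \<bar>\<phi> x\<bar> * norm (pgrad X x) + \<bar>pfun X x\<bar> * norm (grad_fun \<phi> x)"
          unfolding 2 using norm_triangle_ineq[of "\<phi> x *\<^sub>R pgrad X x" "pfun X x *\<^sub>R grad_fun \<phi> x"] by simp
        also have "\<dots> \<le> C1 * norm (pgrad X x) + \<bar>pfun X x\<bar> * C2"
          using C1(2)[of x] C2(2)[of x] by (intro add_mono mult_right_mono mult_left_mono) auto
        finally show ?thesis by (simp add: mult.commute)
      qed
      then have "(norm (pgrad (mul_pair \<phi> X) x))\<^sup>2 \<le> (C1 * norm (pgrad X x) + C2 * \<bar>pfun X x\<bar>)\<^sup>2"
        by (intro power_mono) auto
      also have "\<dots> \<le> 2 * (C1 * norm (pgrad X x))\<^sup>2 + 2 * (C2 * \<bar>pfun X x\<bar>)\<^sup>2"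
        using sum_squares_bound[of "C1 * norm (pgrad X x)" "C2 * \<bar>pfun X x\<bar>"] unfolding power2_sum by linarith
      finally show "(norm (pgrad (mul_pair \<phi> X) x))\<^sup>2 \<le> 2 * C1\<^sup>2 * (norm (pgrad X x))\<^sup>2 + 2 * C2\<^sup>2 * (pfun X x)\<^sup>2"
        by (simp add: power_mult_distrib)
    qed (use sqb in auto)
    also have "\<dots> = 2 * C1\<^sup>2 * q_form X X + 2 * C2\<^sup>2 * b_form X X" using sqb by (simp add: bq)
    finally have "b_form (mul_pair \<phi> X) (mul_pair \<phi> X) + q_form (mul_pair \<phi> X) (mul_pair \<phi> X)
      \<le> (C1\<^sup>2 + 2 * C2\<^sup>2) * b_form X X + 2 * C1\<^sup>2 * q_form X X" using b by (simp add: algebra_simps)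
    also have "\<dots> \<le> C * b_form X X + C * q_form X X"
      by (intro add_mono mult_right_mono b.nonneg q.nonneg) (auto simp: C_def)
    finally show ?thesis by (simp add: algebra_simps)
  qed
  then have "h.nrm (mul_pair \<phi> X) \<le> sqrt C * h.nrm X" for X
    unfolding h.nrm_def real_sqrt_mult[symmetric] by (rule real_sqrt_le_mono)
  then show "\<exists>C. \<forall>X. h.nrm (mul_pair \<phi> X) \<le> C * h.nrm X" by blast
qed

lemma mul_pair_diff: "\<phi> \<in> test_functions U \<Longrightarrow> mul_pair \<phi> (X - Y) = mul_pair \<phi> X - mul_pair \<phi> Y"
  by (rule pair_eqI) (auto simp: mul_pair_bounded pair_ops algebra_simps)

lemma mul_pair_tpair:
  assumes "\<phi> \<in> test_functions U" "\<psi> \<in> test_functions V"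
  shows "mul_pair \<phi> (tpair \<psi>) = tpair (\<lambda>x. \<phi> x * \<psi> x)"
proof -
  have "(\<lambda>x. \<phi> x * \<psi> x) \<in> test_functions V" by (rule test_ops(3)[OF assms(2) test_smooth[OF assms(1)]])
  then show ?thesis
    by (intro pair_eqI) (auto simp: mul_pair_bounded[OF assms(1)] tpair[OF assms(2)] tpair
        grad_fun_ops(2)[OF test_smooth[OF assms(1)] test_smooth[OF assms(2)]])
qed

text \<open>Multiplication by \<phi> is bounded in the \<open>H\<^sup>1\<close> norm and preserves
  the test functions on \<open>V\<close>, hence also their closure.\<close>

lemma mul_pair_H1:
  assumes \<phi>: "\<phi> \<in> test_functions U" and X: "X \<in> H1 V"
  shows "mul_pair \<phi> X \<in> H1 V"
proof (rule H1_closed)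
  fix \<epsilon> :: real assume \<epsilon>: "\<epsilon> > 0"
  obtain C where C: "\<And>X. h.nrm (mul_pair \<phi> X) \<le> C * h.nrm X" using mul_pair_bounded(3)[OF \<phi>] by blast
  have "\<epsilon> / (\<bar>C\<bar> + 1) > 0" using \<epsilon> by simp
  then obtain \<psi> where \<psi>: "\<psi> \<in> test_functions V" "h.nrm (tpair \<psi> - X) < \<epsilon> / (\<bar>C\<bar> + 1)"
    using X unfolding H1_def by blast
  have "h.nrm (mul_pair \<phi> (tpair \<psi>) - mul_pair \<phi> X) \<le> C * h.nrm (tpair \<psi> - X)"
    using C[of "tpair \<psi> - X"] by (simp add: mul_pair_diff[OF \<phi>])
  also have "\<dots> \<le> (\<bar>C\<bar> + 1) * h.nrm (tpair \<psi> - X)" by (intro mult_right_mono h.nrm_nonneg) auto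
  also have "\<dots> < \<epsilon>" using \<psi>(2) by (simp add: field_simps)
  finally show "\<exists>Y\<in>H1 V. h.nrm (Y - mul_pair \<phi> X) < \<epsilon>"
    using tpair_H1[OF test_ops(3)[OF \<psi>(1) test_smooth[OF \<phi>]]] mul_pair_tpair[OF \<phi> \<psi>(1)] by metis
qed

text \<open>
  If \<open>f\<^sub>n - \<eta> \<in> H\<^sup>1\<^sub>0(\<Omega> - K)\<close> and the energy of \<open>f\<^sub>n\<close> tends to zero, then a test function \<open>\<phi>\<close> is the limit of
  \<open>\<phi> - \<phi> f\<^sub>n = \<phi> (1 - \<eta>) - \<phi> (f\<^sub>n - \<eta>)\<close>.
\<close>
lemma H1_zero_capacity:
  fixes \<Omega> K :: "'a::euclidean_space set"
  assumes \<Omega>: "bounded \<Omega>" "open \<Omega>" and K: "compact K" "K \<subseteq> \<Omega>" and cap: "capacity \<Omega> K = 0"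
  shows "H1 \<Omega> \<subseteq> H1 (\<Omega> - K)"
proof
  define \<eta> where "\<eta> = (SOME \<eta>. \<eta> \<in> test_functions \<Omega> \<and> (\<exists>W. open W \<and> K \<subseteq> W \<and> (\<forall>x\<in>W. \<eta> x = 1)))"
  have "\<eta> \<in> test_functions \<Omega> \<and> (\<exists>W. open W \<and> K \<subseteq> W \<and> (\<forall>x\<in>W. \<eta> x = 1))"
    unfolding \<eta>_def by (rule someI_ex[OF cutoff_exists[OF K \<Omega>(2)]])
  then obtain W where \<eta>: "\<eta> \<in> test_functions \<Omega>" and W: "open W" "K \<subseteq> W" "\<And>x. x \<in> W \<Longrightarrow> \<eta> x = 1" by blast
  obtain P where P: "0 < P" "\<And>X. X \<in> H1 \<Omega> \<Longrightarrow> b.nrm X \<le> P * q.nrm X" using poincare[OF \<Omega>(1)] by blast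
  let ?S = "{energy f | f. f \<in> H10 \<Omega> \<and> (\<lambda>x. f x - \<eta> x) \<in> H10 (\<Omega> - K)}"
  have inf: "Inf ?S = 0" using cap by (simp add: capacity_def u_capacity_def \<eta>_def)
  have small: "\<exists>X\<in>H1 \<Omega>. X - tpair \<eta> \<in> H1 (\<Omega> - K) \<and> q_form X X < \<epsilon>" if "\<epsilon> > 0" for \<epsilon>
  proof -
    \<comment> \<open>\<eta> itself is a competitor. The infimum is thus over a nonempty set, and
      its value zero provides competitors of arbitrarily small energy.\<close>
    have "(\<lambda>x. \<eta> x - \<eta> x) \<in> H10 (\<Omega> - K)"
      unfolding H10_iff using subspace_0[OF H1_subspace] by (auto simp: pair_ops intro!: bexI[of _ 0])
    moreover have "\<eta> \<in> H10 \<Omega>" unfolding H10_iff using tpair_H1[OF \<eta>] tpair(1)[OF \<eta>] by blast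
    ultimately have ne: "?S \<noteq> {}" by blast
    have "Inf ?S < \<epsilon>" using inf that by (simp only:)
    from cInf_lessD[OF ne this] obtain e where "e \<in> ?S" "e < \<epsilon>" by blast
    then obtain f where f: "f \<in> H10 \<Omega>" "(\<lambda>x. f x - \<eta> x) \<in> H10 (\<Omega> - K)" "energy f < \<epsilon>"
      by blast
    obtain X where X: "X \<in> H1 \<Omega>" "pfun X = f" using f(1) H10_iff by blast
    obtain Y where Y: "Y \<in> H1 (\<Omega> - K)" "pfun Y = (\<lambda>x. f x - \<eta> x)" using f(2) H10_iff by blast
    have "X - tpair \<eta> \<in> H1 \<Omega>" by (intro subspace_diff[OF H1_subspace] X tpair_H1 \<eta>)
    then have "h.nrm (Y - (X - tpair \<eta>)) = 0"
      by (rule H1_same_fun[OF Y(1)]) (simp add: pair_ops X Y tpair(1)[OF \<eta>])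
    then have "X - tpair \<eta> \<in> H1 (\<Omega> - K)" by (rule H1_null[OF Y(1)])
    then show ?thesis using X f(3) forms_eq(3)[OF X(1) X(1)] by auto
  qed
  have tp: "tpair \<phi> \<in> H1 (\<Omega> - K)" if \<phi>: "\<phi> \<in> test_functions \<Omega>" for \<phi>
  proof (rule H1_closed)
    fix \<epsilon> :: real assume \<epsilon>: "\<epsilon> > 0"
    obtain C where C: "\<And>X. h.nrm (mul_pair \<phi> X) \<le> C * h.nrm X" using mul_pair_bounded(3)[OF \<phi>] by blast
    \<comment> \<open>Balances the norm \<open>C\<close> of multiplication by \<phi> and the
      Poincare constant \<open>P\<close>, which bounds the full \<open>H\<^sup>1\<close> norm by the
      energy.\<close>
    define \<rho> where "\<rho> = \<epsilon> / ((\<bar>C\<bar> + 1) * (P + 1))"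
    have \<rho>: "\<rho> > 0" using \<epsilon> P by (simp add: \<rho>_def)
    obtain X where X: "X \<in> H1 \<Omega>" "X - tpair \<eta> \<in> H1 (\<Omega> - K)" "q_form X X < \<rho>\<^sup>2"
      using small[of "\<rho>\<^sup>2"] \<rho> by auto
    have 1: "smooth_fun (\<lambda>x. 1 - \<eta> x)" by (intro smooth_fun_diff smooth_fun_const test_smooth[OF \<eta>])
    \<comment> \<open>The factor \<open>1 - \<eta>\<close> vanishes on the neighbourhood
      \<open>W\<close> of \<open>K\<close>, so the support is a compact set disjoint from
      \<open>K\<close>.\<close>
    have t1: "(\<lambda>x. (1 - \<eta> x) * \<phi> x) \<in> test_functions (\<Omega> - K)"
    proof (rule test_functionsI[where S = "fsupport \<phi> - W"])
      show "smooth_fun (\<lambda>x. (1 - \<eta> x) * \<phi> x)" by (intro smooth_fun_mult 1 test_smooth[OF \<phi>])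
      show "compact (fsupport \<phi> - W)" by (intro compact_diff test_compact[OF \<phi>] W)
      show "fsupport \<phi> - W \<subseteq> \<Omega> - K" using W test_support[OF \<phi>] by blast
    qed (use W fsupport_zero in auto)
    have t2: "(\<lambda>x. \<phi> x * \<eta> x) \<in> test_functions \<Omega>" by (rule test_ops(3)[OF \<eta> test_smooth[OF \<phi>]])
    have "tpair \<phi> = tpair (\<lambda>x. (1 - \<eta> x) * \<phi> x + \<phi> x * \<eta> x)" by (simp add: algebra_simps)
    also have "\<dots> = tpair (\<lambda>x. (1 - \<eta> x) * \<phi> x) + mul_pair \<phi> (tpair \<eta>)"
      using tpair_ops(1)[OF _ t2, of "\<lambda>x. (1 - \<eta> x) * \<phi> x"] t1 test_mono[of "\<Omega> - K" \<Omega>]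
      by (auto simp: mul_pair_tpair[OF \<phi> \<eta>])
    finally have eq: "tpair \<phi> - mul_pair \<phi> X = tpair (\<lambda>x. (1 - \<eta> x) * \<phi> x) - mul_pair \<phi> (X - tpair \<eta>)"
      by (simp add: mul_pair_diff[OF \<phi>])
    have "tpair \<phi> - mul_pair \<phi> X \<in> H1 (\<Omega> - K)"
      unfolding eq by (intro subspace_diff[OF H1_subspace] tpair_H1 t1 mul_pair_H1[OF \<phi>] X)
    moreover have "h.nrm ((tpair \<phi> - mul_pair \<phi> X) - tpair \<phi>) < \<epsilon>"
    proof -
      have qX: "q.nrm X < \<rho>" using X(3) \<rho> by (simp add: q.nrm_def real_less_lsqrt q.nonneg)
      have "h.nrm ((tpair \<phi> - mul_pair \<phi> X) - tpair \<phi>) = h.nrm (mul_pair \<phi> X)" by (simp add: h.nrm_minus)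
      also have "\<dots> \<le> (\<bar>C\<bar> + 1) * h.nrm X"
        by (rule order_trans[OF C]) (intro mult_right_mono h.nrm_nonneg, auto)
      also have "\<dots> \<le> (\<bar>C\<bar> + 1) * ((P + 1) * q.nrm X)"
        using h_le[of X] P(2)[OF X(1)] by (intro mult_left_mono) (auto simp: algebra_simps)
      also have "\<dots> < (\<bar>C\<bar> + 1) * ((P + 1) * \<rho>)" using qX P by (intro mult_strict_left_mono) auto
      also have "\<dots> = \<epsilon>"
      proof -
        have "(\<bar>C\<bar> + 1) * (P + 1) \<noteq> 0" using P(1) by simp
        then show ?thesis unfolding \<rho>_def mult.assoc[symmetric] by simp
      qed
      finally show ?thesis .
    qed
    ultimately show "\<exists>Y\<in>H1 (\<Omega> - K). h.nrm (Y - tpair \<phi>) < \<epsilon>" by blast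
  qed
  fix X assume X: "X \<in> H1 \<Omega>"
  show "X \<in> H1 (\<Omega> - K)"
    by (rule H1_closed) (use X tp in \<open>unfold H1_def[of \<Omega>], blast\<close>)
qed

subsection \<open>Potentials and the notions of the statement\<close>

text \<open>\<open>V\<close> represents the potential of \<open>X\<close>, up to null sets.\<close>
definition is_potential :: "'a::euclidean_space set \<Rightarrow> 'a set \<Rightarrow> 'a pair_space \<Rightarrow> 'a pair_space \<Rightarrow> bool" where
  "is_potential \<Omega> K X V \<longleftrightarrow> V \<in> H1 \<Omega> \<and> X - V \<in> H1 (\<Omega> - K) \<and> (\<forall>v\<in>H1 (\<Omega> - K). q_form V v = 0)"

lemma pfun_sum: "pfun (\<Sum>j\<in>S. c j *\<^sub>R X j) = (\<lambda>x. \<Sum>j\<in>S. c j * pfun (X j) x)"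
  by (induction S rule: infinite_finite_induct) (auto simp: pair_ops)

lemma H1_sum: "(\<And>j. j \<in> S \<Longrightarrow> X j \<in> H1 U) \<Longrightarrow> (\<Sum>j\<in>S. c j *\<^sub>R X j) \<in> H1 U"
  by (intro subspace_sum subspace_scale H1_subspace)

lemma riesz_H1:
  assumes U: "bounded U" and \<phi>: "linear \<phi>" "\<And>v. v \<in> H1 U \<Longrightarrow> \<bar>\<phi> v\<bar> \<le> C * q.nrm v"
  shows "\<exists>w\<in>H1 U. \<forall>v\<in>H1 U. q_form w v = \<phi> v"
proof (rule q.riesz[OF H1_subspace _ \<phi>(1)])
  show "\<exists>l\<in>H1 U. (\<lambda>n. q.nrm (X n - l)) \<longlonglongrightarrow> 0"
    if "\<forall>n. X n \<in> H1 U" "\<forall>\<epsilon>>0. \<exists>N. \<forall>m\<ge>N. \<forall>n\<ge>N. q.nrm (X m - X n) < \<epsilon>" for X :: "nat \<Rightarrow> _"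
    by (rule H1_complete[OF U that])
  show "\<bar>\<phi> v\<bar> \<le> C * q.nrm v" if "v \<in> H1 U" for v by (rule \<phi>(2)[OF that])
  show ?thesis if "w \<in> H1 U" "\<And>v. v \<in> H1 U \<Longrightarrow> q_form w v = \<phi> v" for w
    using that by blast
qed

text \<open>The Riesz representative \<open>w\<close> of \<open>q_form X\<close> on the smaller
  space is the energy projection of \<open>X\<close>; the potential is the remainder
  \<open>X - w\<close>.\<close>

lemma potential_exists:
  assumes "bounded \<Omega>" "X \<in> H1 \<Omega>"
  shows "\<exists>V. is_potential \<Omega> K X V"
proof -
  have b: "bounded (\<Omega> - K)" using assms(1) by (rule bounded_subset) auto
  have sub: "H1 (\<Omega> - K) \<subseteq> H1 \<Omega>" by (rule H1_mono) auto
  have "linear (q_form X)" by (rule q.bilin[unfolded bilinear_def, THEN conjunct1, THEN spec])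
  then have "\<exists>w\<in>H1 (\<Omega> - K). \<forall>v\<in>H1 (\<Omega> - K). q_form w v = q_form X v"
    by (rule riesz_H1[OF b, where C = "q.nrm X"]) (rule q.cauchy_schwarz)
  then obtain w where w: "w \<in> H1 (\<Omega> - K)" "\<And>v. v \<in> H1 (\<Omega> - K) \<Longrightarrow> q_form w v = q_form X v"
    by blast
  have "is_potential \<Omega> K X (X - w)"
    unfolding is_potential_def using w sub assms(2)
    by (auto simp: q.lin intro!: subspace_diff[OF H1_subspace])
  then show ?thesis by blast
qed

lemma is_potential_sum:
  assumes "\<And>j. j \<in> S \<Longrightarrow> is_potential \<Omega> K (X j) (V j)"
  shows "is_potential \<Omega> K (\<Sum>j\<in>S. c j *\<^sub>R X j) (\<Sum>j\<in>S. c j *\<^sub>R V j)"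
proof -
  have "(\<Sum>j\<in>S. c j *\<^sub>R X j) - (\<Sum>j\<in>S. c j *\<^sub>R V j) = (\<Sum>j\<in>S. c j *\<^sub>R (X j - V j))"
    by (simp add: sum_subtractf scaleR_diff_right)
  then show ?thesis
    using assms unfolding is_potential_def by (auto simp: q.lsum q.lin intro!: H1_sum sum.neutral)
qed

text \<open>Lifts a competitor of the variational problem to a pair. The lift of the difference and
  the difference of the lifts have the same function, hence distance zero, and \<open>H1\<close> is
  closed.\<close>

lemma competitor_diff:
  assumes X: "X \<in> H1 \<Omega>" and f: "f \<in> H10 \<Omega>" "(\<lambda>x. f x - pfun X x) \<in> H10 (\<Omega> - K)"
  obtains Y where "Y \<in> H1 \<Omega>" "pfun Y = f" "Y - X \<in> H1 (\<Omega> - K)"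
proof -
  obtain Y Z where Y: "Y \<in> H1 \<Omega>" "pfun Y = f" and Z: "Z \<in> H1 (\<Omega> - K)" "pfun Z = (\<lambda>x. f x - pfun X x)"
    using f H10_iff by metis
  have "Y - X \<in> H1 \<Omega>" by (intro subspace_diff[OF H1_subspace] X Y)
  then have "h.nrm (Z - (Y - X)) = 0"
    by (rule H1_same_fun[OF Z(1)]) (simp add: pair_ops Y Z)
  then have "Y - X \<in> H1 (\<Omega> - K)" by (rule H1_null[OF Z(1)])
  with Y show ?thesis by (rule that)
qed

text \<open>Pythagoras: \<open>Y - V\<close> lies in the form domain, to which \<open>V\<close> is
  energy-orthogonal.\<close>

lemma potential_energy:
  assumes X: "X \<in> H1 \<Omega>" and V: "is_potential \<Omega> K X V"
    and Y: "Y \<in> H1 \<Omega>" "Y - X \<in> H1 (\<Omega> - K)"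
  shows "q_form Y Y = q_form V V + q_form (Y - V) (Y - V)"
proof -
  have "(Y - X) + (X - V) \<in> H1 (\<Omega> - K)"
    using V Y by (intro subspace_add[OF H1_subspace]) (auto simp: is_potential_def)
  then have "q_form V (Y - V) = 0" using V by (simp add: is_potential_def)
  then show ?thesis using q.sym[of Y V] by (simp add: q.lin)
qed

lemma potential_competitor:
  assumes "is_potential \<Omega> K X V"
  shows "pfun V \<in> H10 \<Omega>" "(\<lambda>x. pfun V x - pfun X x) \<in> H10 (\<Omega> - K)"
proof -
  have V: "X - V \<in> H1 (\<Omega> - K)" "V \<in> H1 \<Omega>" using assms by (auto simp: is_potential_def)
  show "pfun V \<in> H10 \<Omega>" unfolding H10_iff using V(2) by blast
  have "- (X - V) \<in> H1 (\<Omega> - K)" by (rule subspace_neg[OF H1_subspace V(1)])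
  moreover have "pfun (- (X - V)) = (\<lambda>x. pfun V x - pfun X x)" by (simp add: pair_ops)
  ultimately show "(\<lambda>x. pfun V x - pfun X x) \<in> H10 (\<Omega> - K)" unfolding H10_iff by blast
qed

lemma u_capacity_eq:
  assumes X: "X \<in> H1 \<Omega>" and V: "is_potential \<Omega> K X V"
  shows "u_capacity \<Omega> K (pfun X) = q_form V V"
  unfolding u_capacity_def
proof (rule cInf_eq_minimum)
  have VH: "V \<in> H1 \<Omega>" using V by (simp add: is_potential_def)
  show "q_form V V \<in> {energy f | f. f \<in> H10 \<Omega> \<and> (\<lambda>x. f x - pfun X x) \<in> H10 (\<Omega> - K)}"
    using forms_eq(3)[OF VH VH, symmetric] potential_competitor[OF V] by blast
  fix y assume "y \<in> {energy f | f. f \<in> H10 \<Omega> \<and> (\<lambda>x. f x - pfun X x) \<in> H10 (\<Omega> - K)}"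
  then obtain f where f: "y = energy f" "f \<in> H10 \<Omega>" "(\<lambda>x. f x - pfun X x) \<in> H10 (\<Omega> - K)" by blast
  obtain Y where Y: "Y \<in> H1 \<Omega>" "pfun Y = f" "Y - X \<in> H1 (\<Omega> - K)" by (rule competitor_diff[OF X f(2,3)])
  show "q_form V V \<le> y"
    using potential_energy[OF X V Y(1,3)] q.nonneg[of "Y - V"] forms_eq(3)[OF Y(1) Y(1)] f(1) Y(2) by simp
qed

text \<open>The function chosen by \<open>potential\<close> has minimal energy, so by Pythagoras its
  distance to \<open>V\<close> in energy is zero, and by Poincare also in \<open>L\<^sup>2\<close>.
  Neither form can then tell the two apart.\<close>

lemma potential_pair:
  assumes \<Omega>: "bounded \<Omega>" and X: "X \<in> H1 \<Omega>" and V: "is_potential \<Omega> K X V"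
  obtains Y where "Y \<in> H1 \<Omega>" "pfun Y = potential \<Omega> K (pfun X)" "\<And>Z. q_form Z Y = q_form Z V" "\<And>Z. b_form Z Y = b_form Z V"
proof -
  have "V \<in> H1 \<Omega>" using V by (simp add: is_potential_def)
  have "energy (pfun V) = u_capacity \<Omega> K (pfun X)"
    using u_capacity_eq[OF X V] forms_eq(3)[OF \<open>V \<in> H1 \<Omega>\<close> \<open>V \<in> H1 \<Omega>\<close>] by simp
  then have "\<exists>f. f \<in> H10 \<Omega> \<and> (\<lambda>x. f x - pfun X x) \<in> H10 (\<Omega> - K) \<and> energy f = u_capacity \<Omega> K (pfun X)"
    using potential_competitor[OF V] by blast
  from someI_ex[OF this] have f: "potential \<Omega> K (pfun X) \<in> H10 \<Omega>"
    "(\<lambda>x. potential \<Omega> K (pfun X) x - pfun X x) \<in> H10 (\<Omega> - K)"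
    "energy (potential \<Omega> K (pfun X)) = u_capacity \<Omega> K (pfun X)"
    unfolding potential_def by auto
  obtain Y where Y: "Y \<in> H1 \<Omega>" "pfun Y = potential \<Omega> K (pfun X)" "Y - X \<in> H1 (\<Omega> - K)"
    by (rule competitor_diff[OF X f(1,2)])
  have "q_form Y Y = q_form V V" using f(3) forms_eq(3)[OF Y(1) Y(1)] u_capacity_eq[OF X V] Y(2) by simp
  then have q0: "q_form (Y - V) (Y - V) = 0" using potential_energy[OF X V Y(1,3)] by simp
  obtain P where P: "\<And>X. X \<in> H1 \<Omega> \<Longrightarrow> b.nrm X \<le> P * q.nrm X" using poincare[OF \<Omega>] by blast
  have "b.nrm (Y - V) \<le> P * q.nrm (Y - V)"
    by (intro P subspace_diff[OF H1_subspace] Y \<open>V \<in> H1 \<Omega>\<close>)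
  then have "b.nrm (Y - V) = 0" using q0 b.nrm_nonneg[of "Y - V"] by (simp add: q.nrm_def)
  then have b0: "b_form (Y - V) (Y - V) = 0" using b.nrm_sq[of "Y - V"] by simp
  show ?thesis
  proof (rule that[OF Y(1,2)])
    show "q_form Z Y = q_form Z V" for Z using q.null_right[OF q0, of Z] by (simp add: q.lin)
    show "b_form Z Y = b_form Z V" for Z using b.null_right[OF b0, of Z] by (simp add: b.lin)
  qed
qed

lemma r_form_eq:
  assumes "bounded \<Omega>" "X \<in> H1 \<Omega>" "is_potential \<Omega> K X V" "X' \<in> H1 \<Omega>" "is_potential \<Omega> K X' V'"
  shows "r_form \<Omega> K lam (pfun X) (pfun X') = q_form V V' - lam * b_form V V'"
proof -
  obtain Y where Y: "Y \<in> H1 \<Omega>" "pfun Y = potential \<Omega> K (pfun X)"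
    "\<And>Z. q_form Z Y = q_form Z V" "\<And>Z. b_form Z Y = b_form Z V"
    using potential_pair[OF assms(1-3)] by blast
  obtain Y' where Y': "Y' \<in> H1 \<Omega>" "pfun Y' = potential \<Omega> K (pfun X')"
    "\<And>Z. q_form Z Y' = q_form Z V'" "\<And>Z. b_form Z Y' = b_form Z V'"
    using potential_pair[OF assms(1,4,5)] by blast
  have "r_form \<Omega> K lam (pfun X) (pfun X') = q_form Y Y' - lam * b_form Y Y'"
    unfolding r_form_def Y(2)[symmetric] Y'(2)[symmetric] using forms_eq(1,2)[OF Y(1) Y'(1)] by simp
  also have "q_form Y Y' = q_form V V'" using Y'(3)[of Y] Y(3)[of V'] q.sym by metis
  also have "b_form Y Y' = b_form V V'" using Y'(4)[of Y] Y(4)[of V'] b.sym by metis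
  finally show ?thesis .
qed

text \<open>Families in \<open>H10\<close> and families of pairs correspond through
  \<open>pfun\<close>, and lifting preserves energies and inner products, so both infima run over
  the same set of reals.\<close>

lemma dir_eigenvalue_eq: "dir_eigenvalue U k = minmax (H1 U) k"
proof -
  have sup: "Sup {energy (\<lambda>x. \<Sum>j<k. c j * f j x) | c. (\<Sum>j<k. (c j)\<^sup>2) = 1} = rayleigh_sup k F"
    and inner: "(\<forall>i<k. \<forall>j<k. l2_inner (f i) (f j) = (if i = j then 1 else 0)) \<longleftrightarrow> b.ortho k F"
    if F: "\<And>j. j < k \<Longrightarrow> F j \<in> H1 U" "\<And>j. j < k \<Longrightarrow> pfun (F j) = f j" for F f
  proof -
    have "energy (\<lambda>x. \<Sum>j<k. c j * f j x) = q_form (\<Sum>j<k. c j *\<^sub>R F j) (\<Sum>j<k. c j *\<^sub>R F j)" for c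
    proof -
      have "(\<lambda>x. \<Sum>j<k. c j * f j x) = pfun (\<Sum>j<k. c j *\<^sub>R F j)"
        unfolding pfun_sum by (intro ext sum.cong) (auto simp: F(2))
      moreover have "(\<Sum>j<k. c j *\<^sub>R F j) \<in> H1 U" by (rule H1_sum) (simp add: F)
      ultimately show ?thesis using forms_eq(3) by metis
    qed
    then show "Sup {energy (\<lambda>x. \<Sum>j<k. c j * f j x) | c. (\<Sum>j<k. (c j)\<^sup>2) = 1} = rayleigh_sup k F"
      by (simp add: rayleigh_sup_def)
    have "l2_inner (f i) (f j) = b_form (F i) (F j)" if "i < k" "j < k" for i j
      using forms_eq(2)[OF F(1)[OF that(1)] F(1)[OF that(2)]] F(2) that by simp
    then show "(\<forall>i<k. \<forall>j<k. l2_inner (f i) (f j) = (if i = j then 1 else 0)) \<longleftrightarrow> b.ortho k F"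
      by (simp add: b.ortho_def)
  qed
  have "{Sup {energy (\<lambda>x. \<Sum>j<k. c j * f j x) | c. (\<Sum>j<k. (c j)\<^sup>2) = 1}
        | f. (\<forall>j<k. f j \<in> H10 U) \<and> (\<forall>i<k. \<forall>j<k. l2_inner (f i) (f j) = (if i = j then 1 else 0))}
    = {rayleigh_sup k F | F. (\<forall>j<k. F j \<in> H1 U) \<and> b.ortho k F}" (is "?L = ?R")
  proof (intro equalityI subsetI)
    fix y assume "y \<in> ?L"
    then obtain f where f: "y = Sup {energy (\<lambda>x. \<Sum>j<k. c j * f j x) | c. (\<Sum>j<k. (c j)\<^sup>2) = 1}"
      "\<forall>j<k. f j \<in> H10 U" "\<forall>i<k. \<forall>j<k. l2_inner (f i) (f j) = (if i = j then 1 else 0)" by blast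
    have "\<forall>j\<in>{..<k}. \<exists>X. X \<in> H1 U \<and> pfun X = f j" using f(2) by (auto simp: H10_iff)
    from bchoice[OF this] obtain F where F: "\<And>j. j < k \<Longrightarrow> F j \<in> H1 U" "\<And>j. j < k \<Longrightarrow> pfun (F j) = f j"
      by auto
    have "y = rayleigh_sup k F" using sup[OF F] f(1) by simp
    moreover have "b.ortho k F" using inner[of F f] F f(3) by blast
    ultimately show "y \<in> ?R" using F(1) by blast
  next
    fix y assume "y \<in> ?R"
    then obtain F where F: "y = rayleigh_sup k F" "\<forall>j<k. F j \<in> H1 U" "b.ortho k F" by blast
    have "\<forall>j<k. pfun (F j) \<in> H10 U" using F(2) H10_iff by blast
    moreover have "y = Sup {energy (\<lambda>x. \<Sum>j<k. c j * pfun (F j) x) | c. (\<Sum>j<k. (c j)\<^sup>2) = 1}"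
      using sup[of F "\<lambda>j. pfun (F j)"] F(1,2) by simp
    moreover have "\<forall>i<k. \<forall>j<k. l2_inner (pfun (F i)) (pfun (F j)) = (if i = j then 1 else 0)"
      using inner[of F "\<lambda>j. pfun (F j)"] F(2,3) by blast
    ultimately show "y \<in> ?L" by (intro CollectI exI[of _ "\<lambda>j. pfun (F j)"] conjI)
  qed
  then show ?thesis unfolding dir_eigenvalue_def minmax_def by (simp only:)
qed

definition eigen_pair :: "'a::euclidean_space set \<Rightarrow> real \<Rightarrow> 'a pair_space \<Rightarrow> bool" where
  "eigen_pair \<Omega> lam X \<longleftrightarrow> X \<in> H1 \<Omega> \<and> (\<forall>v\<in>H1 \<Omega>. q_form X v = lam * b_form X v)"

lemma dir_eigenspace_iff: "u \<in> dir_eigenspace \<Omega> lam \<longleftrightarrow> (\<exists>X. eigen_pair \<Omega> lam X \<and> pfun X = u)"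
proof
  assume "u \<in> dir_eigenspace \<Omega> lam"
  then have u: "u \<in> H10 \<Omega>" "\<And>v. v \<in> H10 \<Omega> \<Longrightarrow> dirichlet_form u v = lam * l2_inner u v"
    by (auto simp: dir_eigenspace_def)
  then obtain X where X: "X \<in> H1 \<Omega>" "pfun X = u" using H10_iff by blast
  have "q_form X v = lam * b_form X v" if "v \<in> H1 \<Omega>" for v
    using u(2)[of "pfun v"] forms_eq(1,2)[OF X(1) that] X(2) that H10_iff[of "pfun v" \<Omega>] by auto
  then show "\<exists>X. eigen_pair \<Omega> lam X \<and> pfun X = u" using X by (auto simp: eigen_pair_def)
next
  assume "\<exists>X. eigen_pair \<Omega> lam X \<and> pfun X = u"
  then obtain X where X: "X \<in> H1 \<Omega>" "pfun X = u" "\<And>v. v \<in> H1 \<Omega> \<Longrightarrow> q_form X v = lam * b_form X v"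
    by (auto simp: eigen_pair_def)
  have "dirichlet_form u v = lam * l2_inner u v" if "v \<in> H10 \<Omega>" for v
  proof -
    obtain Y where Y: "Y \<in> H1 \<Omega>" "pfun Y = v" using \<open>v \<in> H10 \<Omega>\<close> H10_iff by blast
    show ?thesis using forms_eq(1,2)[OF X(1) Y(1)] X Y by simp
  qed
  moreover have "u \<in> H10 \<Omega>" unfolding H10_iff using X by blast
  ultimately show "u \<in> dir_eigenspace \<Omega> lam" by (simp add: dir_eigenspace_def)
qed

text \<open>The basis is shifted to start at index zero.\<close>
lemma r_eigenvalues_basis:
  assumes \<Omega>: "bounded \<Omega>" and r: "r_eigenvalues \<Omega> K lam m \<mu>"
  obtains e where "\<And>j. j < m \<Longrightarrow> eigen_pair \<Omega> lam (e j)" "b.ortho m e"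
    "\<And>X Y. eigen_pair \<Omega> lam X \<Longrightarrow> b_form Y X = b_form Y (\<Sum>j<m. b_form X (e j) *\<^sub>R e j)"
    "\<And>i j V W. i < m \<Longrightarrow> j < m \<Longrightarrow> is_potential \<Omega> K (e i) V \<Longrightarrow> is_potential \<Omega> K (e j) W \<Longrightarrow>
      q_form V W - lam * b_form V W = (if i = j then \<mu> (Suc i) else 0)"
proof -
  from r obtain e' where e': "\<forall>i\<in>{1..m}. e' i \<in> dir_eigenspace \<Omega> lam"
    "\<forall>i\<in>{1..m}. \<forall>j\<in>{1..m}. l2_inner (e' i) (e' j) = (if i = j then 1 else 0)"
    "\<forall>u\<in>dir_eigenspace \<Omega> lam. AE x in lebesgue. u x = (\<Sum>i=1..m. l2_inner u (e' i) * e' i x)"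
    "\<forall>i\<in>{1..m}. \<forall>v\<in>dir_eigenspace \<Omega> lam. r_form \<Omega> K lam (e' i) v = \<mu> i * l2_inner (e' i) v"
    unfolding r_eigenvalues_def by blast
  have "\<forall>j. \<exists>X. j < m \<longrightarrow> eigen_pair \<Omega> lam X \<and> pfun X = e' (Suc j)"
  proof
    fix j
    have "e' (Suc j) \<in> dir_eigenspace \<Omega> lam" if "j < m" using e'(1) that by simp
    then show "\<exists>X. j < m \<longrightarrow> eigen_pair \<Omega> lam X \<and> pfun X = e' (Suc j)"
      by (auto simp: dir_eigenspace_iff)
  qed
  then obtain e where e: "\<And>j. j < m \<Longrightarrow> eigen_pair \<Omega> lam (e j)" "\<And>j. j < m \<Longrightarrow> pfun (e j) = e' (Suc j)"
    by metis
  have eH: "e j \<in> H1 \<Omega>" if "j < m" for j using e(1)[OF that] by (simp add: eigen_pair_def)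
  have inner: "l2_inner (e' (Suc i)) (e' (Suc j)) = b_form (e i) (e j)" if "i < m" "j < m" for i j
    using forms_eq(2)[OF eH[OF that(1)] eH[OF that(2)]] e(2) that by simp
  have o: "b_form (e i) (e j) = (if i = j then 1 else 0)" if "i < m" "j < m" for i j
    using e'(2) inner[OF that] that by simp
  show ?thesis
  proof (rule that)
    show "j < m \<Longrightarrow> eigen_pair \<Omega> lam (e j)" for j by (rule e)
    show "b.ortho m e" using o by (simp add: b.ortho_def)
    fix X Y assume X: "eigen_pair \<Omega> lam X"
    then have XH: "X \<in> H1 \<Omega>" by (simp add: eigen_pair_def)
    have sm: "(\<Sum>i=1..m. l2_inner (pfun X) (e' i) * e' i x) = pfun (\<Sum>j<m. b_form X (e j) *\<^sub>R e j) x" for x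
    proof -
      have "(\<Sum>i=1..m. l2_inner (pfun X) (e' i) * e' i x) = (\<Sum>j<m. l2_inner (pfun X) (e' (Suc j)) * e' (Suc j) x)"
        by (simp add: sum.atLeast1_atMost_eq)
      also have "\<dots> = (\<Sum>j<m. b_form X (e j) * pfun (e j) x)"
        by (intro sum.cong refl) (use forms_eq(2)[OF XH eH] e(2) in simp)
      finally show ?thesis by (simp add: pfun_sum)
    qed
    have "pfun X \<in> dir_eigenspace \<Omega> lam" using X by (auto simp: dir_eigenspace_iff)
    from bspec[OF e'(3) this] have "AE x in lebesgue. pfun X x = pfun (\<Sum>j<m. b_form X (e j) *\<^sub>R e j) x"
      unfolding sm .
    moreover have "(\<Sum>j<m. b_form X (e j) *\<^sub>R e j) \<in> H1 \<Omega>" by (rule H1_sum) (simp add: eH)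
    \<comment> \<open>The expansion holds almost everywhere, which gives distance zero but no
      equation between pairs. It is therefore recorded in weak form, tested against any
      \<open>Y\<close>.\<close>
    ultimately have "h.nrm (X - (\<Sum>j<m. b_form X (e j) *\<^sub>R e j)) = 0" by (intro H1_same_fun[OF XH])
    then have "b.nrm (X - (\<Sum>j<m. b_form X (e j) *\<^sub>R e j)) = 0"
      using b_le_h[of "X - (\<Sum>j<m. b_form X (e j) *\<^sub>R e j)"] b.nrm_nonneg by (metis order_antisym)
    then have "b_form (X - (\<Sum>j<m. b_form X (e j) *\<^sub>R e j)) (X - (\<Sum>j<m. b_form X (e j) *\<^sub>R e j)) = 0"
      using b.nrm_sq by (metis power_zero_numeral)
    from b.null_right[OF this, of Y] show "b_form Y X = b_form Y (\<Sum>j<m. b_form X (e j) *\<^sub>R e j)"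
      by (simp only: b.lin)
  next
    fix i j V W assume *: "i < m" "j < m" "is_potential \<Omega> K (e i) V" "is_potential \<Omega> K (e j) W"
    have "e' (Suc j) \<in> dir_eigenspace \<Omega> lam" using e'(1) *(2) by simp
    then have "r_form \<Omega> K lam (e' (Suc i)) (e' (Suc j)) = \<mu> (Suc i) * l2_inner (e' (Suc i)) (e' (Suc j))"
      using e'(4) *(1) by simp
    also have "\<dots> = (if i = j then \<mu> (Suc i) else 0)" using inner[OF *(1,2)] o[OF *(1,2)] by simp
    finally show "q_form V W - lam * b_form V W = (if i = j then \<mu> (Suc i) else 0)"
      using r_form_eq[OF \<Omega> eH[OF *(1)] *(3) eH[OF *(2)] *(4)] e(2) *(1,2) by simp
  qed
qed

subsection \<open>Concentrating families\<close>

text \<open>Zero capacity provides a test function near \<open>X\<close> with support off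
  \<open>K\<close>; by concentration it lies in the perturbed form domain for small \<epsilon>.
  Being orthogonal to it, \<open>V\<close> only sees the remainder of \<open>X\<close>.\<close>

lemma potential_small:
  fixes \<Omega> K :: "'a::euclidean_space set"
  assumes \<Omega>: "bounded \<Omega>" "open \<Omega>" and K: "compact K" "K \<subseteq> \<Omega>" "capacity \<Omega> K = 0"
    and conc: "concentrates_to \<Omega> Ks K" and X: "X \<in> H1 \<Omega>" and \<delta>: "0 < \<delta>"
  shows "eventually (\<lambda>\<epsilon>. \<forall>V. is_potential \<Omega> (Ks \<epsilon>) X V \<longrightarrow> q.nrm V \<le> \<delta>) (at_right 0)"
proof -
  have "X \<in> H1 (\<Omega> - K)" using H1_zero_capacity[OF \<Omega> K] X by blast
  then obtain \<phi> where \<phi>: "\<phi> \<in> test_functions (\<Omega> - K)" "h.nrm (tpair \<phi> - X) < \<delta>"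
    using \<delta> unfolding H1_def by blast
  have "open (\<Omega> - fsupport \<phi>)" using \<Omega> by (intro open_Diff) (auto simp: fsupport_def)
  moreover have "K \<subseteq> \<Omega> - fsupport \<phi>" using test_support[OF \<phi>(1)] K by blast
  ultimately obtain eU where eU: "eU > 0" "\<And>\<epsilon>. 0 < \<epsilon> \<Longrightarrow> \<epsilon> < eU \<Longrightarrow> Ks \<epsilon> \<subseteq> \<Omega> - fsupport \<phi>"
    using conc[unfolded concentrates_to_def, rule_format, of "\<Omega> - fsupport \<phi>"] by blast
  have "q.nrm V \<le> \<delta>" if \<epsilon>: "0 < \<epsilon>" "\<epsilon> < eU" and V: "is_potential \<Omega> (Ks \<epsilon>) X V" for \<epsilon> V
  proof -
    have "\<phi> \<in> test_functions (\<Omega> - Ks \<epsilon>)"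
      using \<phi>(1) eU(2)[OF \<epsilon>] by (auto simp: test_functions_def)
    then have t: "tpair \<phi> \<in> H1 (\<Omega> - Ks \<epsilon>)" by (rule tpair_H1)
    have "q_form V (X - V) = 0" "q_form V (tpair \<phi>) = 0" using V t by (auto simp: is_potential_def)
    then have "(q.nrm V)\<^sup>2 = q_form V (X - tpair \<phi>)" by (simp add: q.nrm_sq q.lin)
    also have "\<dots> \<le> q.nrm V * q.nrm (X - tpair \<phi>)" using q.cauchy_schwarz[of V "X - tpair \<phi>"] by simp
    also have "\<dots> \<le> q.nrm V * \<delta>"
      using q_le_h[of "X - tpair \<phi>"] \<phi>(2) h.nrm_diff_commute[of X "tpair \<phi>"] q.nrm_nonneg[of V]
      by (intro mult_left_mono) auto
    finally have "q.nrm V * q.nrm V \<le> q.nrm V * \<delta>" by (simp add: power2_eq_square)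
    then show ?thesis using q.nrm_nonneg[of V] \<delta> by (cases "q.nrm V = 0") auto
  qed
  then show ?thesis unfolding eventually_at_right_field using eU(1) by blast
qed

text \<open>Compactness of the embedding into \<open>L\<^sup>2\<close> makes the \<open>L\<^sup>2\<close> norm negligible on the orthogonal complement
  of the perturbed space.\<close>
lemma complement_small:
  fixes \<Omega> K :: "'a::euclidean_space set"
  assumes \<Omega>: "bounded \<Omega>" "open \<Omega>" and K: "compact K" "K \<subseteq> \<Omega>" "capacity \<Omega> K = 0"
    and conc: "concentrates_to \<Omega> Ks K" and \<kappa>: "0 < \<kappa>"
  shows "eventually (\<lambda>\<epsilon>. \<forall>v\<in>H1 \<Omega>. (\<forall>y\<in>H1 (\<Omega> - Ks \<epsilon>). q_form v y = 0) \<longrightarrow> b.nrm v \<le> \<kappa> * q.nrm v) (at_right 0)"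
proof -
  have "0 < \<kappa>\<^sup>2 / 2" using \<kappa> by simp
  from rellich[OF \<Omega>(1) this] obtain I :: "('a \<Rightarrow> int) set" and Y where IY: "finite I \<and>
      (\<forall>X\<in>H1 \<Omega>. b_form X X \<le> \<kappa>\<^sup>2 / 2 * q_form X X + (\<Sum>k\<in>I. (b_form X (Y k))\<^sup>2))"
    by (elim exE)
  from IY have I: "finite I" by simp
  from IY have rel: "b_form X X \<le> \<kappa>\<^sup>2 / 2 * q_form X X + (\<Sum>k\<in>I. (b_form X (Y k))\<^sup>2)" if "X \<in> H1 \<Omega>" for X
    using that by blast
  obtain P where P: "0 < P" "\<And>X. X \<in> H1 \<Omega> \<Longrightarrow> b.nrm X \<le> P * q.nrm X" using poincare[OF \<Omega>(1)] by blast
  \<comment> \<open>Writing the functional \<open>Y k\<close> as an energy pairing with a fixed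
    \<open>w k\<close> makes it small on the complement of the perturbed space: there
    \<open>w k\<close> may be replaced by its potential.\<close>
  have "\<exists>w\<in>H1 \<Omega>. \<forall>v\<in>H1 \<Omega>. q_form w v = b_form (Y k) v" for k
  proof (rule riesz_H1[OF \<Omega>(1)])
    show "linear (b_form (Y k))" by (rule b.bilin[unfolded bilinear_def, THEN conjunct1, THEN spec])
    fix v assume "v \<in> H1 \<Omega>"
    have "\<bar>b_form (Y k) v\<bar> \<le> b.nrm (Y k) * b.nrm v" by (rule b.cauchy_schwarz)
    also have "\<dots> \<le> b.nrm (Y k) * (P * q.nrm v)"
      using P(2)[OF \<open>v \<in> H1 \<Omega>\<close>] b.nrm_nonneg by (intro mult_left_mono) auto
    finally show "\<bar>b_form (Y k) v\<bar> \<le> b.nrm (Y k) * P * q.nrm v" by (simp add: mult.assoc)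
  qed
  then obtain w where w: "\<And>k. w k \<in> H1 \<Omega>" "\<And>k v. v \<in> H1 \<Omega> \<Longrightarrow> q_form (w k) v = b_form (Y k) v" by metis
  \<comment> \<open>Chosen so that the \<open>card I\<close> squared functionals together stay below
    half of the target \<open>\<kappa>\<^sup>2\<close>.\<close>
  define \<rho> where "\<rho> = \<kappa> / sqrt (2 * (real (card I) + 1))"
  have \<rho>: "0 < \<rho>" using \<kappa> by (simp add: \<rho>_def add_pos_nonneg)
  have \<rho>2: "real (card I) * \<rho>\<^sup>2 \<le> \<kappa>\<^sup>2 / 2"
    by (simp add: \<rho>_def power_divide field_simps)
  have "eventually (\<lambda>\<epsilon>. \<forall>k\<in>I. \<forall>V. is_potential \<Omega> (Ks \<epsilon>) (w k) V \<longrightarrow> q.nrm V \<le> \<rho>) (at_right 0)"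
    using I potential_small[OF \<Omega> K conc w(1) \<rho>] by (simp add: eventually_ball_finite)
  then show ?thesis
  proof eventually_elim
    case (elim \<epsilon>)
    show ?case
    proof (intro ballI impI)
      fix v assume v: "v \<in> H1 \<Omega>" and orth: "\<forall>y\<in>H1 (\<Omega> - Ks \<epsilon>). q_form v y = 0"
      have le: "(b_form v (Y k))\<^sup>2 \<le> \<rho>\<^sup>2 * q_form v v" if k: "k \<in> I" for k
      proof -
        obtain V where V: "is_potential \<Omega> (Ks \<epsilon>) (w k) V" using potential_exists[OF \<Omega>(1) w(1)] by blast
        have "q_form v (w k - V) = 0" using V orth by (simp add: is_potential_def)
        then have "b_form v (Y k) = q_form V v"
          using w(2)[OF v, of k] b.sym[of v "Y k"] q.sym[of v "w k"] q.sym[of v V] by (simp add: q.lin)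
        then have "\<bar>b_form v (Y k)\<bar> \<le> q.nrm V * q.nrm v" using q.cauchy_schwarz[of V v] by simp
        also have "\<dots> \<le> \<rho> * q.nrm v" using elim k V q.nrm_nonneg by (intro mult_right_mono) auto
        finally have "\<bar>b_form v (Y k)\<bar>\<^sup>2 \<le> (\<rho> * q.nrm v)\<^sup>2" by (intro power_mono) auto
        then show ?thesis by (simp add: power_mult_distrib q.nrm_sq)
      qed
      have "b_form v v \<le> \<kappa>\<^sup>2 / 2 * q_form v v + (\<Sum>k\<in>I. \<rho>\<^sup>2 * q_form v v)"
      proof -
        have "(\<Sum>k\<in>I. (b_form v (Y k))\<^sup>2) \<le> (\<Sum>k\<in>I. \<rho>\<^sup>2 * q_form v v)" by (rule sum_mono) (rule le)
        then show ?thesis using rel[OF v] by linarith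
      qed
      also have "\<dots> \<le> \<kappa>\<^sup>2 / 2 * q_form v v + \<kappa>\<^sup>2 / 2 * q_form v v"
        using mult_right_mono[OF \<rho>2 q.nonneg[of v]] by (simp add: algebra_simps)
      also have "\<dots> = (\<kappa> * q.nrm v)\<^sup>2" by (simp add: power_mult_distrib q.nrm_sq)
      finally show "b.nrm v \<le> \<kappa> * q.nrm v" using \<kappa> q.nrm_nonneg[of v] by (subst b.nrm_le_iff) auto
    qed
  qed
qed

section \<open>The eigenspace and the supremum of the capacities on it\<close>

lemma eigen_pair_sum: "(\<And>j. j \<in> S \<Longrightarrow> eigen_pair \<Omega> lam (X j)) \<Longrightarrow> eigen_pair \<Omega> lam (\<Sum>j\<in>S. c j *\<^sub>R X j)"
  unfolding eigen_pair_def
  by (auto simp: q.lsum b.lsum q.lin b.lin sum_distrib_left intro!: H1_sum sum.cong)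

lemma H1_b_null:
  assumes "X \<in> H1 U" "b_form X X = 0"
  shows "h.nrm X = 0"
proof -
  have "AE x in lebesgue. (pfun X x)\<^sup>2 = 0"
    using assms(2) sq_int_pair(1)[of X]
    by (subst integral_nonneg_eq_0_iff_AE[symmetric]) (auto simp: b_form_def power2_eq_square sq_int_def)
  then have "AE x in lebesgue. pfun X x = pfun 0 x" by eventually_elim (simp add: pair_ops)
  from H1_same_fun[OF assms(1) subspace_0[OF H1_subspace] this] show ?thesis by simp
qed

lemma null_H1: "h.nrm X = 0 \<Longrightarrow> X \<in> H1 U"
  by (rule H1_null[OF subspace_0[OF H1_subspace]]) (simp add: h.nrm_minus)

text \<open>Expanding a normalised eigenfunction in \<open>e\<close> expands its potential in
  \<open>V\<close>, with coefficients bounded by Bessel's inequality. The resulting bound makes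
  \<open>Sup\<close> meaningful and shows that it is small as soon as the potentials of one basis
  are.\<close>

lemma chi2_bounds:
  fixes \<Omega> Ke :: "'a::euclidean_space set"
  assumes \<Omega>: "bounded \<Omega>" and m: "0 < m"
    and e: "\<And>j. j < m \<Longrightarrow> eigen_pair \<Omega> lam (e j)" "b.ortho m e"
    and span: "\<And>X Y. eigen_pair \<Omega> lam X \<Longrightarrow> b_form Y X = b_form Y (\<Sum>j<m. b_form X (e j) *\<^sub>R e j)"
    and V: "\<And>j. j < m \<Longrightarrow> is_potential \<Omega> Ke (e j) (V j)"
  shows "\<And>X W. eigen_pair \<Omega> lam X \<Longrightarrow> b_form X X = 1 \<Longrightarrow> is_potential \<Omega> Ke X W \<Longrightarrow> q_form W W \<le> chi2 \<Omega> Ke lam"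
    and "0 \<le> chi2 \<Omega> Ke lam" and "chi2 \<Omega> Ke lam \<le> (\<Sum>j<m. q.nrm (V j))\<^sup>2"
proof -
  let ?S = "{u_capacity \<Omega> Ke u | u. u \<in> dir_eigenspace \<Omega> lam \<and> l2_inner u u = 1}"
  have in_S: "q_form W W \<in> ?S" if X: "eigen_pair \<Omega> lam X" "b_form X X = 1" "is_potential \<Omega> Ke X W" for X W
  proof -
    have "X \<in> H1 \<Omega>" using X(1) by (simp add: eigen_pair_def)
    then have "u_capacity \<Omega> Ke (pfun X) = q_form W W" "l2_inner (pfun X) (pfun X) = 1"
      using u_capacity_eq X forms_eq(2) by metis+
    moreover have "pfun X \<in> dir_eigenspace \<Omega> lam" using X(1) dir_eigenspace_iff by blast
    ultimately show ?thesis by (metis (mono_tags, lifting) mem_Collect_eq)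
  qed
  have of_S: "\<exists>X. eigen_pair \<Omega> lam X \<and> b_form X X = 1 \<and> y = u_capacity \<Omega> Ke (pfun X)" if y: "y \<in> ?S" for y
  proof -
    from y obtain u where u: "y = u_capacity \<Omega> Ke u" "u \<in> dir_eigenspace \<Omega> lam" "l2_inner u u = 1" by blast
    then obtain X where X: "eigen_pair \<Omega> lam X" "pfun X = u" using dir_eigenspace_iff by blast
    then have "X \<in> H1 \<Omega>" by (simp add: eigen_pair_def)
    then have "b_form X X = 1" using forms_eq(2)[of X \<Omega> X \<Omega>] X u by simp
    then show ?thesis using X u by blast
  qed
  have le: "y \<le> (\<Sum>j<m. q.nrm (V j))\<^sup>2" if yS: "y \<in> ?S" for y
  proof -
    obtain X where X: "eigen_pair \<Omega> lam X" "b_form X X = 1" "y = u_capacity \<Omega> Ke (pfun X)"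
      using of_S[OF yS] by blast
    have XH: "X \<in> H1 \<Omega>" using X(1) by (simp add: eigen_pair_def)
    define Z W where "Z = (\<Sum>j<m. b_form X (e j) *\<^sub>R e j)" and "W = (\<Sum>j<m. b_form X (e j) *\<^sub>R V j)"
    have ZH: "Z \<in> H1 \<Omega>" unfolding Z_def using e(1) by (intro H1_sum) (auto simp: eigen_pair_def)
    \<comment> \<open>\<open>X\<close> and its expansion \<open>Z\<close> differ by an
      \<open>L\<^sup>2\<close>-null pair, which is then \<open>H\<^sup>1\<close>-null and belongs to
      every \<open>H1\<close> space. So a potential of \<open>Z\<close> is also one of
      \<open>X\<close>.\<close>
    have "b_form (X - Z) (X - Z) = 0"
      using span[OF X(1), of "X - Z"] unfolding Z_def[symmetric] by (simp add: b.lin)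
    then have null: "h.nrm (X - Z) = 0" using XH ZH by (intro H1_b_null subspace_diff[OF H1_subspace])
    have ZW: "is_potential \<Omega> Ke Z W" unfolding Z_def W_def by (rule is_potential_sum) (simp add: V)
    have "X - W = (X - Z) + (Z - W)" by simp
    also have "\<dots> \<in> H1 (\<Omega> - Ke)"
      using ZW null_H1[OF null] by (intro subspace_add[OF H1_subspace]) (auto simp: is_potential_def)
    finally have "is_potential \<Omega> Ke X W" using ZW by (simp add: is_potential_def)
    then have y: "y = q_form W W" using u_capacity_eq[OF XH] X(3) by simp
    have "(\<Sum>j<m. (b_form X (e j))\<^sup>2) \<le> 1\<^sup>2" using b.bessel[OF e(2), of X] X(2) by simp
    then have "q.nrm W \<le> 1 * (\<Sum>j<m. q.nrm (V j))" unfolding W_def by (rule q.nrm_sum_unit) simp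
    then show ?thesis unfolding y by (subst q.nrm_le_iff[symmetric]) (auto intro!: sum_nonneg q.nrm_nonneg)
  qed
  have bdd: "bdd_above ?S" using le by (rule bdd_aboveI)
  show up: "q_form W W \<le> chi2 \<Omega> Ke lam"
    if "eigen_pair \<Omega> lam X" "b_form X X = 1" "is_potential \<Omega> Ke X W" for X W
    unfolding chi2_def by (rule cSup_upper[OF in_S[OF that] bdd])
  have e0: "b_form (e 0) (e 0) = 1" using e(2) m by (simp add: b.ortho_def)
  show "0 \<le> chi2 \<Omega> Ke lam"
    using up[OF e(1)[OF m] e0 V[OF m]] q.nonneg[of "V 0"] by linarith
  show "chi2 \<Omega> Ke lam \<le> (\<Sum>j<m. q.nrm (V j))\<^sup>2"
    unfolding chi2_def by (rule cSup_least) (use in_S[OF e(1)[OF m] e0 V[OF m]] le in blast)+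
qed

text \<open>\<open>f\<close> and \<open>c\<close> are tied to the basis only through
  \<open>b\<close>-orthogonality to all of its members. By the two span conditions this is
  orthogonality to the eigenspace, whichever basis is used.\<close>

lemma degenerate_value_basis_change:
  assumes "degenerate_value q_form b_form (H1 \<Omega>) lam m n e f D c"
    and e': "\<And>j. j < m \<Longrightarrow> eigen_pair \<Omega> lam (e' j)" "b.ortho m e'"
    and span: "\<And>X Y. eigen_pair \<Omega> lam X \<Longrightarrow> b_form Y X = b_form Y (\<Sum>j<m. b_form X (e j) *\<^sub>R e j)"
    and span': "\<And>X Y. eigen_pair \<Omega> lam X \<Longrightarrow> b_form Y X = b_form Y (\<Sum>j<m. b_form X (e' j) *\<^sub>R e' j)"
  shows "degenerate_value q_form b_form (H1 \<Omega>) lam m n e' f D c"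
proof -
  interpret d: degenerate_value q_form b_form "H1 \<Omega>" lam m n e f D c by fact
  have e: "eigen_pair \<Omega> lam (e j)" if "j < m" for j
    using d.e_in[OF that] d.e_eigen[OF that] by (simp add: eigen_pair_def)
  have zero: "b_form Y (e' j) = 0" if "\<forall>j<m. b_form Y (e j) = 0" "j < m" for Y j
    using span[OF e'(1)[OF that(2)], of Y] that(1) by (simp add: b.rsum b.lin)
  have zero': "b_form Y (e j) = 0" if "\<forall>j<m. b_form Y (e' j) = 0" "j < m" for Y j
    using span'[OF e[OF that(2)], of Y] that(1) by (simp add: b.rsum b.lin)
  show ?thesis
  proof unfold_locales
    show "e' j \<in> H1 \<Omega>" if "j < m" for j using e'(1)[OF that] by (simp add: eigen_pair_def)
    show "q_form (e' j) v = lam * b_form (e' j) v" if "j < m" "v \<in> H1 \<Omega>" for j v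
      using e'(1)[OF that(1)] that(2) by (simp add: eigen_pair_def)
    show "b_form (f i) (e' j) = 0" if "i < n" "j < m" for i j using zero d.fe that by blast
    show "c * b_form g g \<le> q_form g g - lam * b_form g g"
      if "g \<in> H1 \<Omega>" "\<forall>i<n. q_form g (f i) - lam * b_form g (f i) = 0" "\<forall>j<m. b_form g (e' j) = 0" for g
      using d.coercive[OF that(1,2)] zero'[OF that(3)] by blast
  qed (use d.H d.lam_nonneg e'(2) d.f_in d.f_ortho d.D d.c_pos in auto)
qed

section \<open>Asymptotics of the perturbed Dirichlet eigenvalues\<close>

theorem theorem1p9:
  fixes \<Omega> K :: "'a::euclidean_space set"
    and Ks :: "real \<Rightarrow> 'a set"
    and N m :: nat
    and \<mu> :: "real \<Rightarrow> nat \<Rightarrow> real"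
  assumes "DIM('a) \<ge> 2"
    and "bounded \<Omega>" and "open \<Omega>"
    and "compact K" and "K \<subseteq> \<Omega>" and "capacity \<Omega> K = 0"
    and "\<forall>\<epsilon>>0. compact (Ks \<epsilon>) \<and> Ks \<epsilon> \<subseteq> \<Omega>"
    and "concentrates_to \<Omega> Ks K"
    and "N \<ge> 1" and "m \<ge> 1"
    and "N = 1 \<or> dir_eigenvalue \<Omega> (N - 1) < dir_eigenvalue \<Omega> N"
    and "\<forall>j<m. dir_eigenvalue \<Omega> (N + j) = dir_eigenvalue \<Omega> N"
    and "dir_eigenvalue \<Omega> N < dir_eigenvalue \<Omega> (N + m)"
    and "\<forall>\<epsilon>>0. r_eigenvalues \<Omega> (Ks \<epsilon>) (dir_eigenvalue \<Omega> N) m (\<mu> \<epsilon>)"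
  shows "\<forall>i\<in>{1..m}.
    (\<lambda>\<epsilon>. dir_eigenvalue (\<Omega> - Ks \<epsilon>) (N + i - 1) - dir_eigenvalue \<Omega> N - \<mu> \<epsilon> i)
      \<in> o[at_right 0](\<lambda>\<epsilon>. chi2 \<Omega> (Ks \<epsilon>) (dir_eigenvalue \<Omega> N))"
proof -
  note \<Omega> = assms(2,3) and K = assms(4-6) and conc = assms(8)
  obtain n where N: "N = Suc n" using assms(9) by (cases N) auto
  define lam where "lam = dir_eigenvalue \<Omega> N"
  have lam_eq: "lam = minmax (H1 \<Omega>) (Suc n)" by (simp add: lam_def dir_eigenvalue_eq N)
  have gap1: "n = 0 \<or> minmax (H1 \<Omega>) n < lam" using assms(11) by (auto simp: lam_def dir_eigenvalue_eq N)
  have gap2: "lam < minmax (H1 \<Omega>) (Suc n + m)" using assms(13) by (simp add: lam_def dir_eigenvalue_eq N)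
  define P where "P \<epsilon> e \<longleftrightarrow> (\<forall>j<m. eigen_pair \<Omega> lam (e j)) \<and> b.ortho m e \<and>
    (\<forall>X Y. eigen_pair \<Omega> lam X \<longrightarrow> b_form Y X = b_form Y (\<Sum>j<m. b_form X (e j) *\<^sub>R e j)) \<and>
    (\<forall>i j V W. i < m \<longrightarrow> j < m \<longrightarrow> is_potential \<Omega> (Ks \<epsilon>) (e i) V \<longrightarrow> is_potential \<Omega> (Ks \<epsilon>) (e j) W \<longrightarrow>
      q_form V W - lam * b_form V W = (if i = j then \<mu> \<epsilon> (Suc i) else 0))" for \<epsilon> and e :: "nat \<Rightarrow> 'a pair_space"
  have "\<exists>e. P \<epsilon> e" if \<epsilon>: "\<epsilon> > 0" for \<epsilon>
  proof (rule r_eigenvalues_basis[OF \<Omega>(1)])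
    show "r_eigenvalues \<Omega> (Ks \<epsilon>) lam m (\<mu> \<epsilon>)" using assms(14) \<epsilon> by (simp add: lam_def)
  qed (unfold P_def, blast)
  \<comment> \<open>One basis for each \<epsilon>, without any continuity. The one for \<epsilon> =
    1 serves as a fixed reference.\<close>
  then obtain e where "\<And>\<epsilon>. \<epsilon> > 0 \<Longrightarrow> P \<epsilon> (e \<epsilon>)" by metis
  then have e: "\<And>\<epsilon> j. \<epsilon> > 0 \<Longrightarrow> j < m \<Longrightarrow> eigen_pair \<Omega> lam (e \<epsilon> j)" "\<And>\<epsilon>. \<epsilon> > 0 \<Longrightarrow> b.ortho m (e \<epsilon>)"
    "\<And>\<epsilon> X Y. \<epsilon> > 0 \<Longrightarrow> eigen_pair \<Omega> lam X \<Longrightarrow> b_form Y X = b_form Y (\<Sum>j<m. b_form X (e \<epsilon> j) *\<^sub>R e \<epsilon> j)"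
    "\<And>\<epsilon> i j V W. \<epsilon> > 0 \<Longrightarrow> i < m \<Longrightarrow> j < m \<Longrightarrow> is_potential \<Omega> (Ks \<epsilon>) (e \<epsilon> i) V \<Longrightarrow>
      is_potential \<Omega> (Ks \<epsilon>) (e \<epsilon> j) W \<Longrightarrow> q_form V W - lam * b_form V W = (if i = j then \<mu> \<epsilon> (Suc i) else 0)"
    unfolding P_def by blast+
  have m: "0 < m" using assms(10) by simp
  have eH: "e \<epsilon> j \<in> H1 \<Omega>" if "\<epsilon> > 0" "j < m" for \<epsilon> j using e(1)[OF that] by (simp add: eigen_pair_def)
  \<comment> \<open>As \<open>m\<close> is positive there is a normalised eigenfunction, and its
    energy is \<open>lam\<close>.\<close>
  have lam0: "0 \<le> lam"
  proof -
    have "q_form (e 1 0) (e 1 0) = lam * b_form (e 1 0) (e 1 0)"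
      using e(1)[of 1 0] m by (simp add: eigen_pair_def)
    moreover have "b_form (e 1 0) (e 1 0) = 1" using e(2)[of 1] m by (simp add: b.ortho_def)
    ultimately show ?thesis using q.nonneg[of "e 1 0"] by simp
  qed
  have null: "q_form X X = 0" if "X \<in> H1 \<Omega>" "b_form X X = 0" for X
    using H1_b_null[OF that] q_le_h[of X] q.nrm_nonneg[of X] q.nrm_sq[of X] by simp
  obtain f D c where deg1: "degenerate_value q_form b_form (H1 \<Omega>) lam m n (e 1) f D c"
  proof (rule degenerate_value_exists[OF H1_subspace null lam0 lam_eq gap1 gap2])
    show "\<forall>j<m. e 1 j \<in> H1 \<Omega>" using eH by simp
    show "b.ortho m (e 1)" by (rule e) simp
    show "q_form (e 1 j) v = lam * b_form (e 1 j) v" if "j < m" "v \<in> H1 \<Omega>" for j v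
      using e(1)[of 1 j] that by (simp add: eigen_pair_def)
  qed
  interpret d1: degenerate_value q_form b_form "H1 \<Omega>" lam m n "e 1" f D c by (rule deg1)
  have deg: "degenerate_value q_form b_form (H1 \<Omega>) lam m n (e \<epsilon>) f D c" if "\<epsilon> > 0" for \<epsilon>
    using deg1 e(1)[OF that] e(2)[OF that] e(3)[OF zero_less_one] e(3)[OF that]
    by (rule degenerate_value_basis_change)
  have main: "eventually (\<lambda>\<epsilon>. \<forall>i<m. \<bar>minmax (H1 (\<Omega> - Ks \<epsilon>)) (n + Suc i) - lam - \<mu> \<epsilon> (Suc i)\<bar>
      \<le> \<tau> * chi2 \<Omega> (Ks \<epsilon>) lam) (at_right 0)" if \<tau>: "0 < \<tau>" for \<tau>
  proof -
    obtain \<kappa>0 where \<kappa>0: "0 < \<kappa>0" and conclusion: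
      "\<And>(H :: 'a pair_space set) m e f M we wf k x \<mu> i. perturbed_value q_form b_form H lam m n e f D c M we wf k x \<mu> \<Longrightarrow>
        k \<le> \<kappa>0 \<Longrightarrow> x \<le> \<kappa>0 \<Longrightarrow> i < m \<Longrightarrow> \<bar>minmax M (n + Suc i) - lam - \<mu> i\<bar> \<le> \<tau> * x\<^sup>2"
      using minmax_perturbation[OF lam0 d1.D(1) d1.c_pos \<tau>, of n] by blast
    define \<kappa> where "\<kappa> = min \<kappa>0 1"
    have \<kappa>: "0 < \<kappa>" "\<kappa> \<le> \<kappa>0" "\<kappa> \<le> 1" using \<kappa>0 by (auto simp: \<kappa>_def)
    have ev1: "eventually (\<lambda>\<epsilon>. \<forall>v\<in>H1 \<Omega>. (\<forall>y\<in>H1 (\<Omega> - Ks \<epsilon>). q_form v y = 0) \<longrightarrow> b.nrm v \<le> \<kappa> * q.nrm v) (at_right 0)"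
      by (rule complement_small[OF \<Omega> K conc \<kappa>(1)])
    \<comment> \<open>The \<open>n\<close> norms have to add up to at most \<kappa>; dividing by
      \<open>n + 1\<close> also covers \<open>n = 0\<close>.\<close>
    have "eventually (\<lambda>\<epsilon>. \<forall>j\<in>{..<n}. \<forall>V. is_potential \<Omega> (Ks \<epsilon>) (f j) V \<longrightarrow> q.nrm V \<le> \<kappa> / real (n + 1)) (at_right 0)"
      using \<kappa> by (intro eventually_ball_finite ballI potential_small[OF \<Omega> K conc]) (auto simp: d1.f_in)
    \<comment> \<open>The smallness of potentials concerns fixed functions, so it is applied to the
      reference basis and not to the basis moving with \<epsilon>.\<close>
    moreover have "eventually (\<lambda>\<epsilon>. \<forall>j\<in>{..<m}. \<forall>V. is_potential \<Omega> (Ks \<epsilon>) (e 1 j) V \<longrightarrow> q.nrm V \<le> \<kappa> / real (m + 1)) (at_right 0)"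
      using \<kappa> by (intro eventually_ball_finite ballI potential_small[OF \<Omega> K conc]) (auto simp: eH)
    moreover have "eventually (\<lambda>\<epsilon>::real. 0 < \<epsilon>) (at_right 0)" by (rule eventually_at_right_less)
    ultimately show ?thesis using ev1
    proof eventually_elim
      case (elim \<epsilon>)
      note ef = elim(1) and ee = elim(2) and \<epsilon> = elim(3) and sm = elim(4)
      let ?K = "Ks \<epsilon>"
      define pot where "pot X = (SOME V. is_potential \<Omega> ?K X V)" for X
      have pot: "is_potential \<Omega> ?K X (pot X)" if "X \<in> H1 \<Omega>" for X
        unfolding pot_def by (rule someI_ex[OF potential_exists[OF \<Omega>(1) that]])
      have pote: "is_potential \<Omega> ?K (e \<epsilon> j) (pot (e \<epsilon> j))" if "j < m" for j by (rule pot[OF eH[OF \<epsilon> that]])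
      have pot1: "is_potential \<Omega> ?K (e 1 j) (pot (e 1 j))" if "j < m" for j
        by (rule pot[OF eH[OF zero_less_one that]])
      have potf: "is_potential \<Omega> ?K (f j) (pot (f j))" if "j < n" for j by (rule pot[OF d1.f_in[OF that]])
      have sum_le: "(\<Sum>j<l. q.nrm (g j)) \<le> \<kappa>" if "\<forall>j<l. q.nrm (g j) \<le> \<kappa> / real (l + 1)" for l and g :: "nat \<Rightarrow> 'a pair_space"
      proof -
        have "(\<Sum>j<l. q.nrm (g j)) \<le> (\<Sum>j<l. \<kappa> / real (l + 1))" using that by (intro sum_mono) auto
        also have "\<dots> \<le> \<kappa>" using \<kappa>(1) by (simp add: field_simps)
        finally show ?thesis .
      qed
      \<comment> \<open>Two descriptions of the same supremum: the reference basis shows that it is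
        small, the moving basis is the one whose potentials it has to bound.\<close>
      note chi1 = chi2_bounds[OF \<Omega>(1) m e(1)[OF zero_less_one] e(2)[OF zero_less_one] e(3)[OF zero_less_one] pot1]
      note chi\<epsilon> = chi2_bounds[OF \<Omega>(1) m e(1)[OF \<epsilon>] e(2)[OF \<epsilon>] e(3)[OF \<epsilon>] pote]
      define x where "x = sqrt (chi2 \<Omega> ?K lam)"
      have x2: "x\<^sup>2 = chi2 \<Omega> ?K lam" using chi1(2) by (simp add: x_def)
      have "(\<Sum>j<m. q.nrm (pot (e 1 j))) \<le> \<kappa>" using ee pot1 by (intro sum_le) auto
      then have "(\<Sum>j<m. q.nrm (pot (e 1 j)))\<^sup>2 \<le> \<kappa>\<^sup>2" by (intro power_mono sum_nonneg q.nrm_nonneg)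
      then have x: "0 \<le> x" "x \<le> \<kappa>"
        using chi1(2,3) \<kappa>(1) by (auto simp: x_def intro!: real_le_lsqrt)
      have "perturbed_value q_form b_form (H1 \<Omega>) lam m n (e \<epsilon>) f D c (H1 (\<Omega> - ?K))
        (\<lambda>j. pot (e \<epsilon> j)) (\<lambda>j. pot (f j)) \<kappa> x (\<lambda>i. \<mu> \<epsilon> (Suc i))"
      proof (rule perturbed_value.intro[OF deg[OF \<epsilon>]], unfold_locales)
        show "subspace (H1 (\<Omega> - ?K))" by (rule H1_subspace)
        show "H1 (\<Omega> - ?K) \<subseteq> H1 \<Omega>" by (rule H1_mono) auto
        show "pot (e \<epsilon> j) \<in> H1 \<Omega>" "e \<epsilon> j - pot (e \<epsilon> j) \<in> H1 (\<Omega> - ?K)" if "j < m" for j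
          using pote[OF that] by (auto simp: is_potential_def)
        show "q_form (pot (e \<epsilon> j)) v = 0" if "j < m" "v \<in> H1 (\<Omega> - ?K)" for j v
          using pote[OF that(1)] that(2) by (auto simp: is_potential_def)
        show "pot (f j) \<in> H1 \<Omega>" "f j - pot (f j) \<in> H1 (\<Omega> - ?K)" if "j < n" for j
          using potf[OF that] by (auto simp: is_potential_def)
        show "q_form (pot (f j)) v = 0" if "j < n" "v \<in> H1 (\<Omega> - ?K)" for j v
          using potf[OF that(1)] that(2) by (auto simp: is_potential_def)
        show "0 \<le> \<kappa>" "\<kappa> \<le> 1" "0 \<le> x" "x \<le> 1" using \<kappa> x by auto
        show "b.nrm v \<le> \<kappa> * q.nrm v" if "v \<in> H1 \<Omega>" "\<forall>y\<in>H1 (\<Omega> - ?K). q_form v y = 0" for v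
          using sm that by blast
        show "q_form (pot (e \<epsilon> i)) (pot (e \<epsilon> j)) - lam * b_form (pot (e \<epsilon> i)) (pot (e \<epsilon> j))
            = (if i = j then \<mu> \<epsilon> (Suc i) else 0)" if "i < m" "j < m" for i j
          by (rule e(4)[OF \<epsilon> that pote[OF that(1)] pote[OF that(2)]])
        show "\<mu> \<epsilon> (Suc i) \<le> \<mu> \<epsilon> (Suc j)" if "i \<le> j" "j < m" for i j
        proof -
          have "r_eigenvalues \<Omega> ?K lam m (\<mu> \<epsilon>)" using assms(14) \<epsilon> by (simp add: lam_def)
          then have "\<forall>i j. 1 \<le> i \<and> i \<le> j \<and> j \<le> m \<longrightarrow> \<mu> \<epsilon> i \<le> \<mu> \<epsilon> j" unfolding r_eigenvalues_def by blast
          then show ?thesis using that by simp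
        qed
        show "q.nrm (\<Sum>j<n. d j *\<^sub>R pot (f j)) \<le> \<kappa> * sqrt (\<Sum>j<n. (d j)\<^sup>2)" for d
        proof -
          have "q.nrm (\<Sum>j<n. d j *\<^sub>R pot (f j)) \<le> sqrt (\<Sum>j<n. (d j)\<^sup>2) * (\<Sum>j<n. q.nrm (pot (f j)))"
            by (rule q.nrm_sum_unit) (auto simp: sum_nonneg)
          also have "\<dots> \<le> sqrt (\<Sum>j<n. (d j)\<^sup>2) * \<kappa>"
            using ef potf by (intro mult_left_mono sum_le) (auto simp: sum_nonneg)
          finally show ?thesis by (simp add: mult.commute)
        qed
        show "q.nrm (\<Sum>j<m. d j *\<^sub>R pot (e \<epsilon> j)) \<le> x * sqrt (\<Sum>j<m. (d j)\<^sup>2)" for d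
        proof (cases "(\<Sum>j<m. (d j)\<^sup>2) = 0")
          case True
          then have "\<forall>j<m. d j = 0" by (simp add: sum_nonneg_eq_0_iff)
          then show ?thesis using True by (simp add: q.nrm_zero)
        next
          case False
          define s where "s = (\<Sum>j<m. (d j)\<^sup>2)"
          have s: "0 < s" using False sum_nonneg[of "{..<m}" "\<lambda>j. (d j)\<^sup>2"] by (simp add: s_def less_le)
          \<comment> \<open>After normalising the coefficients, the combination of potentials is the
            potential of a normalised eigenfunction, so its energy is at most
            \<open>chi2\<close>.\<close>
          define X where "X = (\<Sum>j<m. (d j / sqrt s) *\<^sub>R e \<epsilon> j)"
          define W where "W = (\<Sum>j<m. (d j / sqrt s) *\<^sub>R pot (e \<epsilon> j))"
          have "eigen_pair \<Omega> lam X" unfolding X_def by (rule eigen_pair_sum) (simp add: e(1)[OF \<epsilon>])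
          moreover have "b_form X X = 1"
          proof -
            have "b_form X X = (\<Sum>j<m. (d j)\<^sup>2 / s)"
              unfolding X_def b.ortho_sum[OF e(2)[OF \<epsilon>]] using s
              by (intro sum.cong) (auto simp: power2_eq_square[symmetric] power_divide)
            then show ?thesis using s by (simp add: s_def[symmetric] flip: sum_divide_distrib)
          qed
          moreover have "is_potential \<Omega> ?K X W" unfolding X_def W_def by (rule is_potential_sum) (simp add: pote)
          ultimately have "q_form W W \<le> x\<^sup>2" using chi\<epsilon>(1) x2 by metis
          then have "q.nrm W \<le> x" using x by (simp add: q.nrm_le_iff)
          moreover have "(\<Sum>j<m. d j *\<^sub>R pot (e \<epsilon> j)) = sqrt s *\<^sub>R W"
            using s by (simp add: W_def scaleR_sum_right)
          ultimately show ?thesis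
            using s by (simp add: q.nrm_scale mult.commute mult_left_mono flip: s_def)
        qed
      qed
      from conclusion[OF this \<kappa>(2)] x \<kappa>(2) show ?case by (simp add: x2)
    qed
  qed
  show ?thesis
  proof
    fix i assume i: "i \<in> {1..m}"
    \<comment> \<open>The indices of \<mu> start at 1 and those of the abstract bounds at 0; with
      \<open>N = Suc n\<close> the index \<open>N + i - 1\<close> is
      \<open>n + Suc j\<close>.\<close>
    then obtain j where j: "i = Suc j" "j < m" by (cases i) auto
    show "(\<lambda>\<epsilon>. dir_eigenvalue (\<Omega> - Ks \<epsilon>) (N + i - 1) - dir_eigenvalue \<Omega> N - \<mu> \<epsilon> i)
      \<in> o[at_right 0](\<lambda>\<epsilon>. chi2 \<Omega> (Ks \<epsilon>) (dir_eigenvalue \<Omega> N))"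
    proof (rule landau_o.smallI)
      fix \<tau> :: real assume "\<tau> > 0"
      from main[OF this] show "eventually (\<lambda>\<epsilon>. norm (dir_eigenvalue (\<Omega> - Ks \<epsilon>) (N + i - 1) - dir_eigenvalue \<Omega> N - \<mu> \<epsilon> i)
          \<le> \<tau> * norm (chi2 \<Omega> (Ks \<epsilon>) (dir_eigenvalue \<Omega> N))) (at_right 0)"
      proof eventually_elim
        case (elim \<epsilon>)
        have "\<bar>minmax (H1 (\<Omega> - Ks \<epsilon>)) (n + Suc j) - lam - \<mu> \<epsilon> (Suc j)\<bar> \<le> \<tau> * chi2 \<Omega> (Ks \<epsilon>) lam"
          using elim j(2) by blast
        also have "\<dots> \<le> \<tau> * \<bar>chi2 \<Omega> (Ks \<epsilon>) lam\<bar>" using \<open>\<tau> > 0\<close> by (intro mult_left_mono) auto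
        finally show ?case by (simp add: lam_def N j(1) dir_eigenvalue_eq)
      qed
    qed
  qed
qed

end
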